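(* Let $\mathbf{S}$ be any fixed schema and $k\ge 0$. The class of all $k$-ary conjunctive queries (CQs) over $\mathbf{S}$ is efficiently PAC learnable with membership queries. Likewise, the class of all $k$-ary unions of conjunctive queries (UCQs) over $\mathbf{S}$ is efficiently PAC learnable with membership queries.
   Context: Queries. A schema $\mathbf{S}$ is a finite set of relation symbols with associated arities. An instance over $\mathbf{S}$ is a finite set of facts $R(a_1,\dots,a_n)$ with $R\in\mathbf{S}$ $n$-ary and $a_1,\dots,a_n$ values; its active domain $\mathrm{adom}(I)$ is the set of values occurring in its facts. A $k$-ary CQ over $\mathbf{S}$ is an expression $q(\mathbf{x}) := \exists\mathbf{y}(\alpha_1\wedge\cdots\wedge\alpha_n)$ where $\mathbf{x}$ is a $k$-tuple of variables, each $\alpha_i$ is an atomic formula using a relation symbol from $\mathbf{S}$ and only variables from $\mathbf{x},\mathbf{y}$, and each variable of $\mathbf{x}$ occurs in some conjunct. A $k$-ary UCQ over $\mathbf{S}$ is a non-empty finite disjunction of $k$-ary CQs over $\mathbf{S}$. $q(I)$ is the set of $k$-tuples $\mathbf{a}$ with $I\models q(\mathbf{a})$. Concept classes. A concept class is a triple $(\Phi,\mathit{Ex},\models)$ with $\Phi$ a set of concepts, $\mathit{Ex}$ a set of examples, ${\models}\subseteq \mathit{Ex}\times\Phi$; concepts and examples have effective representations with sizes $|\phi|$, $|e|$. $\mathit{lab}_\phi(e)=+$ if $e\models\phi$ and $-$ otherwise. $\Phi_{(n)}$, $\mathit{Ex}_{(m)}$ are the sets of concepts of size at most $n$ and examples of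 size at most $m$. A class $C$ of $k$-ary (U)CQs over $\mathbf{S}$ is viewed as the concept class $(C,\mathit{Ex},\models)$ where $\mathit{Ex}$ consists of all pairs $(I,\mathbf{a})$ with $I$ an $\mathbf{S}$-instance and $\mathbf{a}$ a $k$-tuple over $\mathrm{adom}(I)$, and $(I,\mathbf{a})\models q$ iff $\mathbf{a}\in q(I)$. PAC learning with membership queries. A membership oracle $\mathit{MEMB}_{\phi}$ for a concept $\phi$ is an oracle that, given any unlabeled example $e$, returns in unit time $\mathit{lab}_\phi(e)$. An example distribution is a probability distribution $D$ over $\mathit{Ex}$; $\mathrm{error}_{D,\phi^*}(\phi)=\Pr_{e\in D}(\mathit{lab}_\phi(e)\neq\mathit{lab}_{\phi^*}(e))$. A concept class is efficiently PAC learnable with membership queries if there is a pair $(A,f)$ where $A$ is a randomized polynomial-time algorithm that takes as input a collection (sample) of labeled examples, has access to a membership oracle for the target concept, and outputs a concept of the class, and $f$ is a polynomial function in four arguments such that for all $\delta,\epsilon\in(0,1)$, all $n,m\in\mathbb{N}$, all example distributions $D$ over $\mathit{Ex}_{(m)}$, and all target concepts $\phi^*\in\Phi_{(n)}$: if the input consists of at least $f(1/\delta,1/\epsilon,n,m)$ examples drawn from $D$ and labeled according to $\phi^*$, and the oracle is $\mathit{MEMB}_{\phi^*}$, then with probability at least $1-\delta$, $A$ outputs a concept $\phi$ with $\mathrm{error}_{D,\phi^*}(\phi)\le\epsilon$. *)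

theory Defs
  imports "HOL-Probability.Probability"
begin

section \<open>Randomized oracle computation\<close>

text \<open>
  The machine model is a WHILE language in the style of Jones ("Computability and Complexity
  from a Programming Perspective"): programs manipulate binary trees, toss fair coins, and put
  questions to an oracle. Reading a variable is charged the full size of its value, so the cost
  of an evaluation bounds the size of everything it builds, and this cost is polynomially
  related to the running time of a probabilistic oracle Turing machine.
\<close>

datatype data = Leaf | Node data data

text \<open>The library function \<open>size\<close> counts the inner nodes of a tree.\<close>

primrec enc_bool :: "bool \<Rightarrow> data" where
  "enc_bool False = Leaf"
| "enc_bool True = Node Leaf Leaf"

primrec enc_list :: "('a \<Rightarrow> data) \<Rightarrow> 'a list \<Rightarrow> data" where
  "enc_list f [] = Leaf"
| "enc_list f (x # xs) = Node (f x) (enc_list f xs)"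

primrec left :: "data \<Rightarrow> data" where
  "left Leaf = Leaf"
| "left (Node a b) = a"

primrec right :: "data \<Rightarrow> data" where
  "right Leaf = Leaf"
| "right (Node a b) = b"

text \<open>
  Variables are de Bruijn indices into an environment. \<open>LetIn a b\<close> evaluates \<open>b\<close> with the value
  of \<open>a\<close> pushed as variable 0. \<open>While c b\<close> repeats the assignment of \<open>b\<close> to variable 0 as long as
  \<open>c\<close> is not \<open>Leaf\<close>; its value is the final content of variable 0.
\<close>

datatype program =
    Var nat
  | Nul
  | Pair program program
  | Lft program
  | Rgt program
  | Equal program program
  | Cond program program program
  | LetIn program program
  | While program program
  | Flip
  | Query program

text \<open>
  \<open>eval M \<rho> P \<omega> v \<omega>' t\<close>: with oracle \<open>M\<close>, environment \<open>\<rho>\<close> and the coin tosses \<open>\<omega>\<close> still to come,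
  \<open>P\<close> terminates with value \<open>v\<close> at cost \<open>t\<close>, leaving the coin tosses \<open>\<omega>'\<close>.
\<close>

inductive eval ::
  "(data \<Rightarrow> bool) \<Rightarrow> data list \<Rightarrow> program \<Rightarrow> bool stream \<Rightarrow> data \<Rightarrow> bool stream \<Rightarrow> nat \<Rightarrow> bool"
  for M :: "data \<Rightarrow> bool"
where
  Var: "i < length \<rho> \<Longrightarrow> eval M \<rho> (Var i) \<omega> (\<rho> ! i) \<omega> (1 + size (\<rho> ! i))"
| Nul: "eval M \<rho> Nul \<omega> Leaf \<omega> 1"
| Pair: "eval M \<rho> a \<omega> v \<omega>' s \<Longrightarrow> eval M \<rho> b \<omega>' w \<omega>'' t
    \<Longrightarrow> eval M \<rho> (Pair a b) \<omega> (Node v w) \<omega>'' (s + t + 1)"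
| Lft: "eval M \<rho> a \<omega> v \<omega>' t \<Longrightarrow> eval M \<rho> (Lft a) \<omega> (left v) \<omega>' (t + 1)"
| Rgt: "eval M \<rho> a \<omega> v \<omega>' t \<Longrightarrow> eval M \<rho> (Rgt a) \<omega> (right v) \<omega>' (t + 1)"
| Equal: "eval M \<rho> a \<omega> v \<omega>' s \<Longrightarrow> eval M \<rho> b \<omega>' w \<omega>'' t
    \<Longrightarrow> eval M \<rho> (Equal a b) \<omega> (enc_bool (v = w)) \<omega>'' (s + t + 1)"
| Cond_True: "eval M \<rho> c \<omega> v \<omega>' s \<Longrightarrow> v \<noteq> Leaf \<Longrightarrow> eval M \<rho> a \<omega>' w \<omega>'' t
    \<Longrightarrow> eval M \<rho> (Cond c a b) \<omega> w \<omega>'' (s + t + 1)"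
| Cond_False: "eval M \<rho> c \<omega> Leaf \<omega>' s \<Longrightarrow> eval M \<rho> b \<omega>' w \<omega>'' t
    \<Longrightarrow> eval M \<rho> (Cond c a b) \<omega> w \<omega>'' (s + t + 1)"
| LetIn: "eval M \<rho> a \<omega> v \<omega>' s \<Longrightarrow> eval M (v # \<rho>) b \<omega>' w \<omega>'' t
    \<Longrightarrow> eval M \<rho> (LetIn a b) \<omega> w \<omega>'' (s + t + 1)"
| While_stop: "eval M (v # \<rho>) c \<omega> Leaf \<omega>' s
    \<Longrightarrow> eval M (v # \<rho>) (While c b) \<omega> v \<omega>' (s + size v + 1)"
| While_step: "eval M (v # \<rho>) c \<omega> u \<omega>1 r \<Longrightarrow> u \<noteq> Leaf \<Longrightarrow> eval M (v # \<rho>) b \<omega>1 v' \<omega>2 s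
    \<Longrightarrow> eval M (v' # \<rho>) (While c b) \<omega>2 w \<omega>3 t
    \<Longrightarrow> eval M (v # \<rho>) (While c b) \<omega> w \<omega>3 (r + s + t + 1)"
| Flip: "eval M \<rho> Flip \<omega> (enc_bool (shd \<omega>)) (stl \<omega>) 1"
| Query: "eval M \<rho> a \<omega> v \<omega>' t \<Longrightarrow> eval M \<rho> (Query a) \<omega> (enc_bool (M v)) \<omega>' (t + 1)"

definition outputs_within ::
  "program \<Rightarrow> (data \<Rightarrow> bool) \<Rightarrow> data \<Rightarrow> bool stream \<Rightarrow> data \<Rightarrow> nat \<Rightarrow> bool" where
  "outputs_within A M inp \<omega> out t \<longleftrightarrow> (\<exists>\<omega>'. \<exists>t' \<le> t. eval M [inp] A \<omega> out \<omega>' t')"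

definition outputs :: "program \<Rightarrow> (data \<Rightarrow> bool) \<Rightarrow> data \<Rightarrow> bool stream \<Rightarrow> data \<Rightarrow> bool" where
  "outputs A M inp \<omega> out \<longleftrightarrow> (\<exists>t. outputs_within A M inp \<omega> out t)"

definition fair_coins :: "bool stream measure" where
  "fair_coins = stream_space (measure_pmf (bernoulli_pmf (1/2)))"


section \<open>Concept classes and PAC learning with membership queries\<close>

text \<open>
  The effective representation of concepts and examples is a relation between trees and objects,
  since a finite set of facts has no preferred listing. The size of an object is the size of its
  smallest representation.
\<close>

record ('c, 'e) concept_class =
  concepts :: "'c set"
  examples :: "'e set"
  sat :: "'e \<Rightarrow> 'c \<Rightarrow> bool"
  rep_concept :: "data \<Rightarrow> 'c \<Rightarrow> bool"
  rep_example :: "data \<Rightarrow> 'e \<Rightarrow> bool"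

definition concept_size :: "('c, 'e) concept_class \<Rightarrow> 'c \<Rightarrow> nat" where
  "concept_size C \<phi> = (LEAST n. \<exists>d. rep_concept C d \<phi> \<and> size d = n)"

definition example_size :: "('c, 'e) concept_class \<Rightarrow> 'e \<Rightarrow> nat" where
  "example_size C e = (LEAST n. \<exists>d. rep_example C d e \<and> size d = n)"

definition concepts_upto :: "('c, 'e) concept_class \<Rightarrow> nat \<Rightarrow> 'c set" where
  "concepts_upto C n = {\<phi> \<in> concepts C. concept_size C \<phi> \<le> n}"

definition examples_upto :: "('c, 'e) concept_class \<Rightarrow> nat \<Rightarrow> 'e set" where
  "examples_upto C m = {e \<in> examples C. example_size C e \<le> m}"

text \<open>The labels + and - are rendered as \<open>True\<close> and \<open>False\<close>.\<close>

definition lab :: "('c, 'e) concept_class \<Rightarrow> 'c \<Rightarrow> 'e \<Rightarrow> bool" where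
  "lab C \<phi> e \<longleftrightarrow> sat C e \<phi>"

text \<open>Trees that represent no example are answered negatively.\<close>

definition MEMB :: "('c, 'e) concept_class \<Rightarrow> 'c \<Rightarrow> data \<Rightarrow> bool" where
  "MEMB C \<phi> d \<longleftrightarrow> (\<exists>e \<in> examples C. rep_example C d e \<and> lab C \<phi> e)"

definition error :: "('c, 'e) concept_class \<Rightarrow> 'e pmf \<Rightarrow> 'c \<Rightarrow> 'c \<Rightarrow> real" where
  "error C D \<phi>star \<phi> = measure_pmf.prob D {e. lab C \<phi> e \<noteq> lab C \<phi>star e}"

definition enc_sample :: "(data \<times> bool) list \<Rightarrow> data" where
  "enc_sample = enc_list (\<lambda>(d, l). Node d (enc_bool l))"

definition polynomial4 :: "(real \<Rightarrow> real \<Rightarrow> real \<Rightarrow> real \<Rightarrow> real) \<Rightarrow> bool" where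
  "polynomial4 f \<longleftrightarrow> (\<exists>(N :: nat) (c :: nat \<Rightarrow> nat \<Rightarrow> nat \<Rightarrow> nat \<Rightarrow> real). \<forall>w x y z.
     f w x y z = (\<Sum>i\<le>N. \<Sum>j\<le>N. \<Sum>k\<le>N. \<Sum>l\<le>N. c i j k l * w ^ i * x ^ j * y ^ k * z ^ l))"

text \<open>
  The time bound and the requirement that a concept of the class is output hold on all samples
  (even if their labels disagree with the oracle), for all coin tosses.
\<close>

definition poly_time_MQ_algorithm :: "('c, 'e) concept_class \<Rightarrow> program \<Rightarrow> bool" where
  "poly_time_MQ_algorithm C A \<longleftrightarrow> (\<exists>p :: nat poly. \<forall>\<phi>star \<in> concepts C. \<forall>ds \<omega>.
     (\<forall>(d, l) \<in> set ds. \<exists>e \<in> examples C. rep_example C d e) \<longrightarrow>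
     (\<exists>out. \<exists>\<phi> \<in> concepts C. rep_concept C out \<phi> \<and>
        outputs_within A (MEMB C \<phi>star) (enc_sample ds) \<omega> out (poly p (size (enc_sample ds)))))"

text \<open>
  Drawn examples may be presented to the algorithm in any representation \<open>enc\<close>. There are only
  countably many examples of bounded size, so every distribution on them is given by a \<open>pmf\<close>.
\<close>

definition efficiently_PAC_learnable_MQ :: "('c, 'e) concept_class \<Rightarrow> bool" where
  "efficiently_PAC_learnable_MQ C \<longleftrightarrow>
    (\<exists>(A :: program) (f :: real \<Rightarrow> real \<Rightarrow> real \<Rightarrow> real \<Rightarrow> real).
      poly_time_MQ_algorithm C A \<and> polynomial4 f \<and>
      (\<forall>(\<delta> :: real) (\<epsilon> :: real) (n :: nat) (m :: nat) (D :: 'e pmf) (\<phi>star :: 'c)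
          (N :: nat) (enc :: 'e \<Rightarrow> data).
        0 < \<delta> \<and> \<delta> < 1 \<and> 0 < \<epsilon> \<and> \<epsilon> < 1 \<and>
        set_pmf D \<subseteq> examples_upto C m \<and> \<phi>star \<in> concepts_upto C n \<and>
        real N \<ge> f (1 / \<delta>) (1 / \<epsilon>) (real n) (real m) \<and>
        (\<forall>e \<in> examples C. rep_example C (enc e) e)
        \<longrightarrow> \<P>((es, \<omega>) in measure_pmf (replicate_pmf N D) \<Otimes>\<^sub>M fair_coins.
              \<exists>out. \<exists>\<phi> \<in> concepts C. rep_concept C out \<phi> \<and>
                outputs A (MEMB C \<phi>star)
                  (enc_sample (map (\<lambda>e. (enc e, lab C \<phi>star e)) es)) \<omega> out \<and>
                error C D \<phi>star \<phi> \<le> \<epsilon>) \<ge> 1 - \<delta>))"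


section \<open>Conjunctive queries and their unions\<close>

text \<open>Relation symbols, values and variables are named by bit strings.\<close>

type_synonym name = "bool list"

type_synonym schema = "name \<rightharpoonup> nat"

type_synonym fact = "name \<times> name list"
type_synonym atom = "name \<times> name list"

definition over_schema :: "schema \<Rightarrow> name \<times> name list \<Rightarrow> bool" where
  "over_schema S = (\<lambda>(R, ts). S R = Some (length ts))"

definition is_instance :: "schema \<Rightarrow> fact set \<Rightarrow> bool" where
  "is_instance S I \<longleftrightarrow> finite I \<and> (\<forall>F \<in> I. over_schema S F)"

definition adom :: "fact set \<Rightarrow> name set" where
  "adom I = (\<Union>(R, as) \<in> I. set as)"

text \<open>\<open>CQ x \<alpha>s\<close> is \<open>q(x) := \<exists>y(\<alpha>1 \<and> ... \<and> \<alpha>n)\<close>, with \<open>y\<close> the variables of \<open>\<alpha>s\<close> that are not in \<open>x\<close>.\<close>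

datatype cq = CQ (head: "name list") (body: "atom list")

definition is_CQ :: "schema \<Rightarrow> nat \<Rightarrow> cq \<Rightarrow> bool" where
  "is_CQ S k q \<longleftrightarrow> length (head q) = k \<and> body q \<noteq> [] \<and> (\<forall>\<alpha> \<in> set (body q). over_schema S \<alpha>) \<and>
     (\<forall>x \<in> set (head q). \<exists>(R, zs) \<in> set (body q). x \<in> set zs)"

definition cq_answers :: "cq \<Rightarrow> fact set \<Rightarrow> name list set" where
  "cq_answers q I = {as. \<exists>g :: name \<Rightarrow> name. map g (head q) = as \<and>
     (\<forall>(R, zs) \<in> set (body q). (R, map g zs) \<in> I)}"

type_synonym ucq = "cq list"

definition is_UCQ :: "schema \<Rightarrow> nat \<Rightarrow> ucq \<Rightarrow> bool" where
  "is_UCQ S k Q \<longleftrightarrow> Q \<noteq> [] \<and> (\<forall>q \<in> set Q. is_CQ S k q)"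

definition ucq_answers :: "ucq \<Rightarrow> fact set \<Rightarrow> name list set" where
  "ucq_answers Q I = (\<Union>q \<in> set Q. cq_answers q I)"

type_synonym pointed_instance = "fact set \<times> name list"

definition query_examples :: "schema \<Rightarrow> nat \<Rightarrow> pointed_instance set" where
  "query_examples S k = {(I, as). is_instance S I \<and> length as = k \<and> set as \<subseteq> adom I}"

definition enc_name :: "name \<Rightarrow> data" where
  "enc_name = enc_list enc_bool"

definition enc_atom :: "name \<times> name list \<Rightarrow> data" where
  "enc_atom = (\<lambda>(R, ts). Node (enc_name R) (enc_list enc_name ts))"

definition enc_cq :: "cq \<Rightarrow> data" where
  "enc_cq q = Node (enc_list enc_atom (body q)) (enc_list enc_name (head q))"

text \<open>An instance is represented by any list of its facts.\<close>

definition rep_pointed_instance :: "data \<Rightarrow> pointed_instance \<Rightarrow> bool" where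
  "rep_pointed_instance d = (\<lambda>(I, as).
     \<exists>Fs. set Fs = I \<and> d = Node (enc_list enc_atom Fs) (enc_list enc_name as))"

definition CQ_class :: "schema \<Rightarrow> nat \<Rightarrow> (cq, pointed_instance) concept_class" where
  "CQ_class S k =
    \<lparr>concepts = {q. is_CQ S k q},
     examples = query_examples S k,
     sat = (\<lambda>(I, as) q. as \<in> cq_answers q I),
     rep_concept = (\<lambda>d q. d = enc_cq q),
     rep_example = rep_pointed_instance\<rparr>"

definition UCQ_class :: "schema \<Rightarrow> nat \<Rightarrow> (ucq, pointed_instance) concept_class" where
  "UCQ_class S k =
    \<lparr>concepts = {Q. is_UCQ S k Q},
     examples = query_examples S k,
     sat = (\<lambda>(I, as) Q. as \<in> ucq_answers Q I),
     rep_concept = (\<lambda>d Q. d = enc_list enc_cq Q),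
     rep_example = rep_pointed_instance\<rparr>"

end

theory Submission
  imports Defs
begin

text \<open>Hypotheses must be small for two separate reasons. The running time has to be polynomial
  in the sample for every target, although products are nested as deep as the sample is long. The
  cap on facts does not control the names in them: a pairing that enlarged both components by a
  factor could make names exponentially long. \<open>prod_name\<close> therefore copies its left
  component unchanged, and the hypothesis is always the left factor, so names grow only additively.
  Generalisation, on the other hand, requires a bound in the target alone; there names disappear by
  renaming variables, and the facts are bounded by those of the disjuncts or of the initial
  hypothesis. This leaves at most exp (C * n^3) answer functions, and a union bound makes failure at
  most exp (C * n^3 - \<epsilon> * N). The sample size contains 1/\<delta> instead of a logarithm
  because it must be a polynomial. It also forces n \<le> N, so that the cap, which is the sample
  length, never discards a candidate that the correctness argument relies on. Finally, the program
  tosses no coins, so the success event is determined by the sample.\<close>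

text \<open>
  The learner keeps a list of hypotheses, each a conjunctive query read as a pointed instance on
  which the target answers positively; such a query is contained in the target. A positive
  example is merged into every hypothesis whose direct product with it is still positive: the
  product is minimised by deleting facts as long as the membership oracle agrees, and it replaces
  the hypothesis. If there is no such hypothesis, the minimised example becomes a new one. Since
  conjunctive queries are closed under products, every disjunct of the target maps to at most one
  hypothesis, so there are at most as many hypotheses as disjuncts; for a CQ there is always
  exactly one, so the same program learns CQs. Minimised instances have at most as many facts as
  some disjunct, hence the hypotheses come from a class whose cardinality, up to equivalence, is
  exponential in a polynomial of the target size alone, and consistency with the sample suffices
  for PAC learning. No query is ever evaluated. The labels of the sample are not read, because the
  oracle and minimisation reject negative examples anyway, and candidates with more facts than the
  sample has members are discarded, which keeps the running time polynomial in the sample when the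
  target is large.
\<close>

section \<open>Cost-bounded evaluation\<close>

text \<open>Returning the coins unconsumed confines this notion to deterministic runs, whose costs
  compose without tracking streams.\<close>

definition computes :: "(data \<Rightarrow> bool) \<Rightarrow> data list \<Rightarrow> program \<Rightarrow> data \<Rightarrow> nat \<Rightarrow> bool" where
  "computes M \<rho> P v t \<longleftrightarrow> (\<forall>\<omega>. \<exists>t'\<le>t. eval M \<rho> P \<omega> v \<omega> t')"

text \<open>\<open>computes\<close> only yields the existence of one run. Independence of every
  possible output from the coins, without proving \<open>eval\<close> deterministic, comes from this
  syntactic condition.\<close>

primrec flip_free :: "program \<Rightarrow> bool" where
  "flip_free (Var i) = True"
| "flip_free Nul = True"
| "flip_free (Pair a b) = (flip_free a \<and> flip_free b)"
| "flip_free (Lft a) = flip_free a"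
| "flip_free (Rgt a) = flip_free a"
| "flip_free (Equal a b) = (flip_free a \<and> flip_free b)"
| "flip_free (Cond c a b) = (flip_free c \<and> flip_free a \<and> flip_free b)"
| "flip_free (LetIn a b) = (flip_free a \<and> flip_free b)"
| "flip_free (While c b) = (flip_free c \<and> flip_free b)"
| "flip_free Flip = False"
| "flip_free (Query a) = flip_free a"

lemma eval_flip_free:
  assumes "eval M \<rho> P \<omega> v \<omega>' t" "flip_free P"
  shows "eval M \<rho> P \<omega>2 v \<omega>2 t"
  using assms by (induction arbitrary: \<omega>2) (auto intro: eval.intros simp del: One_nat_def)

lemma outputs_flip_free:
  assumes "flip_free A" "outputs A M inp \<omega> out"
  shows "outputs A M inp \<omega>' out"
  using assms eval_flip_free unfolding outputs_def outputs_within_def by blast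

text \<open>Because of this, every cost bound doubles as a size bound on the value; see
  \<open>ptime_size\<close>.\<close>

lemma eval_size: "eval M \<rho> P \<omega> v \<omega>' t \<Longrightarrow> size v \<le> t"
proof (induction rule: eval.induct)
  case (Lft \<rho> a \<omega> v \<omega>' t)
  then show ?case by (cases v) auto
next
  case (Rgt \<rho> a \<omega> v \<omega>' t)
  then show ?case by (cases v) auto
next
  case (Equal \<rho> a \<omega> v \<omega>' s b w \<omega>'' t)
  then show ?case by (cases "v = w") auto
next
  case (Flip \<rho> \<omega>)
  then show ?case by (cases "shd \<omega>") auto
next
  case (Query \<rho> a \<omega> v \<omega>' t)
  then show ?case by (cases "M v") auto
qed auto

lemma computes_size: "computes M \<rho> P v t \<Longrightarrow> size v \<le> t"
  unfolding computes_def using eval_size le_trans by blast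

lemma computes_mono: "computes M \<rho> P v s \<Longrightarrow> s \<le> t \<Longrightarrow> computes M \<rho> P v t"
  unfolding computes_def using le_trans by blast

lemma computesE:
  assumes "computes M \<rho> P v t"
  obtains t' where "t' \<le> t" "eval M \<rho> P \<omega> v \<omega> t'"
  using assms unfolding computes_def by blast

lemma computes_Var: "i < length \<rho> \<Longrightarrow> computes M \<rho> (Var i) (\<rho> ! i) (1 + size (\<rho> ! i))"
  unfolding computes_def using eval.Var by blast

lemma computes_Nul: "computes M \<rho> Nul Leaf 1"
  unfolding computes_def using eval.Nul by blast

lemma computes_Pair:
  assumes "computes M \<rho> a v s" "computes M \<rho> b w t"
  shows "computes M \<rho> (Pair a b) (Node v w) (s + t + 1)"
  unfolding computes_def
proof
  fix \<omega>
  obtain s' t' where "s' \<le> s" "eval M \<rho> a \<omega> v \<omega> s'" "t' \<le> t" "eval M \<rho> b \<omega> w \<omega> t'"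
    using assms by (meson computesE)
  then show "\<exists>r\<le>s + t + 1. eval M \<rho> (Pair a b) \<omega> (Node v w) \<omega> r"
    by (intro exI[of _ "s' + t' + 1"]) (auto intro: eval.Pair simp del: One_nat_def)
qed

lemma computes_Lft: "computes M \<rho> a v t \<Longrightarrow> computes M \<rho> (Lft a) (left v) (t + 1)"
  unfolding computes_def using eval.Lft by (metis add_le_mono1)

lemma computes_Rgt: "computes M \<rho> a v t \<Longrightarrow> computes M \<rho> (Rgt a) (right v) (t + 1)"
  unfolding computes_def using eval.Rgt by (metis add_le_mono1)

lemma computes_Query: "computes M \<rho> a v t \<Longrightarrow> computes M \<rho> (Query a) (enc_bool (M v)) (t + 1)"
  unfolding computes_def using eval.Query by (metis add_le_mono1)

lemma computes_Equal:
  assumes "computes M \<rho> a v s" "computes M \<rho> b w t"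
  shows "computes M \<rho> (Equal a b) (enc_bool (v = w)) (s + t + 1)"
  unfolding computes_def
proof
  fix \<omega>
  obtain s' t' where "s' \<le> s" "eval M \<rho> a \<omega> v \<omega> s'" "t' \<le> t" "eval M \<rho> b \<omega> w \<omega> t'"
    using assms by (meson computesE)
  then show "\<exists>r\<le>s + t + 1. eval M \<rho> (Equal a b) \<omega> (enc_bool (v = w)) \<omega> r"
    by (intro exI[of _ "s' + t' + 1"]) (auto intro: eval.Equal simp del: One_nat_def)
qed

lemma computes_Cond:
  assumes "computes M \<rho> c u s" "u \<noteq> Leaf \<Longrightarrow> computes M \<rho> a w t" "u = Leaf \<Longrightarrow> computes M \<rho> b w t"
  shows "computes M \<rho> (Cond c a b) w (s + t + 1)"
  unfolding computes_def
proof
  fix \<omega>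
  obtain s' where s': "s' \<le> s" "eval M \<rho> c \<omega> u \<omega> s'"
    using assms by (meson computesE)
  show "\<exists>r\<le>s + t + 1. eval M \<rho> (Cond c a b) \<omega> w \<omega> r"
  proof (cases "u = Leaf")
    case True
    then obtain t' where "t' \<le> t" "eval M \<rho> b \<omega> w \<omega> t'"
      using assms by (meson computesE)
    then show ?thesis
      using s' True by (intro exI[of _ "s' + t' + 1"]) (auto intro: eval.Cond_False simp del: One_nat_def)
  next
    case False
    then obtain t' where "t' \<le> t" "eval M \<rho> a \<omega> w \<omega> t'"
      using assms by (meson computesE)
    then show ?thesis
      using s' False by (intro exI[of _ "s' + t' + 1"]) (auto intro: eval.Cond_True simp del: One_nat_def)
  qed
qed

lemma computes_LetIn:
  assumes "computes M \<rho> a v s" "computes M (v # \<rho>) b w t"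
  shows "computes M \<rho> (LetIn a b) w (s + t + 1)"
  unfolding computes_def
proof
  fix \<omega>
  obtain s' t' where "s' \<le> s" "eval M \<rho> a \<omega> v \<omega> s'" "t' \<le> t" "eval M (v # \<rho>) b \<omega> w \<omega> t'"
    using assms by (meson computesE)
  then show "\<exists>r\<le>s + t + 1. eval M \<rho> (LetIn a b) \<omega> w \<omega> r"
    by (intro exI[of _ "s' + t' + 1"]) (auto intro: eval.LetIn simp del: One_nat_def)
qed

text \<open>A round costs a guard, a body and 1; the final test costs a guard, the size of the
  result and 1. Either is at most \<open>2 * s + 1\<close>, and there are \<open>n + 1\<close> of
  them. The induction shifts the sequence of states by one.\<close>

lemma computes_While:
  assumes "\<And>i. i < n \<Longrightarrow> \<exists>u. u \<noteq> Leaf \<and> computes M (st i # \<rho>) c u s"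
    and "\<And>i. i < n \<Longrightarrow> computes M (st i # \<rho>) b (st (Suc i)) s"
    and "computes M (st n # \<rho>) c Leaf s" "size (st n) \<le> s"
  shows "computes M (st 0 # \<rho>) (While c b) (st n) ((n + 1) * (2 * s + 1))"
  using assms
proof (induction n arbitrary: st)
  case 0
  show ?case
    unfolding computes_def
  proof
    fix \<omega>
    obtain s' where "s' \<le> s" "eval M (st 0 # \<rho>) c \<omega> Leaf \<omega> s'"
      using 0(3) by (meson computesE)
    then show "\<exists>t'\<le>(0 + 1) * (2 * s + 1). eval M (st 0 # \<rho>) (While c b) \<omega> (st 0) \<omega> t'"
      using 0(4) by (intro exI[of _ "s' + size (st 0) + 1"]) (auto intro: eval.While_stop simp del: One_nat_def)
  qed
next
  case (Suc n)
  have IH: "computes M (st (Suc 0) # \<rho>) (While c b) (st (Suc n)) ((n + 1) * (2 * s + 1))"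
    using Suc.IH[of "\<lambda>i. st (Suc i)"] Suc.prems by auto
  obtain u where u: "u \<noteq> Leaf" "computes M (st 0 # \<rho>) c u s"
    using Suc.prems(1) by blast
  show ?case
    unfolding computes_def
  proof
    fix \<omega>
    obtain r where r: "r \<le> s" "eval M (st 0 # \<rho>) c \<omega> u \<omega> r"
      using u(2) by (meson computesE)
    obtain s' where s': "s' \<le> s" "eval M (st 0 # \<rho>) b \<omega> (st (Suc 0)) \<omega> s'"
      using Suc.prems(2)[of 0] by (meson computesE zero_less_Suc)
    obtain t where t: "t \<le> (n + 1) * (2 * s + 1)"
      "eval M (st (Suc 0) # \<rho>) (While c b) \<omega> (st (Suc n)) \<omega> t"
      using IH by (meson computesE)
    show "\<exists>t'\<le>(Suc n + 1) * (2 * s + 1). eval M (st 0 # \<rho>) (While c b) \<omega> (st (Suc n)) \<omega> t'"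
    proof (intro exI conjI)
      show "eval M (st 0 # \<rho>) (While c b) \<omega> (st (Suc n)) \<omega> (r + s' + t + 1)"
        using eval.While_step[OF r(2) u(1) s'(2) t(2)] .
      show "r + s' + t + 1 \<le> (Suc n + 1) * (2 * s + 1)"
        using r s' t by simp
    qed
  qed
qed


section \<open>Polynomial time\<close>

text \<open>
  A context consists of a set of parameters and assigns to each of them a budget and an oracle.
  Costs are polynomial in the budget, uniformly in the parameter. As the budget stays the same in
  subprograms and loop bodies, no polynomials need to be composed.
\<close>

type_synonym 'x ctx = "'x set \<times> ('x \<Rightarrow> nat) \<times> ('x \<Rightarrow> data \<Rightarrow> bool)"

abbreviation pts :: "'x ctx \<Rightarrow> 'x set" where "pts \<Gamma> \<equiv> fst \<Gamma>"
abbreviation budget :: "'x ctx \<Rightarrow> 'x \<Rightarrow> nat" where "budget \<Gamma> \<equiv> fst (snd \<Gamma>)"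
abbreviation oracle_of :: "'x ctx \<Rightarrow> 'x \<Rightarrow> data \<Rightarrow> bool" where "oracle_of \<Gamma> \<equiv> snd (snd \<Gamma>)"

text \<open>A base of at least 2 lets constants and sums be absorbed into the exponent, so that a
  polynomial is represented by a single number.\<close>

definition pbounded :: "'x ctx \<Rightarrow> ('x \<Rightarrow> nat) \<Rightarrow> bool" where
  "pbounded \<Gamma> f \<longleftrightarrow> (\<exists>c. \<forall>x \<in> pts \<Gamma>. f x \<le> (budget \<Gamma> x + 2) ^ c)"

lemma pbounded_mono:
  "pbounded \<Gamma> f \<Longrightarrow> (\<And>x. x \<in> pts \<Gamma> \<Longrightarrow> g x \<le> f x) \<Longrightarrow> pbounded \<Gamma> g"
  unfolding pbounded_def by (meson order_trans)

lemma pbounded_const: "pbounded \<Gamma> (\<lambda>x. k)"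
proof -
  have "k \<le> (m + 2) ^ k" for m :: nat
  proof -
    have "k \<le> 2 ^ k" by (rule less_imp_le) (rule less_exp)
    also have "\<dots> \<le> (m + 2) ^ k" by (rule power_mono) auto
    finally show ?thesis .
  qed
  then show ?thesis unfolding pbounded_def by blast
qed

lemma pbounded_budget: "pbounded \<Gamma> (budget \<Gamma>)"
  unfolding pbounded_def by (intro exI[of _ 1]) auto

lemma pbounded_mult:
  assumes "pbounded \<Gamma> f" "pbounded \<Gamma> g" shows "pbounded \<Gamma> (\<lambda>x. f x * g x)"
proof -
  obtain c d where "\<forall>x \<in> pts \<Gamma>. f x \<le> (budget \<Gamma> x + 2) ^ c"
    "\<forall>x \<in> pts \<Gamma>. g x \<le> (budget \<Gamma> x + 2) ^ d"
    using assms unfolding pbounded_def by blast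
  then have "\<forall>x \<in> pts \<Gamma>. f x * g x \<le> (budget \<Gamma> x + 2) ^ (c + d)"
    by (simp add: mult_mono power_add)
  then show ?thesis unfolding pbounded_def by blast
qed

text \<open>Reduced to products by f + g \<le> (f + 1) * (g + 1); adding 1 at most doubles the
  power, which costs one further factor of the base.\<close>

lemma pbounded_add:
  assumes "pbounded \<Gamma> f" "pbounded \<Gamma> g" shows "pbounded \<Gamma> (\<lambda>x. f x + g x)"
proof -
  have "pbounded \<Gamma> (\<lambda>x. (f x + 1) * (g x + 1))"
    if "pbounded \<Gamma> (\<lambda>x. f x + 1)" "pbounded \<Gamma> (\<lambda>x. g x + 1)"
    using pbounded_mult that by blast
  moreover have "pbounded \<Gamma> (\<lambda>x. h x + 1)" if h: "pbounded \<Gamma> h" for h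
  proof -
    obtain c where c: "\<forall>x \<in> pts \<Gamma>. h x \<le> (budget \<Gamma> x + 2) ^ c"
      using h unfolding pbounded_def by blast
    have "h x + 1 \<le> (budget \<Gamma> x + 2) ^ Suc c" if "x \<in> pts \<Gamma>" for x
    proof -
      have "1 \<le> (budget \<Gamma> x + 2) ^ c" by simp
      then have "h x + 1 \<le> 2 * (budget \<Gamma> x + 2) ^ c" using c that
        by (smt (verit) add_mono_thms_linordered_semiring(1) mult_2)
      also have "\<dots> \<le> (budget \<Gamma> x + 2) ^ Suc c" by simp
      finally show ?thesis .
    qed
    then show ?thesis unfolding pbounded_def by blast
  qed
  ultimately have "pbounded \<Gamma> (\<lambda>x. (f x + 1) * (g x + 1))"
    using assms by blast
  then show ?thesis
    by (rule pbounded_mono) simp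
qed

lemmas pbounded_intros = pbounded_const pbounded_budget pbounded_mult pbounded_add

definition env_bounded :: "'x ctx \<Rightarrow> ('x \<Rightarrow> data list) \<Rightarrow> bool" where
  "env_bounded \<Gamma> env \<longleftrightarrow> pbounded \<Gamma> (\<lambda>x. sum_list (map size (env x)))"

lemma env_bounded_Cons:
  "pbounded \<Gamma> (\<lambda>x. size (v x)) \<Longrightarrow> env_bounded \<Gamma> env \<Longrightarrow> env_bounded \<Gamma> (\<lambda>x. v x # env x)"
  unfolding env_bounded_def list.map sum_list.Cons by (rule pbounded_add)

lemma env_bounded_nth:
  assumes "env_bounded \<Gamma> env" "\<And>x. x \<in> pts \<Gamma> \<Longrightarrow> i < length (env x)"
  shows "pbounded \<Gamma> (\<lambda>x. size (env x ! i))"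
proof (rule pbounded_mono)
  show "pbounded \<Gamma> (\<lambda>x. sum_list (map size (env x)))"
    using assms(1) unfolding env_bounded_def .
  show "size (env x ! i) \<le> sum_list (map size (env x))" if "x \<in> pts \<Gamma>" for x
    using assms(2)[OF that] by (intro member_le_sum_list) auto
qed

text \<open>Having the bound on the environment inside the definition frees all rules from it.\<close>

definition ptime :: "'x ctx \<Rightarrow> ('x \<Rightarrow> data list) \<Rightarrow> program \<Rightarrow> ('x \<Rightarrow> data) \<Rightarrow> bool" where
  "ptime \<Gamma> env P val \<longleftrightarrow> (env_bounded \<Gamma> env \<longrightarrow>
     (\<exists>t. pbounded \<Gamma> t \<and> (\<forall>x \<in> pts \<Gamma>. computes (oracle_of \<Gamma> x) (env x) P (val x) (t x))))"

lemma ptimeI: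
  assumes "env_bounded \<Gamma> env \<Longrightarrow> pbounded \<Gamma> t"
    and "\<And>x. env_bounded \<Gamma> env \<Longrightarrow> x \<in> pts \<Gamma> \<Longrightarrow> computes (oracle_of \<Gamma> x) (env x) P (val x) (t x)"
  shows "ptime \<Gamma> env P val"
  using assms unfolding ptime_def by (intro impI exI[of _ t] conjI ballI)

lemma ptimeD:
  assumes "ptime \<Gamma> env P val" "env_bounded \<Gamma> env"
  shows "\<exists>t. pbounded \<Gamma> t \<and> (\<forall>x \<in> pts \<Gamma>. computes (oracle_of \<Gamma> x) (env x) P (val x) (t x))"
  using assms unfolding ptime_def by (rule mp)

lemma ptime_size:
  assumes "ptime \<Gamma> env P val" "env_bounded \<Gamma> env"
  shows "pbounded \<Gamma> (\<lambda>x. size (val x))"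
proof -
  obtain t where t: "pbounded \<Gamma> t \<and>
    (\<forall>x \<in> pts \<Gamma>. computes (oracle_of \<Gamma> x) (env x) P (val x) (t x))"
    using ptimeD[OF assms] by (rule exE)
  show ?thesis
    using t computes_size by (intro pbounded_mono[of \<Gamma> t "\<lambda>x. size (val x)"]) blast+
qed

text \<open>With the value left schematic, the syntax-driven rules synthesise it; what remains is an
  equation with the intended value, to be checked on the parameters only.\<close>

lemma ptime_cong:
  "ptime \<Gamma> env P val' \<Longrightarrow> (\<And>x. x \<in> pts \<Gamma> \<Longrightarrow> val' x = val x) \<Longrightarrow> ptime \<Gamma> env P val"
  unfolding ptime_def by (simp cong: ball_cong)

lemma ptime_Var:
  assumes "\<And>x. x \<in> pts \<Gamma> \<Longrightarrow> i < length (env x)"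
  shows "ptime \<Gamma> env (Var i) (\<lambda>x. env x ! i)"
proof (rule ptimeI[where t = "\<lambda>x. 1 + size (env x ! i)"])
  show "pbounded \<Gamma> (\<lambda>x. 1 + size (env x ! i))" if "env_bounded \<Gamma> env"
    using env_bounded_nth[OF that assms] by (intro pbounded_add pbounded_const)
  show "computes (oracle_of \<Gamma> x) (env x) (Var i) (env x ! i) (1 + size (env x ! i))"
    if "x \<in> pts \<Gamma>" for x
    using that assms by (intro computes_Var)
qed

lemma ptime_Nul: "ptime \<Gamma> env Nul (\<lambda>x. Leaf)"
  by (rule ptimeI[where t = "\<lambda>x. 1"]) (auto intro: pbounded_const computes_Nul simp del: One_nat_def)

lemma ptime_Pair:
  assumes a: "ptime \<Gamma> env a v" and b: "ptime \<Gamma> env b w"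
  shows "ptime \<Gamma> env (Pair a b) (\<lambda>x. Node (v x) (w x))"
  unfolding ptime_def
proof
  assume e: "env_bounded \<Gamma> env"
  obtain s where s: "pbounded \<Gamma> s \<and>
    (\<forall>x \<in> pts \<Gamma>. computes (oracle_of \<Gamma> x) (env x) a (v x) (s x))"
    using ptimeD[OF a e] by (rule exE)
  obtain t where t: "pbounded \<Gamma> t \<and>
    (\<forall>x \<in> pts \<Gamma>. computes (oracle_of \<Gamma> x) (env x) b (w x) (t x))"
    using ptimeD[OF b e] by (rule exE)
  show "\<exists>t. pbounded \<Gamma> t \<and>
    (\<forall>x\<in>pts \<Gamma>. computes (oracle_of \<Gamma> x) (env x) (Pair a b) (Node (v x) (w x)) (t x))"
    using s t by (intro exI[of _ "\<lambda>x. s x + t x + 1"] conjI ballI pbounded_intros computes_Pair) auto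
qed

lemma ptime_Equal:
  assumes a: "ptime \<Gamma> env a v" and b: "ptime \<Gamma> env b w"
  shows "ptime \<Gamma> env (Equal a b) (\<lambda>x. enc_bool (v x = w x))"
  unfolding ptime_def
proof
  assume e: "env_bounded \<Gamma> env"
  obtain s where s: "pbounded \<Gamma> s \<and>
    (\<forall>x \<in> pts \<Gamma>. computes (oracle_of \<Gamma> x) (env x) a (v x) (s x))"
    using ptimeD[OF a e] by (rule exE)
  obtain t where t: "pbounded \<Gamma> t \<and>
    (\<forall>x \<in> pts \<Gamma>. computes (oracle_of \<Gamma> x) (env x) b (w x) (t x))"
    using ptimeD[OF b e] by (rule exE)
  show "\<exists>t. pbounded \<Gamma> t \<and>
    (\<forall>x\<in>pts \<Gamma>. computes (oracle_of \<Gamma> x) (env x) (Equal a b) (enc_bool (v x = w x)) (t x))"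
    using s t by (intro exI[of _ "\<lambda>x. s x + t x + 1"] conjI ballI pbounded_intros computes_Equal) auto
qed

lemma ptime_Lft:
  assumes a: "ptime \<Gamma> env a v"
  shows "ptime \<Gamma> env (Lft a) (\<lambda>x. left (v x))"
  unfolding ptime_def
proof
  assume e: "env_bounded \<Gamma> env"
  obtain s where s: "pbounded \<Gamma> s \<and>
    (\<forall>x \<in> pts \<Gamma>. computes (oracle_of \<Gamma> x) (env x) a (v x) (s x))"
    using ptimeD[OF a e] by (rule exE)
  show "\<exists>t. pbounded \<Gamma> t \<and> (\<forall>x\<in>pts \<Gamma>. computes (oracle_of \<Gamma> x) (env x) (Lft a) (left (v x)) (t x))"
    using s by (intro exI[of _ "\<lambda>x. s x + 1"] conjI ballI pbounded_intros computes_Lft) auto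
qed

lemma ptime_Rgt:
  assumes a: "ptime \<Gamma> env a v"
  shows "ptime \<Gamma> env (Rgt a) (\<lambda>x. right (v x))"
  unfolding ptime_def
proof
  assume e: "env_bounded \<Gamma> env"
  obtain s where s: "pbounded \<Gamma> s \<and>
    (\<forall>x \<in> pts \<Gamma>. computes (oracle_of \<Gamma> x) (env x) a (v x) (s x))"
    using ptimeD[OF a e] by (rule exE)
  show "\<exists>t. pbounded \<Gamma> t \<and> (\<forall>x\<in>pts \<Gamma>. computes (oracle_of \<Gamma> x) (env x) (Rgt a) (right (v x)) (t x))"
    using s by (intro exI[of _ "\<lambda>x. s x + 1"] conjI ballI pbounded_intros computes_Rgt) auto
qed

lemma ptime_Query:
  assumes a: "ptime \<Gamma> env a v"
  shows "ptime \<Gamma> env (Query a) (\<lambda>x. enc_bool (oracle_of \<Gamma> x (v x)))"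
  unfolding ptime_def
proof
  assume e: "env_bounded \<Gamma> env"
  obtain s where s: "pbounded \<Gamma> s \<and>
    (\<forall>x \<in> pts \<Gamma>. computes (oracle_of \<Gamma> x) (env x) a (v x) (s x))"
    using ptimeD[OF a e] by (rule exE)
  show "\<exists>t. pbounded \<Gamma> t \<and> (\<forall>x\<in>pts \<Gamma>.
    computes (oracle_of \<Gamma> x) (env x) (Query a) (enc_bool (oracle_of \<Gamma> x (v x))) (t x))"
    using s by (intro exI[of _ "\<lambda>x. s x + 1"] conjI ballI pbounded_intros computes_Query) auto
qed

lemma ptime_Cond:
  assumes c: "ptime \<Gamma> env c u" and a: "ptime \<Gamma> env a v" and b: "ptime \<Gamma> env b w"
  shows "ptime \<Gamma> env (Cond c a b) (\<lambda>x. if u x \<noteq> Leaf then v x else w x)"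
  unfolding ptime_def
proof
  assume e: "env_bounded \<Gamma> env"
  obtain r where r: "pbounded \<Gamma> r \<and>
    (\<forall>x \<in> pts \<Gamma>. computes (oracle_of \<Gamma> x) (env x) c (u x) (r x))"
    using ptimeD[OF c e] by (rule exE)
  obtain s where s: "pbounded \<Gamma> s \<and>
    (\<forall>x \<in> pts \<Gamma>. computes (oracle_of \<Gamma> x) (env x) a (v x) (s x))"
    using ptimeD[OF a e] by (rule exE)
  obtain t where t: "pbounded \<Gamma> t \<and>
    (\<forall>x \<in> pts \<Gamma>. computes (oracle_of \<Gamma> x) (env x) b (w x) (t x))"
    using ptimeD[OF b e] by (rule exE)
  show "\<exists>t. pbounded \<Gamma> t \<and> (\<forall>x\<in>pts \<Gamma>.
    computes (oracle_of \<Gamma> x) (env x) (Cond c a b) (if u x \<noteq> Leaf then v x else w x) (t x))"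
  proof (intro exI conjI ballI)
    show "pbounded \<Gamma> (\<lambda>x. r x + (s x + t x) + 1)"
      using r s t by (intro pbounded_intros) auto
    fix x assume x: "x \<in> pts \<Gamma>"
    have "computes (oracle_of \<Gamma> x) (env x) a (v x) (s x + t x)"
      "computes (oracle_of \<Gamma> x) (env x) b (w x) (s x + t x)"
      using s t x computes_mono le_add1 le_add2 by blast+
    then show "computes (oracle_of \<Gamma> x) (env x) (Cond c a b) (if u x \<noteq> Leaf then v x else w x)
        (r x + (s x + t x) + 1)"
      using r x by (intro computes_Cond) auto
  qed
qed

lemma ptime_LetIn:
  assumes a: "ptime \<Gamma> env a v" and b: "ptime \<Gamma> (\<lambda>x. v x # env x) b w"
  shows "ptime \<Gamma> env (LetIn a b) w"
  unfolding ptime_def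
proof
  assume e: "env_bounded \<Gamma> env"
  obtain s where s: "pbounded \<Gamma> s \<and>
    (\<forall>x \<in> pts \<Gamma>. computes (oracle_of \<Gamma> x) (env x) a (v x) (s x))"
    using ptimeD[OF a e] by (rule exE)
  \<comment> \<open>The cost of \<open>a\<close> bounds its value, so the enlarged environment is
    still polynomial in the unchanged budget.\<close>
  have e': "env_bounded \<Gamma> (\<lambda>x. v x # env x)"
    using a e ptime_size env_bounded_Cons by blast
  obtain t where t: "pbounded \<Gamma> t \<and>
    (\<forall>x \<in> pts \<Gamma>. computes (oracle_of \<Gamma> x) (v x # env x) b (w x) (t x))"
    using ptimeD[OF b e'] by (rule exE)
  show "\<exists>t. pbounded \<Gamma> t \<and> (\<forall>x\<in>pts \<Gamma>. computes (oracle_of \<Gamma> x) (env x) (LetIn a b) (w x) (t x))"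
    using s t by (intro exI[of _ "\<lambda>x. s x + t x + 1"] conjI ballI pbounded_intros computes_LetIn) auto
qed

primrec Const :: "data \<Rightarrow> program" where
  "Const Leaf = Nul"
| "Const (Node a b) = Pair (Const a) (Const b)"

lemma flip_free_Const [simp]: "flip_free (Const d)"
  by (induction d) auto

lemma ptime_Const: "ptime \<Gamma> env (Const d) (\<lambda>x. d)"
  by (induction d) (auto intro: ptime_Nul ptime_Pair)

lemmas ptime_intros =
  ptime_Nul ptime_Pair ptime_Lft ptime_Rgt ptime_Query ptime_Equal ptime_Cond ptime_Const ptime_LetIn
  ptime_Var


section \<open>Loops over lists\<close>

text \<open>
  The body sees the current element as variable 0, the accumulator as variable 1, the internal
  state of the loop as variable 2, and the surrounding environment from variable 3 on.
\<close>

definition Foreach :: "program \<Rightarrow> program \<Rightarrow> program \<Rightarrow> program" where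
  "Foreach L A B = LetIn (Pair L A) (Rgt (While (Lft (Var 0))
     (Pair (Rgt (Lft (Var 0))) (LetIn (Rgt (Var 0)) (LetIn (Lft (Lft (Var 1))) B)))))"

lemma flip_free_Foreach [simp]: "flip_free (Foreach L A B) \<longleftrightarrow> flip_free L \<and> flip_free A \<and> flip_free B"
  by (simp add: Foreach_def)

text \<open>Each round of a loop becomes a parameter of its own with the budget of the whole loop.
  Since bounds are uniform in the parameter, one polynomial then covers the body in all
  rounds.\<close>

definition loop_ctx :: "'x ctx \<Rightarrow> ('x \<Rightarrow> nat) \<Rightarrow> ('x \<times> nat) ctx" where
  "loop_ctx \<Gamma> n = (SIGMA x:pts \<Gamma>. {..<n x}, budget \<Gamma> \<circ> fst, oracle_of \<Gamma> \<circ> fst)"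

lemma loop_ctx_simps [simp]:
  "z \<in> pts (loop_ctx \<Gamma> n) \<longleftrightarrow> fst z \<in> pts \<Gamma> \<and> snd z < n (fst z)"
  "budget (loop_ctx \<Gamma> n) z = budget \<Gamma> (fst z)"
  "oracle_of (loop_ctx \<Gamma> n) z = oracle_of \<Gamma> (fst z)"
  by (cases z, auto simp: loop_ctx_def)+

lemma pbounded_loop_ctx: "pbounded \<Gamma> f \<Longrightarrow> pbounded (loop_ctx \<Gamma> n) (\<lambda>z. f (fst z))"
proof -
  assume "pbounded \<Gamma> f"
  then obtain c where "\<forall>x \<in> pts \<Gamma>. f x \<le> (budget \<Gamma> x + 2) ^ c" unfolding pbounded_def by blast
  then show ?thesis unfolding pbounded_def by (intro exI[of _ c]) auto
qed

lemma size_enc_list: "size (enc_list e xs) = (\<Sum>x\<leftarrow>xs. size (e x) + 1)"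
  by (induction xs) auto

lemma length_le_size_enc_list: "length xs \<le> size (enc_list e xs)"
  by (induction xs) auto

lemma size_enc_list_drop: "size (enc_list e (drop i xs)) \<le> size (enc_list e xs)"
proof -
  have "size (enc_list e xs) = size (enc_list e (take i xs)) + size (enc_list e (drop i xs))"
    unfolding size_enc_list by (metis append_take_drop_id map_append sum_list_append)
  then show ?thesis by simp
qed

lemma enc_list_drop:
  "i < length xs \<Longrightarrow> enc_list e (drop i xs) = Node (e (xs ! i)) (enc_list e (drop (Suc i) xs))"
  by (metis Cons_nth_drop_Suc enc_list.simps(2))

text \<open>Cheap rounds alone do not suffice, since the accumulator could grow by a factor in each
  of them. The premise \<open>bound\<close> controls all intermediate accumulators; the environments
  of the body are then polynomial, and the loop costs the number of rounds times one common
  bound.\<close>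

theorem ptime_Foreach:
  fixes e :: "'a \<Rightarrow> data" and encb :: "'b \<Rightarrow> data"
  defines "acc \<equiv> \<lambda>g xs a i. fold g (take i xs) a"
  assumes L: "ptime \<Gamma> env L (\<lambda>x. enc_list e (xs x))"
    and A: "ptime \<Gamma> env A (\<lambda>x. encb (a x))"
    and B: "\<And>s. ptime (loop_ctx \<Gamma> (\<lambda>x. length (xs x)))
      (\<lambda>z. e (xs (fst z) ! snd z) # encb (acc (g (fst z)) (xs (fst z)) (a (fst z)) (snd z)) # s z # env (fst z)) B
      (\<lambda>z. encb (g (fst z) (xs (fst z) ! snd z) (acc (g (fst z)) (xs (fst z)) (a (fst z)) (snd z))))"
    and bound: "env_bounded \<Gamma> env \<Longrightarrow> \<exists>K. pbounded \<Gamma> K \<and>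
      (\<forall>x \<in> pts \<Gamma>. \<forall>i \<le> length (xs x). size (encb (acc (g x) (xs x) (a x) i)) \<le> K x)"
  shows "ptime \<Gamma> env (Foreach L A B) (\<lambda>x. encb (fold (g x) (xs x) (a x)))"
  unfolding ptime_def
proof
  assume e: "env_bounded \<Gamma> env"
  obtain K where K: "pbounded \<Gamma> K"
    "\<And>x i. x \<in> pts \<Gamma> \<Longrightarrow> i \<le> length (xs x) \<Longrightarrow> size (encb (acc (g x) (xs x) (a x) i)) \<le> K x"
    using bound[OF e] by blast
  have sz: "pbounded \<Gamma> (\<lambda>x. size (enc_list e (xs x)))"
    using L e by (rule ptime_size)
  define st where "st x i = Node (enc_list e (drop i (xs x))) (encb (acc (g x) (xs x) (a x) i))" for x i
  define T where "T x = 1 + size (enc_list e (xs x)) + K x" for x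
  have T: "pbounded \<Gamma> T" unfolding T_def by (intro pbounded_intros sz K)
  have st_T: "size (st x i) \<le> T x" if "x \<in> pts \<Gamma>" "i \<le> length (xs x)" for x i
    using K(2)[OF that] size_enc_list_drop[of e i "xs x"] by (simp add: st_def T_def)
  define \<Delta> where "\<Delta> = loop_ctx \<Gamma> (\<lambda>x. length (xs x))"
  have T': "pbounded \<Delta> (\<lambda>z. T (fst z))" unfolding \<Delta>_def using T by (rule pbounded_loop_ctx)
  let ?env = "\<lambda>z. st (fst z) (snd z) # env (fst z)"
  have e1: "env_bounded \<Delta> ?env"
  proof (rule env_bounded_Cons)
    show "pbounded \<Delta> (\<lambda>z. size (st (fst z) (snd z)))"
      by (rule pbounded_mono[OF T']) (auto intro!: st_T simp: \<Delta>_def)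
    show "env_bounded \<Delta> (\<lambda>z. env (fst z))"
      using e pbounded_loop_ctx unfolding env_bounded_def \<Delta>_def by blast
  qed
  have step: "ptime \<Delta> ?env
     (Pair (Rgt (Lft (Var 0))) (LetIn (Rgt (Var 0)) (LetIn (Lft (Lft (Var 1))) B)))
     (\<lambda>z. st (fst z) (Suc (snd z)))"
  proof (rule ptime_cong[OF ptime_Pair[OF _ ptime_LetIn[OF _ ptime_LetIn]]])
    show "ptime \<Delta> ?env (Rgt (Lft (Var 0))) (\<lambda>z. enc_list e (drop (Suc (snd z)) (xs (fst z))))"
      by (rule ptime_cong, (rule ptime_intros | (simp; fail))+) ((auto simp: st_def \<Delta>_def enc_list_drop))?
    show "ptime \<Delta> ?env (Rgt (Var 0)) (\<lambda>z. encb (acc (g (fst z)) (xs (fst z)) (a (fst z)) (snd z)))"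
      by (rule ptime_cong, (rule ptime_intros | (simp; fail))+) ((auto simp: st_def \<Delta>_def enc_list_drop))?
    show "ptime \<Delta> (\<lambda>z. encb (acc (g (fst z)) (xs (fst z)) (a (fst z)) (snd z)) # ?env z)
        (Lft (Lft (Var 1))) (\<lambda>z. e (xs (fst z) ! snd z))"
      by (rule ptime_cong, (rule ptime_intros | (simp; fail))+) ((auto simp: st_def \<Delta>_def enc_list_drop))?
    show "ptime \<Delta> (\<lambda>z. e (xs (fst z) ! snd z) # encb (acc (g (fst z)) (xs (fst z)) (a (fst z)) (snd z)) #
        ?env z) B (\<lambda>z. encb (g (fst z) (xs (fst z) ! snd z) (acc (g (fst z)) (xs (fst z)) (a (fst z)) (snd z))))"
      using B[of "\<lambda>z. st (fst z) (snd z)"] unfolding \<Delta>_def .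
  qed (auto simp: st_def acc_def \<Delta>_def take_Suc_conv_app_nth)
  obtain t where t: "pbounded \<Delta> t \<and> (\<forall>z \<in> pts \<Delta>. computes (oracle_of \<Delta> z) (?env z)
     (Pair (Rgt (Lft (Var 0))) (LetIn (Rgt (Var 0)) (LetIn (Lft (Lft (Var 1))) B)))
     (st (fst z) (Suc (snd z))) (t z))"
    using ptimeD[OF step e1] by (rule exE)
  \<comment> \<open>The exponent is the same for all rounds, so the bound \<open>S\<close> below
    depends on \<open>x\<close> only.\<close>
  obtain c where c: "\<And>z. z \<in> pts \<Delta> \<Longrightarrow> t z \<le> (budget \<Delta> z + 2) ^ c"
    using t unfolding pbounded_def by blast
  define S where "S x = (budget \<Gamma> x + 2) ^ c + T x + 3" for x
  have "pbounded \<Gamma> (\<lambda>x. (budget \<Gamma> x + 2) ^ c)" unfolding pbounded_def by blast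
  then have S: "pbounded \<Gamma> S" unfolding S_def by (intro pbounded_intros T)
  obtain t0 where t0: "pbounded \<Gamma> t0 \<and>
    (\<forall>x \<in> pts \<Gamma>. computes (oracle_of \<Gamma> x) (env x) (Pair L A) (Node (enc_list e (xs x)) (encb (a x))) (t0 x))"
    using ptimeD[OF ptime_Pair[OF L A] e] by (rule exE)
  show "\<exists>t. pbounded \<Gamma> t \<and> (\<forall>x\<in>pts \<Gamma>. computes (oracle_of \<Gamma> x) (env x) (Foreach L A B)
      (encb (fold (g x) (xs x) (a x))) (t x))"
  proof (intro exI conjI ballI)
    show "pbounded \<Gamma> (\<lambda>x. t0 x + ((size (enc_list e (xs x)) + 1) * (2 * S x + 1) + 1) + 1)"
      by (intro pbounded_intros conjunct1[OF t0] sz S)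
    fix x assume x: "x \<in> pts \<Gamma>"
    have lft: "computes (oracle_of \<Gamma> x) (st x i # env x) (Lft (Var 0)) (enc_list e (drop i (xs x))) (S x)"
      if "i \<le> length (xs x)" for i
    proof (rule computes_mono)
      show "computes (oracle_of \<Gamma> x) (st x i # env x) (Lft (Var 0)) (enc_list e (drop i (xs x)))
          (1 + size (st x i) + 1)"
        using computes_Lft[OF computes_Var[of 0 "st x i # env x"]] by (simp add: st_def)
      show "1 + size (st x i) + 1 \<le> S x"
        using st_T[OF x that] by (simp add: S_def)
    qed
    have "computes (oracle_of \<Gamma> x) (st x 0 # env x) (While (Lft (Var 0))
       (Pair (Rgt (Lft (Var 0))) (LetIn (Rgt (Var 0)) (LetIn (Lft (Lft (Var 1))) B))))
       (st x (length (xs x))) ((length (xs x) + 1) * (2 * S x + 1))"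
    proof (rule computes_While)
      show "\<exists>u. u \<noteq> Leaf \<and> computes (oracle_of \<Gamma> x) (st x i # env x) (Lft (Var 0)) u (S x)"
        if "i < length (xs x)" for i
        using that lft[of i] by (auto simp: enc_list_drop)
      show "computes (oracle_of \<Gamma> x) (st x i # env x)
         (Pair (Rgt (Lft (Var 0))) (LetIn (Rgt (Var 0)) (LetIn (Lft (Lft (Var 1))) B))) (st x (Suc i)) (S x)"
        if "i < length (xs x)" for i
      proof (rule computes_mono)
        have z: "(x, i) \<in> pts \<Delta>" using that x by (simp add: \<Delta>_def)
        show "computes (oracle_of \<Gamma> x) (st x i # env x)
           (Pair (Rgt (Lft (Var 0))) (LetIn (Rgt (Var 0)) (LetIn (Lft (Lft (Var 1))) B))) (st x (Suc i)) (t (x, i))"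
          using bspec[OF conjunct2[OF t] z] by (simp add: \<Delta>_def)
        show "t (x, i) \<le> S x" using c[OF z] by (simp add: \<Delta>_def S_def)
      qed
      show "computes (oracle_of \<Gamma> x) (st x (length (xs x)) # env x) (Lft (Var 0)) Leaf (S x)"
        using lft[of "length (xs x)"] by simp
      show "size (st x (length (xs x))) \<le> S x"
        using st_T[OF x, of "length (xs x)"] by (simp add: S_def)
    qed
    \<comment> \<open>The number of rounds is replaced by the encoded size of the list, which
      \<open>ptime_size\<close> is able to bound.\<close>
    then have "computes (oracle_of \<Gamma> x) (st x 0 # env x) (While (Lft (Var 0))
       (Pair (Rgt (Lft (Var 0))) (LetIn (Rgt (Var 0)) (LetIn (Lft (Lft (Var 1))) B))))
       (st x (length (xs x))) ((size (enc_list e (xs x)) + 1) * (2 * S x + 1))"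
      by (rule computes_mono) (intro mult_le_mono1 add_le_mono1 length_le_size_enc_list)
    from computes_Rgt[OF this]
    have "computes (oracle_of \<Gamma> x) (Node (enc_list e (xs x)) (encb (a x)) # env x) (Rgt (While (Lft (Var 0))
       (Pair (Rgt (Lft (Var 0))) (LetIn (Rgt (Var 0)) (LetIn (Lft (Lft (Var 1))) B)))))
       (encb (fold (g x) (xs x) (a x))) ((size (enc_list e (xs x)) + 1) * (2 * S x + 1) + 1)"
      by (simp add: st_def acc_def)
    from computes_LetIn[OF bspec[OF conjunct2[OF t0] x] this]
    show "computes (oracle_of \<Gamma> x) (env x) (Foreach L A B) (encb (fold (g x) (xs x) (a x)))
       (t0 x + ((size (enc_list e (xs x)) + 1) * (2 * S x + 1) + 1) + 1)"
      unfolding Foreach_def .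
  qed
qed

text \<open>If a round adds at most \<open>K x\<close> to any accumulator, nothing compounds and the
  total increase is at most the number of rounds times \<open>K x\<close>. Arbitrary
  \<open>y\<close> and \<open>b\<close> spare applications any description of the intermediate
  accumulators.\<close>

corollary ptime_Foreach_additive:
  fixes e :: "'a \<Rightarrow> data" and encb :: "'b \<Rightarrow> data"
  assumes L: "ptime \<Gamma> env L (\<lambda>x. enc_list e (xs x))"
    and A: "ptime \<Gamma> env A (\<lambda>x. encb (a x))"
    and B: "\<And>y b s. ptime (loop_ctx \<Gamma> (\<lambda>x. length (xs x)))
      (\<lambda>z. e (y z) # encb (b z) # s z # env (fst z)) B (\<lambda>z. encb (g (fst z) (y z) (b z)))"
    and bound: "env_bounded \<Gamma> env \<Longrightarrow> \<exists>K. pbounded \<Gamma> K \<and>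
      (\<forall>x \<in> pts \<Gamma>. \<forall>y \<in> set (xs x). \<forall>b. size (encb (g x y b)) \<le> size (encb b) + K x)"
  shows "ptime \<Gamma> env (Foreach L A B) (\<lambda>x. encb (fold (g x) (xs x) (a x)))"
proof (rule ptime_Foreach[where \<Gamma> = \<Gamma> and env = env and e = e and xs = xs and encb = encb and a = a and g = g])
  show "ptime \<Gamma> env L (\<lambda>x. enc_list e (xs x))" "ptime \<Gamma> env A (\<lambda>x. encb (a x))"
    using L A .
  show "ptime (loop_ctx \<Gamma> (\<lambda>x. length (xs x)))
      (\<lambda>z. e (xs (fst z) ! snd z) # encb (fold (g (fst z)) (take (snd z) (xs (fst z))) (a (fst z))) # s z # env (fst z)) B
      (\<lambda>z. encb (g (fst z) (xs (fst z) ! snd z) (fold (g (fst z)) (take (snd z) (xs (fst z))) (a (fst z)))))" for s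
    by (rule B)
  assume e: "env_bounded \<Gamma> env"
  obtain K where K: "pbounded \<Gamma> K \<and>
      (\<forall>x \<in> pts \<Gamma>. \<forall>y \<in> set (xs x). \<forall>b. size (encb (g x y b)) \<le> size (encb b) + K x)"
    using bound[OF e] by (rule exE)
  have *: "size (encb (fold (g x) ys b)) \<le> size (encb b) + length ys * K x"
    if "x \<in> pts \<Gamma>" "set ys \<subseteq> set (xs x)" for x ys b
    using that
  proof (induction ys arbitrary: b)
    case (Cons y ys)
    have "size (encb (fold (g x) (y # ys) b)) \<le> size (encb (g x y b)) + length ys * K x"
      using Cons by simp
    also have "\<dots> \<le> size (encb b) + K x + length ys * K x"
      using K Cons.prems by simp
    finally show ?case by simp
  qed simp
  show "\<exists>K. pbounded \<Gamma> K \<and> (\<forall>x \<in> pts \<Gamma>. \<forall>i \<le> length (xs x).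
      size (encb (fold (g x) (take i (xs x)) (a x))) \<le> K x)"
  proof (intro exI conjI ballI allI impI)
    show "pbounded \<Gamma> (\<lambda>x. size (encb (a x)) + size (enc_list e (xs x)) * K x)"
      using ptime_size[OF L e] ptime_size[OF A e] by (intro pbounded_intros conjunct1[OF K])
    fix x i assume x: "x \<in> pts \<Gamma>" "i \<le> length (xs x)"
    have "size (encb (fold (g x) (take i (xs x)) (a x))) \<le> size (encb (a x)) + length (take i (xs x)) * K x"
      by (rule *[OF x(1) set_take_subset])
    also have "\<dots> \<le> size (encb (a x)) + size (enc_list e (xs x)) * K x"
      using length_le_size_enc_list[of "xs x" e] by (intro add_mono mult_le_mono1) auto
    finally show "size (encb (fold (g x) (take i (xs x)) (a x))) \<le>
      size (encb (a x)) + size (enc_list e (xs x)) * K x" .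
  qed
qed

section \<open>The learning algorithm and its program\<close>

text \<open>An injective code of a pair: the bits of \<open>b\<close> in reverse order, each
  announced by \<open>True\<close>, then \<open>False\<close> and the unchanged \<open>a\<close>.
  Its length is that of \<open>a\<close> plus twice that of \<open>b\<close> plus 1.\<close>

definition prod_name :: "name \<Rightarrow> name \<Rightarrow> name" where
  "prod_name a b = fold (\<lambda>x c. True # x # c) b (False # a)"

text \<open>A short \<open>bs\<close> is padded with empty names, so the result always has the
  length of \<open>as\<close>; arities in a product are thus inherited from the left factor.\<close>

primrec prod_tuple :: "name list \<Rightarrow> name list \<Rightarrow> name list" where
  "prod_tuple [] bs = []"
| "prod_tuple (a # as) bs = prod_name a (case bs of [] \<Rightarrow> [] | b # _ \<Rightarrow> b) # prod_tuple as (tl bs)"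

definition prod_facts :: "fact list \<Rightarrow> fact list \<Rightarrow> fact list" where
  "prod_facts Fs Gs = fold (\<lambda>f c. fold (\<lambda>g c.
     if fst f = fst g then (fst g, prod_tuple (snd f) (snd g)) # c else c) Gs c) Fs []"

text \<open>A pointed instance with listed facts is encoded like its canonical CQ, so it is given the type \<^typ>\<open>cq\<close>.\<close>

definition prod_cq :: "cq \<Rightarrow> cq \<Rightarrow> cq" where
  "prod_cq p q = CQ (prod_tuple (head p) (head q)) (prod_facts (body p) (body q))"

text \<open>One greedy pass. \<open>kept\<close> holds the facts found indispensable;
  \<open>rem\<close> holds the current and the unexamined facts and is part of the state because a
  fold shows only the current element. The oracle is asked about everything but the current
  fact.\<close>

definition minimise :: "(cq \<Rightarrow> bool) \<Rightarrow> cq \<Rightarrow> cq" where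
  "minimise pos p = CQ (head p) (fst (fold (\<lambda>f (kept, rem).
     if pos (CQ (head p) (fold Cons kept (tl rem))) then (kept, tl rem) else (f # kept, tl rem))
     (body p) ([], body p)))"

definition acceptable :: "nat \<Rightarrow> (cq \<Rightarrow> bool) \<Rightarrow> cq \<Rightarrow> bool" where
  "acceptable L pos p \<longleftrightarrow> pos p \<and> length (body p) \<le> L"

definition refine :: "nat \<Rightarrow> (cq \<Rightarrow> bool) \<Rightarrow> cq \<Rightarrow> cq \<Rightarrow> bool \<times> cq list \<Rightarrow> bool \<times> cq list" where
  "refine L pos e h r = (let p = minimise pos (prod_cq h e) in
     if acceptable L pos p then (True, p # snd r) else (fst r, h # snd r))"

definition update :: "nat \<Rightarrow> (cq \<Rightarrow> bool) \<Rightarrow> cq \<Rightarrow> cq list \<Rightarrow> cq list" where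
  "update L pos e Hs = (let r = fold (refine L pos e) Hs (False, []); p = minimise pos e in
     if fst r then snd r else if acceptable L pos p then p # Hs else Hs)"

definition learn :: "nat \<Rightarrow> (cq \<Rightarrow> bool) \<Rightarrow> cq \<Rightarrow> cq list \<Rightarrow> cq list" where
  "learn L pos start es = fold (update L pos) es [start]"

definition RevAppP :: "program \<Rightarrow> program \<Rightarrow> program" where
  "RevAppP L A = Foreach L A (Pair (Var 0) (Var 1))"

definition ProdNameP :: "program \<Rightarrow> program \<Rightarrow> program" where
  "ProdNameP A B = Foreach B (Pair Nul A) (Pair (Const (enc_bool True)) (Pair (Var 0) (Var 1)))"

text \<open>The loop state pairs the unread part of the second tuple with the output, which is built
  backwards; hence the final reversal.\<close>

definition ProdTupleP :: "program \<Rightarrow> program \<Rightarrow> program" where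
  "ProdTupleP A B = RevAppP (Rgt (Foreach A (Pair B Nul)
     (Pair (Rgt (Lft (Var 1))) (Pair (ProdNameP (Var 0) (Lft (Lft (Var 1)))) (Rgt (Var 1)))))) Nul"

text \<open>\<open>i\<close> and \<open>j\<close> are the indices of the variables holding the two
  queries. A loop pushes three variables: hence \<open>j + 3\<close>, and in the inner loop
  \<open>Var 3\<close> is the fact of the outer one. The inner loop continues the outer
  accumulator.\<close>

definition ProdFactsP :: "nat \<Rightarrow> nat \<Rightarrow> program" where
  "ProdFactsP i j = Foreach (Lft (Var i)) Nul (Foreach (Lft (Var (j + 3))) (Var 1)
     (Cond (Equal (Lft (Var 3)) (Lft (Var 0)))
       (Pair (Pair (Lft (Var 0)) (ProdTupleP (Rgt (Var 3)) (Rgt (Var 0)))) (Var 1))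
       (Var 1)))"

definition ProdCQP :: "nat \<Rightarrow> nat \<Rightarrow> program" where
  "ProdCQP i j = Pair (ProdFactsP i j) (ProdTupleP (Rgt (Var i)) (Rgt (Var j)))"

text \<open>The shift \<open>i + 4\<close> accounts for the three variables of the loop and for the
  \<open>LetIn\<close> holding the unexamined facts.\<close>

definition MinimiseP :: "nat \<Rightarrow> program" where
  "MinimiseP i = Pair (Lft (Foreach (Lft (Var i)) (Pair Nul (Lft (Var i)))
     (LetIn (Rgt (Rgt (Var 1)))
       (Cond (Query (Pair (RevAppP (Lft (Var 2)) (Var 0)) (Rgt (Var (i + 4)))))
         (Pair (Lft (Var 2)) (Var 0))
         (Pair (Pair (Var 1) (Lft (Var 2))) (Var 0))))))
     (Rgt (Var i))"

text \<open>Lengths are compared in unary: every fact strips one cell off the list at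
  \<open>j\<close>. The additional cell in front leaves a tree other than \<open>Leaf\<close> when
  the lengths are equal.\<close>

definition AcceptableP :: "nat \<Rightarrow> nat \<Rightarrow> program" where
  "AcceptableP i j = Cond (Query (Var i)) (Foreach (Lft (Var i)) (Pair Nul (Var j)) (Rgt (Var 1))) Nul"

text \<open>\<open>Lft (Var 0)\<close> takes the example without its label. The indices 9 and 6 both
  reach the whole sample, whose length is the threshold, and \<open>Const (Node Leaf Leaf)\<close>
  encodes the pair of \<open>False\<close> and the empty list.\<close>

definition UpdateP :: program where
  "UpdateP = LetIn (Lft (Var 0)) (LetIn
     (Foreach (Var 2) (Const (Node Leaf Leaf))
       (LetIn (ProdCQP 0 3) (LetIn (MinimiseP 0)
         (Cond (AcceptableP 0 9)
           (Pair (Const (enc_bool True)) (Pair (Var 0) (Rgt (Var 3))))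
           (Pair (Lft (Var 3)) (Pair (Var 2) (Rgt (Var 3))))))))
     (Cond (Lft (Var 0)) (Rgt (Var 0))
       (LetIn (MinimiseP 1) (Cond (AcceptableP 0 6) (Pair (Var 0) (Var 4)) (Var 4)))))"

definition LearnP :: "cq \<Rightarrow> program" where
  "LearnP start = Foreach (Var 0) (Const (enc_list enc_cq [start])) UpdateP"

lemma flip_free_LearnP: "flip_free (LearnP start)"
  by (simp add: LearnP_def UpdateP_def AcceptableP_def MinimiseP_def ProdCQP_def ProdFactsP_def
      ProdTupleP_def ProdNameP_def RevAppP_def)

section \<open>Injectivity and size of the encodings\<close>

lemma enc_bool_eq_Leaf [simp]: "enc_bool b = Leaf \<longleftrightarrow> \<not> b"
  by (cases b) auto

lemma inj_enc_bool: "inj enc_bool"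
  by (rule injI) (case_tac x; case_tac y; simp)

lemma inj_enc_list: "inj f \<Longrightarrow> inj (enc_list f)"
proof (rule injI)
  fix xs ys assume f: "inj f" and "enc_list f xs = enc_list f ys"
  then show "xs = ys"
  proof (induction xs arbitrary: ys)
    case Nil
    then show ?case by (cases ys) auto
  next
    case (Cons x xs)
    then show ?case by (cases ys) (auto dest: injD)
  qed
qed

lemma inj_enc_name: "inj enc_name"
  unfolding enc_name_def by (intro inj_enc_list inj_enc_bool)

lemma inj_enc_atom: "inj enc_atom"
  using inj_enc_name inj_enc_list[OF inj_enc_name]
  by (auto simp: inj_def enc_atom_def split: prod.splits)

lemma inj_enc_cq: "inj enc_cq"
proof (rule injI)
  fix p q assume "enc_cq p = enc_cq q"
  then show "p = q"
    using injD[OF inj_enc_list[OF inj_enc_atom]] injD[OF inj_enc_list[OF inj_enc_name]]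
    by (cases p; cases q) (auto simp: enc_cq_def)
qed

lemma left_enc_cq [simp]: "left (enc_cq p) = enc_list enc_atom (body p)"
  and right_enc_cq [simp]: "right (enc_cq p) = enc_list enc_name (head p)"
  by (simp_all add: enc_cq_def)

lemma enc_atom_Pair: "enc_atom (R, ts) = Node (enc_name R) (enc_list enc_name ts)"
  by (simp add: enc_atom_def)

lemma left_enc_atom [simp]: "left (enc_atom f) = enc_name (fst f)"
  and right_enc_atom [simp]: "right (enc_atom f) = enc_list enc_name (snd f)"
  by (simp_all add: enc_atom_def split_beta)

lemma right_enc_list [simp]: "right (enc_list e xs) = enc_list e (tl xs)"
  by (cases xs) auto

lemma size_right: "size (right d) \<le> size d"
  by (cases d) simp_all

lemma size_enc_bool: "size (enc_bool b) \<le> 1"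
  by (cases b) auto

lemma size_enc_list_member: "x \<in> set xs \<Longrightarrow> size (e x) + 1 \<le> size (enc_list e xs)"
  unfolding size_enc_list by (intro member_le_sum_list) auto

lemma size_enc_list_append [simp]: "size (enc_list e (xs @ ys)) = size (enc_list e xs) + size (enc_list e ys)"
  by (simp add: size_enc_list)

lemma size_enc_list_rev [simp]: "size (enc_list e (rev xs)) = size (enc_list e xs)"
  by (simp add: size_enc_list rev_map[symmetric])

lemma size_enc_list_take: "size (enc_list e (take i xs)) \<le> size (enc_list e xs)"
  by (metis append_take_drop_id le_add1 size_enc_list_append)

lemma size_enc_list_tl: "size (enc_list e (tl xs)) \<le> size (enc_list e xs)"
  by (cases xs) auto

section \<open>Polynomial time of the subprograms\<close>

lemma ptime_RevAppP:
  assumes L: "ptime \<Gamma> env L (\<lambda>x. enc_list e (xs x))" and A: "ptime \<Gamma> env A (\<lambda>x. enc_list e (ys x))"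
  shows "ptime \<Gamma> env (RevAppP L A) (\<lambda>x. enc_list e (fold Cons (xs x) (ys x)))"
  unfolding RevAppP_def
proof (rule ptime_Foreach_additive[where g = "\<lambda>x. Cons"])
  show "ptime (loop_ctx \<Gamma> (\<lambda>x. length (xs x)))
     (\<lambda>z. e (y z) # enc_list e (b z) # s z # env (fst z)) (Pair (Var 0) (Var 1))
     (\<lambda>z. enc_list e (y z # b z))" for y b s
    by (rule ptime_cong, (rule ptime_intros | (simp; fail))+) (auto)?
  assume e: "env_bounded \<Gamma> env"
  show "\<exists>K. pbounded \<Gamma> K \<and> (\<forall>x\<in>pts \<Gamma>. \<forall>y\<in>set (xs x). \<forall>b.
      size (enc_list e (y # b)) \<le> size (enc_list e b) + K x)"
    using ptime_size[OF L e] size_enc_list_member by (intro exI conjI) (auto simp: add_ac)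
qed (use L A in auto)

lemma ptime_ProdNameP:
  assumes A: "ptime \<Gamma> env A (\<lambda>x. enc_name (a x))" and B: "ptime \<Gamma> env B (\<lambda>x. enc_name (b x))"
  shows "ptime \<Gamma> env (ProdNameP A B) (\<lambda>x. enc_name (prod_name (a x) (b x)))"
  unfolding ProdNameP_def prod_name_def
proof (rule ptime_Foreach_additive[where g = "\<lambda>x y c. True # y # c" and e = enc_bool])
  show "ptime \<Gamma> env B (\<lambda>x. enc_list enc_bool (b x))"
    using B by (simp add: enc_name_def)
  show "ptime \<Gamma> env (Pair Nul A) (\<lambda>x. enc_name (False # a x))"
    by (rule ptime_cong, (rule ptime_intros A | (simp; fail))+) ((auto simp: enc_name_def))?
  show "ptime (loop_ctx \<Gamma> (\<lambda>x. length (b x)))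
     (\<lambda>z. enc_bool (y z) # enc_name (c z) # s z # env (fst z))
     (Pair (Const (enc_bool True)) (Pair (Var 0) (Var 1))) (\<lambda>z. enc_name (True # y z # c z))" for y c s
    by (rule ptime_cong, (rule ptime_intros | (simp; fail))+) ((auto simp: enc_name_def))?
  show "\<exists>K. pbounded \<Gamma> K \<and> (\<forall>x\<in>pts \<Gamma>. \<forall>y\<in>set (b x). \<forall>c.
      size (enc_name (True # y # c)) \<le> size (enc_name c) + K x)"
    using size_enc_bool by (intro exI[of _ "\<lambda>x. 4"] conjI pbounded_const) (auto simp: enc_name_def)
qed

text \<open>Each bit of \<open>b\<close> turns into two list cells and two encoded bits, of total
  size at most 4. The coefficient 1 of \<open>a\<close> is what keeps nested products small in
  \<open>learn_names\<close>.\<close>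

lemma size_prod_name: "size (enc_name (prod_name a b)) \<le> size (enc_name a) + 4 * size (enc_name b) + 1"
proof -
  have "size (enc_list enc_bool (fold (\<lambda>x c. True # x # c) b c)) \<le> size (enc_list enc_bool c) + 4 * size (enc_list enc_bool b)" for c
  proof (induction b arbitrary: c)
    case (Cons x b)
    show ?case using Cons[of "True # x # c"] size_enc_bool[of x] by simp
  qed simp
  from this[of "False # a"] show ?thesis by (simp add: prod_name_def enc_name_def)
qed

lemma size_prod_tuple:
  "size (enc_list enc_name (prod_tuple as bs)) \<le> 2 * size (enc_list enc_name as) + 4 * size (enc_list enc_name bs)"
proof (induction "as" arbitrary: bs)
  case (Cons a "as")
  show ?case
  proof (cases bs)
    case Nil
    then show ?thesis using Cons[of "[]"] size_prod_name[of a "[]"] by (simp add: enc_name_def)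
  next
    case (Cons b bs')
    then show ?thesis using Cons.IH[of bs'] size_prod_name[of a b] by simp
  qed
qed simp

lemma fold_prod_tuple:
  "fold (\<lambda>a r. (tl (fst r), prod_name a (case fst r of [] \<Rightarrow> [] | b # _ \<Rightarrow> b) # snd r)) as (bs, out) =
   (drop (length as) bs, rev (prod_tuple as bs) @ out)"
  by (induction "as" arbitrary: bs out) (auto simp: drop_Suc)

lemma ptime_ProdTupleP:
  assumes A: "ptime \<Gamma> env A (\<lambda>x. enc_list enc_name (as x))"
    and B: "ptime \<Gamma> env B (\<lambda>x. enc_list enc_name (bs x))"
  shows "ptime \<Gamma> env (ProdTupleP A B) (\<lambda>x. enc_list enc_name (prod_tuple (as x) (bs x)))"
proof -
  let ?enc = "\<lambda>r. Node (enc_list enc_name (fst r)) (enc_list enc_name (snd r))"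
  let ?g = "\<lambda>x a r. (tl (fst r), prod_name a (case fst r of [] \<Rightarrow> [] | b # _ \<Rightarrow> b) # snd r)"
  \<comment> \<open>The additive rule does not apply: for an arbitrary accumulator, the name taken
    from its first component is not bounded in terms of \<open>x\<close>. The actual accumulators
    are known from \<open>fold_prod_tuple\<close>.\<close>
  have "ptime \<Gamma> env (Foreach A (Pair B Nul)
     (Pair (Rgt (Lft (Var 1))) (Pair (ProdNameP (Var 0) (Lft (Lft (Var 1)))) (Rgt (Var 1)))))
     (\<lambda>x. ?enc (fold (?g x) (as x) (bs x, [])))"
  proof (rule ptime_Foreach[where g = ?g and encb = ?enc and e = enc_name])
    show "ptime \<Gamma> env A (\<lambda>x. enc_list enc_name (as x))" by (rule A)
    show "ptime \<Gamma> env (Pair B Nul) (\<lambda>x. ?enc (bs x, []))"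
      by (rule ptime_cong, (rule ptime_intros B | (simp; fail))+) (auto)?
    show "ptime (loop_ctx \<Gamma> (\<lambda>x. length (as x)))
     (\<lambda>z. enc_name (as (fst z) ! snd z) # ?enc (fold (?g (fst z)) (take (snd z) (as (fst z))) (bs (fst z), [])) #
        s z # env (fst z))
     (Pair (Rgt (Lft (Var 1))) (Pair (ProdNameP (Var 0) (Lft (Lft (Var 1)))) (Rgt (Var 1))))
     (\<lambda>z. ?enc (?g (fst z) (as (fst z) ! snd z) (fold (?g (fst z)) (take (snd z) (as (fst z))) (bs (fst z), []))))" for s
    proof (rule ptime_cong[OF ptime_Pair[OF _ ptime_Pair[OF ptime_ProdNameP]]])
      show "ptime (loop_ctx \<Gamma> (\<lambda>x. length (as x)))
       (\<lambda>z. enc_name (as (fst z) ! snd z) # ?enc (fold (?g (fst z)) (take (snd z) (as (fst z))) (bs (fst z), [])) #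
          s z # env (fst z)) (Lft (Lft (Var 1)))
       (\<lambda>z. enc_name (case fst (fold (?g (fst z)) (take (snd z) (as (fst z))) (bs (fst z), [])) of [] \<Rightarrow> [] | b # _ \<Rightarrow> b))"
        by (rule ptime_cong, (rule ptime_intros | (simp; fail))+) ((auto simp: enc_name_def split: list.splits))?
      show "ptime (loop_ctx \<Gamma> (\<lambda>x. length (as x)))
       (\<lambda>z. enc_name (as (fst z) ! snd z) # ?enc (fold (?g (fst z)) (take (snd z) (as (fst z))) (bs (fst z), [])) #
          s z # env (fst z)) (Var 0) (\<lambda>z. enc_name (as (fst z) ! snd z))"
        by (rule ptime_cong, (rule ptime_intros | (simp; fail))+) (auto)?
    qed (rule ptime_intros | simp)+
    assume e: "env_bounded \<Gamma> env"
    show "\<exists>K. pbounded \<Gamma> K \<and> (\<forall>x\<in>pts \<Gamma>. \<forall>i\<le>length (as x).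
        size (?enc (fold (?g x) (take i (as x)) (bs x, []))) \<le> K x)"
    proof (intro exI conjI ballI allI impI)
      show "pbounded \<Gamma> (\<lambda>x. 1 + size (enc_list enc_name (bs x)) +
         (2 * size (enc_list enc_name (as x)) + 4 * size (enc_list enc_name (bs x))))"
        using ptime_size[OF A e] ptime_size[OF B e] by (intro pbounded_intros)
      show "size (?enc (fold (?g x) (take i (as x)) (bs x, []))) \<le> 1 + size (enc_list enc_name (bs x)) +
         (2 * size (enc_list enc_name (as x)) + 4 * size (enc_list enc_name (bs x)))" for x i
        using size_prod_tuple[of "take i (as x)" "bs x"] size_enc_list_take[of enc_name i "as x"]
          size_enc_list_drop[of enc_name "length (take i (as x))" "bs x"]
        unfolding fold_prod_tuple by simp
    qed
  qed
  then have *: "ptime \<Gamma> env (Rgt (Foreach A (Pair B Nul)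
     (Pair (Rgt (Lft (Var 1))) (Pair (ProdNameP (Var 0) (Lft (Lft (Var 1)))) (Rgt (Var 1))))))
     (\<lambda>x. enc_list enc_name (rev (prod_tuple (as x) (bs x))))"
    unfolding fold_prod_tuple by (rule ptime_cong[OF ptime_Rgt]) simp
  show ?thesis
    unfolding ProdTupleP_def
    by (rule ptime_cong[OF ptime_RevAppP[OF *, of Nul "\<lambda>x. []"]])
      (auto intro: ptime_cong[OF ptime_Nul] simp: fold_Cons_rev)
qed

lemma size_prod_fact:
  "size (enc_atom (fst g, prod_tuple (snd f) (snd g))) \<le> 2 * size (enc_atom f) + 4 * size (enc_atom g)"
  using size_prod_tuple[of "snd f" "snd g"] by (simp add: enc_atom_def split_beta)

lemma size_fold_prod_facts:
  assumes "\<And>g. g \<in> set gs \<Longrightarrow> size (enc_atom g) \<le> m"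
  shows "size (enc_list enc_atom (fold (\<lambda>g c. if fst f = fst g then (fst g, prod_tuple (snd f) (snd g)) # c else c) gs c))
    \<le> size (enc_list enc_atom c) + length gs * (1 + 2 * size (enc_atom f) + 4 * m)"
  using assms
proof (induction gs arbitrary: c)
  case (Cons h gs)
  let ?c = "if fst f = fst h then (fst h, prod_tuple (snd f) (snd h)) # c else c"
  have "size (enc_list enc_atom ?c) \<le> size (enc_list enc_atom c) + (1 + 2 * size (enc_atom f) + 4 * m)"
    using size_prod_fact[of h f] Cons.prems[of h] by simp
  then show ?case
    using Cons.IH[of ?c] Cons.prems by simp
qed simp

lemma ptime_ProdFactsP:
  assumes i: "\<And>x. x \<in> pts \<Gamma> \<Longrightarrow> i < length (env x) \<and> env x ! i = enc_cq (p x)"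
    and j: "\<And>x. x \<in> pts \<Gamma> \<Longrightarrow> j < length (env x) \<and> env x ! j = enc_cq (q x)"
  shows "ptime \<Gamma> env (ProdFactsP i j) (\<lambda>x. enc_list enc_atom (prod_facts (body (p x)) (body (q x))))"
proof -
  let ?g = "\<lambda>f g c. if fst f = fst g then (fst g, prod_tuple (snd f) (snd g)) # c else c"
  let ?enc = "enc_list enc_atom"
  let ?\<Gamma> = "loop_ctx \<Gamma> (\<lambda>x. length (body (p x)))"
  have g: "size (?enc (?g f g c)) \<le> size (?enc c) + (1 + 2 * size (enc_atom f) + 4 * size (enc_atom g))" for f g c
    using size_prod_fact[of g f] by simp
  show ?thesis
    unfolding ProdFactsP_def prod_facts_def
  proof (rule ptime_Foreach_additive[where e = enc_atom and encb = ?enc and xs = "\<lambda>x. body (p x)"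
        and g = "\<lambda>x f c. fold (?g f) (body (q x)) c"])
    show "ptime \<Gamma> env (Lft (Var i)) (\<lambda>x. ?enc (body (p x)))"
      by (rule ptime_cong, (rule ptime_intros | (simp; fail))+) ((use i in auto))?
    show "ptime \<Gamma> env Nul (\<lambda>x. ?enc [])"
      by (rule ptime_cong, (rule ptime_intros | (simp; fail))+) (auto)?
    fix f c s
    let ?env = "\<lambda>z :: _ \<times> nat. enc_atom (f z) # ?enc (c z) # s z # env (fst z)"
    show "ptime ?\<Gamma> ?env (Foreach (Lft (Var (j + 3))) (Var 1)
      (Cond (Equal (Lft (Var 3)) (Lft (Var 0)))
       (Pair (Pair (Lft (Var 0)) (ProdTupleP (Rgt (Var 3)) (Rgt (Var 0)))) (Var 1)) (Var 1)))
     (\<lambda>z. ?enc (fold (?g (f z)) (body (q (fst z))) (c z)))"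
    proof (rule ptime_Foreach_additive[where e = enc_atom and encb = ?enc and g = "\<lambda>z. ?g (f z)"])
      show "ptime ?\<Gamma> ?env (Lft (Var (j + 3))) (\<lambda>z. ?enc (body (q (fst z))))"
        by (rule ptime_cong, (rule ptime_intros | (simp; fail))+) ((use j in auto))?
      show "ptime ?\<Gamma> ?env (Var 1) (\<lambda>z. ?enc (c z))"
        by (rule ptime_cong, (rule ptime_intros | (simp; fail))+) (auto)?
      fix y b s'
      let ?\<Delta> = "loop_ctx ?\<Gamma> (\<lambda>z. length (body (q (fst z))))"
      let ?env' = "\<lambda>z :: _ \<times> nat. enc_atom (y z) # ?enc (b z) # s' z # ?env (fst z)"
      have "ptime ?\<Delta> ?env' (ProdTupleP (Rgt (Var 3)) (Rgt (Var 0)))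
         (\<lambda>z. enc_list enc_name (prod_tuple (snd (f (fst z))) (snd (y z))))"
      proof (rule ptime_ProdTupleP)
        show "ptime ?\<Delta> ?env' (Rgt (Var 3)) (\<lambda>z. enc_list enc_name (snd (f (fst z))))"
          by (rule ptime_cong, (rule ptime_intros | (simp; fail))+) (auto)?
        show "ptime ?\<Delta> ?env' (Rgt (Var 0)) (\<lambda>z. enc_list enc_name (snd (y z)))"
          by (rule ptime_cong, (rule ptime_intros | (simp; fail))+) (auto)?
      qed
      then show "ptime ?\<Delta> ?env' (Cond (Equal (Lft (Var 3)) (Lft (Var 0)))
         (Pair (Pair (Lft (Var 0)) (ProdTupleP (Rgt (Var 3)) (Rgt (Var 0)))) (Var 1)) (Var 1))
         (\<lambda>z. ?enc (?g (f (fst z)) (y z) (b z)))"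
        by (intro ptime_cong[OF ptime_Cond[OF ptime_Equal[OF ptime_Lft[OF ptime_Var] ptime_Lft[OF ptime_Var]]
              ptime_Pair[OF ptime_Pair[OF ptime_Lft[OF ptime_Var]] ptime_Var] ptime_Var]])
          (auto simp: inj_eq[OF inj_enc_name] enc_atom_Pair)
    next
      assume e: "env_bounded ?\<Gamma> ?env"
      have f: "pbounded ?\<Gamma> (\<lambda>z. size (enc_atom (f z)))"
        using env_bounded_nth[OF e, of 0] by simp
      \<comment> \<open>Bounds are expressed through entries of the environment, since these are the
        quantities known to be polynomial.\<close>
      have q: "pbounded ?\<Gamma> (\<lambda>z. size (?env z ! (j + 3)))"
        by (rule env_bounded_nth[OF e]) (use j in auto)
      show "\<exists>K. pbounded ?\<Gamma> K \<and> (\<forall>z\<in>pts ?\<Gamma>. \<forall>y\<in>set (body (q (fst z))). \<forall>b.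
         size (?enc (?g (f z) y b)) \<le> size (?enc b) + K z)"
      proof (intro exI conjI ballI allI)
        show "pbounded ?\<Gamma> (\<lambda>z. 1 + 2 * size (enc_atom (f z)) + 4 * size (?env z ! (j + 3)))"
          using f q by (intro pbounded_intros)
        fix z y b assume z: "z \<in> pts ?\<Gamma>" and y: "y \<in> set (body (q (fst z)))"
        have "size (enc_atom y) \<le> size (?env z ! (j + 3))"
          using size_enc_list_member[OF y, of enc_atom] j[of "fst z"] z by (simp add: enc_cq_def)
        then show "size (?enc (?g (f z) y b)) \<le> size (?enc b) + (1 + 2 * size (enc_atom (f z)) + 4 * size (?env z ! (j + 3)))"
          using g[of "f z" y b] by linarith
      qed
    qed
  next
    assume e: "env_bounded \<Gamma> env"
    show "\<exists>K. pbounded \<Gamma> K \<and> (\<forall>x\<in>pts \<Gamma>. \<forall>f\<in>set (body (p x)). \<forall>b.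
       size (?enc (fold (?g f) (body (q x)) b)) \<le> size (?enc b) + K x)"
    proof (intro exI conjI ballI allI)
      show "pbounded \<Gamma> (\<lambda>x. size (env x ! j) * (1 + 2 * size (env x ! i) + 4 * size (env x ! j)))"
        using i j by (intro pbounded_intros env_bounded_nth[OF e]) auto
      fix x f b assume x: "x \<in> pts \<Gamma>" and f: "f \<in> set (body (p x))"
      have q: "size (?enc (body (q x))) \<le> size (env x ! j)"
        using j[OF x] by (simp add: enc_cq_def)
      have "size (?enc (fold (?g f) (body (q x)) b)) \<le>
         size (?enc b) + length (body (q x)) * (1 + 2 * size (enc_atom f) + 4 * size (env x ! j))"
        using size_enc_list_member[of _ "body (q x)" enc_atom] q by (intro size_fold_prod_facts) fastforce
      also have "\<dots> \<le> size (?enc b) + size (env x ! j) * (1 + 2 * size (env x ! i) + 4 * size (env x ! j))"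
        using size_enc_list_member[OF f, of enc_atom] i[OF x] length_le_size_enc_list[of "body (q x)" enc_atom] q
        by (intro add_mono mult_mono) (auto simp: enc_cq_def)
      finally show "size (?enc (fold (?g f) (body (q x)) b)) \<le>
         size (?enc b) + size (env x ! j) * (1 + 2 * size (env x ! i) + 4 * size (env x ! j))" .
    qed
  qed
qed

lemma ptime_ProdCQP:
  assumes i: "\<And>x. x \<in> pts \<Gamma> \<Longrightarrow> i < length (env x) \<and> env x ! i = enc_cq (p x)"
    and j: "\<And>x. x \<in> pts \<Gamma> \<Longrightarrow> j < length (env x) \<and> env x ! j = enc_cq (q x)"
  shows "ptime \<Gamma> env (ProdCQP i j) (\<lambda>x. enc_cq (prod_cq (p x) (q x)))"
  unfolding ProdCQP_def
proof (rule ptime_cong[OF ptime_Pair[OF ptime_ProdFactsP[OF i j] ptime_ProdTupleP]])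
  show "ptime \<Gamma> env (Rgt (Var i)) (\<lambda>x. enc_list enc_name (head (p x)))"
    by (rule ptime_cong, (rule ptime_intros | (simp; fail))+) ((use i in auto))?
  show "ptime \<Gamma> env (Rgt (Var j)) (\<lambda>x. enc_list enc_name (head (q x)))"
    by (rule ptime_cong, (rule ptime_intros | (simp; fail))+) ((use j in auto))?
qed (auto simp: prod_cq_def enc_cq_def)

lemma ptime_MinimiseP:
  assumes i: "\<And>x. x \<in> pts \<Gamma> \<Longrightarrow> i < length (env x) \<and> env x ! i = enc_cq (p x)"
  shows "ptime \<Gamma> env (MinimiseP i) (\<lambda>x. enc_cq (minimise (\<lambda>c. oracle_of \<Gamma> x (enc_cq c)) (p x)))"
proof -
  let ?enc = "\<lambda>r. Node (enc_list enc_atom (fst r)) (enc_list enc_atom (snd r))"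
  let ?g = "\<lambda>x f (kept, rem).
     if oracle_of \<Gamma> x (enc_cq (CQ (head (p x)) (fold Cons kept (tl rem)))) then (kept, tl rem) else (f # kept, tl rem)"
  let ?\<Gamma> = "loop_ctx \<Gamma> (\<lambda>x. length (body (p x)))"
  let ?B = "LetIn (Rgt (Rgt (Var 1)))
       (Cond (Query (Pair (RevAppP (Lft (Var 2)) (Var 0)) (Rgt (Var (i + 4)))))
         (Pair (Lft (Var 2)) (Var 0))
         (Pair (Pair (Var 1) (Lft (Var 2))) (Var 0)))"
  have "ptime \<Gamma> env (Foreach (Lft (Var i)) (Pair Nul (Lft (Var i))) ?B)
     (\<lambda>x. ?enc (fold (?g x) (body (p x)) ([], body (p x))))"
  proof (rule ptime_Foreach_additive[where e = enc_atom and encb = ?enc and g = ?g])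
    show "ptime \<Gamma> env (Lft (Var i)) (\<lambda>x. enc_list enc_atom (body (p x)))"
      by (rule ptime_cong, (rule ptime_intros | (simp; fail))+) (use i in auto)?
    show "ptime \<Gamma> env (Pair Nul (Lft (Var i))) (\<lambda>x. ?enc ([], body (p x)))"
      by (rule ptime_cong, (rule ptime_intros | (simp; fail))+) (use i in auto)?
    fix y :: "_ \<times> nat \<Rightarrow> fact" and b :: "_ \<Rightarrow> fact list \<times> fact list" and s
    let ?env = "\<lambda>z. enc_atom (y z) # ?enc (b z) # s z # env (fst z)"
    show "ptime ?\<Gamma> ?env ?B (\<lambda>z. ?enc (?g (fst z) (y z) (b z)))"
    proof (rule ptime_LetIn[where v = "\<lambda>z. enc_list enc_atom (tl (snd (b z)))"])
      show "ptime ?\<Gamma> ?env (Rgt (Rgt (Var 1))) (\<lambda>z. enc_list enc_atom (tl (snd (b z))))"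
        by (rule ptime_cong, (rule ptime_intros | (simp; fail))+) auto?
      let ?env' = "\<lambda>z. enc_list enc_atom (tl (snd (b z))) # ?env z"
      have v2: "ptime ?\<Gamma> ?env' (Lft (Var 2)) (\<lambda>z. enc_list enc_atom (fst (b z)))"
        by (rule ptime_cong, (rule ptime_intros | (simp; fail))+) auto?
      have v0: "ptime ?\<Gamma> ?env' (Var 0) (\<lambda>z. enc_list enc_atom (tl (snd (b z))))"
        by (rule ptime_cong, (rule ptime_intros | (simp; fail))+) auto?
      have v1: "ptime ?\<Gamma> ?env' (Var 1) (\<lambda>z. enc_atom (y z))"
        by (rule ptime_cong, (rule ptime_intros | (simp; fail))+) auto?
      have vi: "ptime ?\<Gamma> ?env' (Rgt (Var (i + 4))) (\<lambda>z. enc_list enc_name (head (p (fst z))))"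
        by (rule ptime_cong, (rule ptime_intros | (simp; fail))+) (use i in auto)?
      show "ptime ?\<Gamma> ?env'
        (Cond (Query (Pair (RevAppP (Lft (Var 2)) (Var 0)) (Rgt (Var (i + 4)))))
         (Pair (Lft (Var 2)) (Var 0)) (Pair (Pair (Var 1) (Lft (Var 2))) (Var 0)))
        (\<lambda>z. ?enc (?g (fst z) (y z) (b z)))"
        by (rule ptime_cong[OF ptime_Cond[OF ptime_Query[OF ptime_Pair[OF ptime_RevAppP[OF v2 v0] vi]]
              ptime_Pair[OF v2 v0] ptime_Pair[OF ptime_Pair[OF v1 v2] v0]]])
          (auto simp: enc_cq_def split_beta)
    qed
  next
    assume e: "env_bounded \<Gamma> env"
    show "\<exists>K. pbounded \<Gamma> K \<and> (\<forall>x\<in>pts \<Gamma>. \<forall>f\<in>set (body (p x)). \<forall>b.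
       size (?enc (?g x f b)) \<le> size (?enc b) + K x)"
    proof (intro exI conjI ballI allI)
      show "pbounded \<Gamma> (\<lambda>x. size (env x ! i))"
        using i by (intro env_bounded_nth[OF e]) auto
      fix x f b assume x: "x \<in> pts \<Gamma>" and f: "f \<in> set (body (p x))"
      show "size (?enc (?g x f b)) \<le> size (?enc b) + size (env x ! i)"
        using size_enc_list_member[OF f, of enc_atom] i[OF x] size_enc_list_tl[of enc_atom "snd b"]
        by (auto simp: enc_cq_def split_beta)
    qed
  qed
  from ptime_Lft[OF this]
  have "ptime \<Gamma> env (Lft (Foreach (Lft (Var i)) (Pair Nul (Lft (Var i))) ?B))
     (\<lambda>x. enc_list enc_atom (body (minimise (\<lambda>c. oracle_of \<Gamma> x (enc_cq c)) (p x))))"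
    by (rule ptime_cong) (simp add: minimise_def)
  moreover have "ptime \<Gamma> env (Rgt (Var i)) (\<lambda>x. enc_list enc_name (head (p x)))"
    by (rule ptime_cong, (rule ptime_intros | (simp; fail))+) (use i in auto)?
  ultimately show ?thesis
    unfolding MinimiseP_def by (rule ptime_cong[OF ptime_Pair]) (simp add: minimise_def enc_cq_def)
qed

lemma fold_right_eq_Leaf:
  "fold (\<lambda>_. right) xs (Node d (enc_list e ys)) = Leaf \<longleftrightarrow> length ys < length xs"
proof (induction xs arbitrary: d ys)
  case (Cons x xs)
  have "fold (\<lambda>_. right) xs Leaf = Leaf" by (induction xs) auto
  then show ?case using Cons.IH by (cases ys) auto
qed simp

text \<open>The program returns what is left of the stripped list and not a Boolean, so only the
  distinction between \<open>Leaf\<close> and other trees is specified.\<close>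

lemma ptime_AcceptableP:
  assumes i: "\<And>x. x \<in> pts \<Gamma> \<Longrightarrow> i < length (env x) \<and> env x ! i = enc_cq (p x)"
    and j: "\<And>x. x \<in> pts \<Gamma> \<Longrightarrow> j < length (env x) \<and> env x ! j = enc_list e (ds x)"
  obtains v where "ptime \<Gamma> env (AcceptableP i j) v"
    "\<And>x. v x \<noteq> Leaf \<longleftrightarrow> acceptable (length (ds x)) (\<lambda>c. oracle_of \<Gamma> x (enc_cq c)) (p x)"
proof
  let ?v = "\<lambda>x. fold (\<lambda>_. right) (body (p x)) (Node Leaf (enc_list e (ds x)))"
  have "ptime \<Gamma> env (Foreach (Lft (Var i)) (Pair Nul (Var j)) (Rgt (Var 1))) ?v"
  proof (rule ptime_Foreach_additive[where e = enc_atom and encb = "\<lambda>d. d" and g = "\<lambda>_ _. right"])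
    show "ptime \<Gamma> env (Lft (Var i)) (\<lambda>x. enc_list enc_atom (body (p x)))"
      by (rule ptime_cong, (rule ptime_intros | (simp; fail))+) (use i in auto)?
    show "ptime \<Gamma> env (Pair Nul (Var j)) (\<lambda>x. Node Leaf (enc_list e (ds x)))"
      by (rule ptime_cong, (rule ptime_intros | (simp; fail))+) (use j in auto)?
    show "ptime (loop_ctx \<Gamma> (\<lambda>x. length (body (p x))))
      (\<lambda>z. enc_atom (y z) # b z # s z # env (fst z)) (Rgt (Var 1)) (\<lambda>z. right (b z))" for y b s
      by (rule ptime_cong, (rule ptime_intros | (simp; fail))+) auto?
    show "\<exists>K. pbounded \<Gamma> K \<and> (\<forall>x\<in>pts \<Gamma>. \<forall>y\<in>set (body (p x)). \<forall>b. size (right b) \<le> size b + K x)"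
      using size_right by (intro exI[of _ "\<lambda>x. 0"] conjI pbounded_const) auto
  qed
  moreover have "ptime \<Gamma> env (Var i) (\<lambda>x. enc_cq (p x))"
    by (rule ptime_cong, (rule ptime_intros | (simp; fail))+) (use i in auto)?
  ultimately show "ptime \<Gamma> env (AcceptableP i j)
      (\<lambda>x. if enc_bool (oracle_of \<Gamma> x (enc_cq (p x))) \<noteq> Leaf then ?v x else Leaf)"
    unfolding AcceptableP_def by (intro ptime_Cond ptime_Query ptime_Nul)
  show "(if enc_bool (oracle_of \<Gamma> x (enc_cq (p x))) \<noteq> Leaf then ?v x else Leaf) \<noteq> Leaf \<longleftrightarrow>
      acceptable (length (ds x)) (\<lambda>c. oracle_of \<Gamma> x (enc_cq c)) (p x)" for x
    by (auto simp: acceptable_def fold_right_eq_Leaf)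
qed

lemma size_minimise: "size (enc_cq (minimise pos p)) \<le> size (enc_cq p)"
proof -
  have "size (enc_list enc_atom (fst (fold (\<lambda>f (kept, rem).
      if pos (CQ (head p) (fold Cons kept (tl rem))) then (kept, tl rem) else (f # kept, tl rem)) fs (kept, rem))))
    \<le> size (enc_list enc_atom kept) + size (enc_list enc_atom fs)" for fs kept rem
  proof (induction fs arbitrary: kept rem)
    case (Cons f fs)
    show ?case using Cons[of kept "tl rem"] Cons[of "f # kept" "tl rem"] by simp
  qed simp
  from this[of "body p" "[]" "body p"] show ?thesis
    by (simp add: minimise_def enc_cq_def)
qed

lemma size_prod_cq:
  "size (enc_cq (prod_cq p q)) \<le> 1 + size (enc_cq p) * (size (enc_cq q) * (1 + 2 * size (enc_cq p) + 4 * size (enc_cq q)))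
    + (2 * size (enc_cq p) + 4 * size (enc_cq q))"
proof -
  let ?g = "\<lambda>f g c. if fst f = fst g then (fst g, prod_tuple (snd f) (snd g)) # c else c"
  let ?K = "size (enc_cq q) * (1 + 2 * size (enc_cq p) + 4 * size (enc_cq q))"
  have "size (enc_list enc_atom (fold (\<lambda>f c. fold (?g f) (body q) c) fs c)) \<le> size (enc_list enc_atom c) + length fs * ?K"
    if "set fs \<subseteq> set (body p)" for fs c
    using that
  proof (induction fs arbitrary: c)
    case (Cons f fs)
    have "size (enc_list enc_atom (fold (?g f) (body q) c)) \<le>
      size (enc_list enc_atom c) + length (body q) * (1 + 2 * size (enc_atom f) + 4 * size (enc_cq q))"
      using size_enc_list_member[of _ "body q" enc_atom] by (intro size_fold_prod_facts) (fastforce simp: enc_cq_def)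
    also have "\<dots> \<le> size (enc_list enc_atom c) + ?K"
      using size_enc_list_member[of f "body p" enc_atom] length_le_size_enc_list[of "body q" enc_atom] Cons.prems
      by (intro add_mono mult_mono) (auto simp: enc_cq_def)
    finally show ?case using Cons.IH[of "fold (?g f) (body q) c"] Cons.prems by simp
  qed simp
  from this[of "body p" "[]"]
  have "size (enc_list enc_atom (prod_facts (body p) (body q))) \<le> length (body p) * ?K"
    by (simp add: prod_facts_def)
  also have "\<dots> \<le> size (enc_cq p) * ?K"
    using length_le_size_enc_list[of "body p" enc_atom] by (intro mult_le_mono1) (simp add: enc_cq_def)
  finally show ?thesis
    using size_prod_tuple[of "head p" "head q"] by (simp add: prod_cq_def enc_cq_def)
qed

text \<open>For one update the inner loop is additive: a round contributes a refined or an old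
  hypothesis, of size bounded in terms of the old list and \<open>e\<close>. This says nothing about
  iterated updates.\<close>

lemma ptime_UpdateP:
  assumes env: "\<And>x. x \<in> pts \<Gamma> \<Longrightarrow>
     env x = Node (enc_cq (e x)) (l x) # enc_list enc_cq (Hs x) # s x # enc_list f (ds x) # rest x"
  shows "ptime \<Gamma> env UpdateP
    (\<lambda>x. enc_list enc_cq (update (length (ds x)) (\<lambda>c. oracle_of \<Gamma> x (enc_cq c)) (e x) (Hs x)))"
proof -
  define pos where "pos x c = oracle_of \<Gamma> x (enc_cq c)" for x c
  let ?env = "\<lambda>x. enc_cq (e x) # env x"
  let ?enc = "\<lambda>r. Node (enc_bool (fst r)) (enc_list enc_cq (snd r))"
  let ?g = "\<lambda>x. refine (length (ds x)) (pos x) (e x)"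
  let ?\<Gamma> = "loop_ctx \<Gamma> (\<lambda>x. length (Hs x))"
  let ?B = "LetIn (ProdCQP 0 3) (LetIn (MinimiseP 0)
         (Cond (AcceptableP 0 9)
           (Pair (Const (enc_bool True)) (Pair (Var 0) (Rgt (Var 3))))
           (Pair (Lft (Var 3)) (Pair (Var 2) (Rgt (Var 3))))))"
  have "ptime \<Gamma> ?env (Foreach (Var 2) (Const (Node Leaf Leaf)) ?B) (\<lambda>x. ?enc (fold (?g x) (Hs x) (False, [])))"
  proof (rule ptime_Foreach_additive[where e = enc_cq and encb = ?enc and g = ?g])
    show "ptime \<Gamma> ?env (Var 2) (\<lambda>x. enc_list enc_cq (Hs x))"
      by (rule ptime_cong, (rule ptime_intros | (simp add: env; fail))+)?
    show "ptime \<Gamma> ?env (Const (Node Leaf Leaf)) (\<lambda>x. ?enc (False, []))"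
      by (rule ptime_cong[OF ptime_Const]) simp
    fix y :: "_ \<times> nat \<Rightarrow> cq" and b :: "_ \<Rightarrow> bool \<times> cq list" and s'
    let ?env1 = "\<lambda>z. enc_cq (y z) # ?enc (b z) # s' z # ?env (fst z)"
    let ?p = "\<lambda>z. prod_cq (y z) (e (fst z))"
    let ?m = "\<lambda>z. minimise (pos (fst z)) (?p z)"
    let ?env2 = "\<lambda>z. enc_cq (?p z) # ?env1 z"
    let ?env3 = "\<lambda>z. enc_cq (?m z) # ?env2 z"
    have p: "ptime ?\<Gamma> ?env1 (ProdCQP 0 3) (\<lambda>z. enc_cq (?p z))"
      by (rule ptime_ProdCQP) auto
    have m: "ptime ?\<Gamma> ?env2 (MinimiseP 0) (\<lambda>z. enc_cq (?m z))"
      by (rule ptime_cong[OF ptime_MinimiseP[where p = ?p]]) (auto simp: pos_def[abs_def])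
    obtain v where v: "ptime ?\<Gamma> ?env3 (AcceptableP 0 9) v"
      "\<And>z. v z \<noteq> Leaf \<longleftrightarrow> acceptable (length (ds (fst z))) (\<lambda>c. oracle_of ?\<Gamma> z (enc_cq c)) (?m z)"
      by (rule ptime_AcceptableP[of ?\<Gamma> 0 ?env3 ?m 9 f "\<lambda>z. ds (fst z)"]) (auto simp: env)
    have A: "ptime ?\<Gamma> ?env3 (Pair (Const (enc_bool True)) (Pair (Var 0) (Rgt (Var 3))))
        (\<lambda>z. ?enc (True, ?m z # snd (b z)))"
      by (rule ptime_cong, (rule ptime_intros | (simp; fail))+)?
    have B: "ptime ?\<Gamma> ?env3 (Pair (Lft (Var 3)) (Pair (Var 2) (Rgt (Var 3))))
        (\<lambda>z. ?enc (fst (b z), y z # snd (b z)))"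
      by (rule ptime_cong, (rule ptime_intros | (simp; fail))+)?
    show "ptime ?\<Gamma> ?env1 ?B (\<lambda>z. ?enc (?g (fst z) (y z) (b z)))"
      by (rule ptime_cong[OF ptime_LetIn[OF p ptime_LetIn[OF m ptime_Cond[OF v(1) A B]]]])
        (auto simp: v(2) refine_def pos_def[abs_def] Let_def)
  next
    assume eb: "env_bounded \<Gamma> ?env"
    show "\<exists>K. pbounded \<Gamma> K \<and> (\<forall>x\<in>pts \<Gamma>. \<forall>h\<in>set (Hs x). \<forall>b.
       size (?enc (?g x h b)) \<le> size (?enc b) + K x)"
    proof (intro exI conjI ballI allI)
      let ?E = "\<lambda>x. size (?env x ! 0)" and ?H = "\<lambda>x. size (?env x ! 2)"
      let ?K = "\<lambda>x. 1 + ?H x * (?E x * (1 + 2 * ?H x + 4 * ?E x)) + (2 * ?H x + 4 * ?E x)"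
      show "pbounded \<Gamma> (\<lambda>x. 2 + ?H x + ?K x)"
        by (intro pbounded_intros env_bounded_nth[OF eb]) (auto simp: env)
      fix x h b assume x: "x \<in> pts \<Gamma>" and h: "h \<in> set (Hs x)"
      have hs: "size (enc_cq h) \<le> ?H x"
        using size_enc_list_member[OF h, of enc_cq] by (simp add: env[OF x])
      have "size (enc_cq (minimise (pos x) (prod_cq h (e x)))) \<le> size (enc_cq (prod_cq h (e x)))"
        by (rule size_minimise)
      also have "\<dots> \<le> 1 + size (enc_cq h) * (?E x * (1 + 2 * size (enc_cq h) + 4 * ?E x)) + (2 * size (enc_cq h) + 4 * ?E x)"
        using size_prod_cq[of h "e x"] by simp
      also have "\<dots> \<le> ?K x"
        using hs by (intro add_mono mult_mono) auto
      finally show "size (?enc (?g x h b)) \<le> size (?enc b) + (2 + ?H x + ?K x)"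
        using hs size_enc_bool[of True] by (auto simp: refine_def Let_def)
    qed
  qed
  note loop = this
  define r where "r x = fold (?g x) (Hs x) (False, [])" for x
  let ?env1 = "\<lambda>x. ?enc (r x) # ?env x"
  let ?m = "\<lambda>x. minimise (pos x) (e x)"
  let ?env2 = "\<lambda>x. enc_cq (?m x) # ?env1 x"
  have e: "ptime \<Gamma> env (Lft (Var 0)) (\<lambda>x. enc_cq (e x))"
    by (rule ptime_cong, (rule ptime_intros | (simp add: env; fail))+)?
  have m: "ptime \<Gamma> ?env1 (MinimiseP 1) (\<lambda>x. enc_cq (?m x))"
    by (rule ptime_cong[OF ptime_MinimiseP[where p = e]]) (auto simp: pos_def[abs_def])
  obtain v where v: "ptime \<Gamma> ?env2 (AcceptableP 0 6) v"
    "\<And>x. v x \<noteq> Leaf \<longleftrightarrow> acceptable (length (ds x)) (\<lambda>c. oracle_of \<Gamma> x (enc_cq c)) (?m x)"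
    by (rule ptime_AcceptableP[of \<Gamma> 0 ?env2 ?m 6 f ds]) (auto simp: env)
  have C: "ptime \<Gamma> ?env1 (Lft (Var 0)) (\<lambda>x. enc_bool (fst (r x)))"
    by (rule ptime_cong, (rule ptime_intros | (simp add: env; fail))+)?
  have D: "ptime \<Gamma> ?env1 (Rgt (Var 0)) (\<lambda>x. enc_list enc_cq (snd (r x)))"
    by (rule ptime_cong, (rule ptime_intros | (simp add: env; fail))+)?
  have E: "ptime \<Gamma> ?env2 (Pair (Var 0) (Var 4)) (\<lambda>x. enc_list enc_cq (?m x # Hs x))"
    by (rule ptime_cong, (rule ptime_intros | (simp add: env; fail))+)?
  have F: "ptime \<Gamma> ?env2 (Var 4) (\<lambda>x. enc_list enc_cq (Hs x))"
    by (rule ptime_cong, (rule ptime_intros | (simp add: env; fail))+)?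
  show ?thesis
    unfolding UpdateP_def
    by (rule ptime_cong[OF ptime_LetIn[OF e ptime_LetIn[OF loop[folded r_def]
            ptime_Cond[OF C D ptime_LetIn[OF m ptime_Cond[OF v(1) E F]]]]]])
      (auto simp: v(2) update_def r_def pos_def[abs_def] Let_def)
qed

text \<open>Updates may compound, so the size of the intermediate hypotheses remains a premise;
  \<open>learner_time\<close> discharges it by the invariants of the learner.\<close>

lemma ptime_LearnP:
  assumes env: "\<And>x. x \<in> pts \<Gamma> \<Longrightarrow> env x = [enc_list (\<lambda>(c, l). Node (enc_cq c) (enc_bool l)) (ds x)]"
    and bound: "\<exists>K. pbounded \<Gamma> K \<and> (\<forall>x\<in>pts \<Gamma>. \<forall>i\<le>length (ds x). size (enc_list enc_cq
      (learn (length (ds x)) (\<lambda>c. oracle_of \<Gamma> x (enc_cq c)) start (map fst (take i (ds x))))) \<le> K x)"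
  shows "ptime \<Gamma> env (LearnP start)
    (\<lambda>x. enc_list enc_cq (learn (length (ds x)) (\<lambda>c. oracle_of \<Gamma> x (enc_cq c)) start (map fst (ds x))))"
proof -
  let ?e = "\<lambda>(c, l). Node (enc_cq c) (enc_bool l)"
  let ?g = "\<lambda>x d. update (length (ds x)) (\<lambda>c. oracle_of \<Gamma> x (enc_cq c)) (fst d)"
  have l: "fold (?g x) es [start] = learn (length (ds x)) (\<lambda>c. oracle_of \<Gamma> x (enc_cq c)) start (map fst es)" for x es
    by (simp add: learn_def fold_map comp_def)
  have "ptime \<Gamma> env (LearnP start) (\<lambda>x. enc_list enc_cq (fold (?g x) (ds x) [start]))"
    unfolding LearnP_def
  proof (rule ptime_Foreach[where g = ?g and encb = "enc_list enc_cq" and e = ?e])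
    show "ptime \<Gamma> env (Var 0) (\<lambda>x. enc_list ?e (ds x))"
      by (rule ptime_cong, (rule ptime_intros | (simp add: env; fail))+)?
    show "ptime \<Gamma> env (Const (enc_list enc_cq [start])) (\<lambda>x. enc_list enc_cq [start])"
      by (rule ptime_Const)
    show "ptime (loop_ctx \<Gamma> (\<lambda>x. length (ds x)))
     (\<lambda>z. ?e (ds (fst z) ! snd z) # enc_list enc_cq (fold (?g (fst z)) (take (snd z) (ds (fst z))) [start]) # s z # env (fst z))
     UpdateP (\<lambda>z. enc_list enc_cq (?g (fst z) (ds (fst z) ! snd z) (fold (?g (fst z)) (take (snd z) (ds (fst z))) [start])))" for s
      by (rule ptime_cong[OF ptime_UpdateP[where e = "\<lambda>z. fst (ds (fst z) ! snd z)" and f = ?e and ds = "\<lambda>z. ds (fst z)"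
              and l = "\<lambda>z. enc_bool (snd (ds (fst z) ! snd z))" and s = s and rest = "\<lambda>z. []"
              and Hs = "\<lambda>z. fold (?g (fst z)) (take (snd z) (ds (fst z))) [start]"]])
        (auto simp: env split_beta)
  qed (use bound in \<open>simp add: l\<close>)
  then show ?thesis unfolding l .
qed

section \<open>Homomorphisms, products and minimisation\<close>

text \<open>A homomorphism respecting the heads. If \<open>c\<close> is read as a query, this is
  containment of \<open>c\<close> in \<open>q\<close> (Chandra and Merlin); if \<open>c\<close> is
  read as a pointed instance, it is satisfaction of \<open>q\<close>.\<close>

definition maps_to :: "cq \<Rightarrow> cq \<Rightarrow> bool" where
  "maps_to q c \<longleftrightarrow> head c \<in> cq_answers q (set (body c))"

lemma maps_to_iff:
  "maps_to q c \<longleftrightarrow> (\<exists>g. map g (head q) = head c \<and> (\<forall>(R, zs) \<in> set (body q). (R, map g zs) \<in> set (body c)))"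
  by (simp add: maps_to_def cq_answers_def)

lemma maps_to_trans:
  assumes "maps_to p q" "maps_to q r" shows "maps_to p r"
proof -
  obtain g h where g: "map g (head p) = head q" "\<forall>(R, zs) \<in> set (body p). (R, map g zs) \<in> set (body q)"
    and h: "map h (head q) = head r" "\<forall>(R, zs) \<in> set (body q). (R, map h zs) \<in> set (body r)"
    using assms unfolding maps_to_iff by blast
  have "map (h \<circ> g) (head p) = head r"
    using g(1) h(1) by (metis map_map)
  moreover have "(R, map (h \<circ> g) zs) \<in> set (body r)" if "(R, zs) \<in> set (body p)" for R zs
    using g(2) h(2) that by fastforce
  ultimately show ?thesis unfolding maps_to_iff by blast
qed

lemma maps_to_subset: "head p = head q \<Longrightarrow> set (body p) \<subseteq> set (body q) \<Longrightarrow> maps_to p q"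
  unfolding maps_to_iff by (rule exI[of _ id]) auto

lemma maps_to_length: "maps_to p q \<Longrightarrow> length (head p) = length (head q)"
  unfolding maps_to_iff by (metis length_map)

fun prod_fst :: "name \<Rightarrow> name" where
  "prod_fst (True # x # c) = prod_fst c"
| "prod_fst (False # a) = a"
| "prod_fst _ = []"

fun prod_snd :: "name \<Rightarrow> name" where
  "prod_snd (True # x # c) = prod_snd c @ [x]"
| "prod_snd _ = []"

lemma prod_fst_prod_name [simp]: "prod_fst (prod_name a b) = a"
proof -
  have "prod_fst (fold (\<lambda>x c. True # x # c) b c) = prod_fst c" for c
    by (induction b arbitrary: c) auto
  then show ?thesis by (simp add: prod_name_def)
qed

lemma prod_snd_prod_name [simp]: "prod_snd (prod_name a b) = b"
proof -
  have "prod_snd (fold (\<lambda>x c. True # x # c) b c) = prod_snd c @ b" for c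
    by (induction b arbitrary: c) auto
  then show ?thesis by (simp add: prod_name_def)
qed

lemma length_prod_tuple [simp]: "length (prod_tuple as bs) = length as"
  by (induction "as" arbitrary: bs) auto

lemma map_prod_fst [simp]: "map prod_fst (prod_tuple as bs) = as"
  by (induction "as" arbitrary: bs) auto

lemma map_prod_snd: "length as = length bs \<Longrightarrow> map prod_snd (prod_tuple as bs) = bs"
proof (induction "as" arbitrary: bs)
  case (Cons a "as")
  then show ?case by (cases bs) auto
qed simp

lemma prod_tuple_map: "prod_tuple (map g zs) (map h zs) = map (\<lambda>z. prod_name (g z) (h z)) zs"
  by (induction zs) auto

lemma set_prod_facts:
  "set (prod_facts Fs Gs) = {(R, prod_tuple ts us) | R ts us. (R, ts) \<in> set Fs \<and> (R, us) \<in> set Gs}"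
proof -
  let ?g = "\<lambda>f g c. if fst f = fst g then (fst g, prod_tuple (snd f) (snd g)) # c else c"
  have 1: "set (fold (?g f) Gs c) = set c \<union> {(fst f, prod_tuple (snd f) us) | us. (fst f, us) \<in> set Gs}" for f c
    by (induction Gs arbitrary: c) auto
  have "set (fold (\<lambda>f c. fold (?g f) Gs c) Fs c) =
      set c \<union> {(R, prod_tuple ts us) | R ts us. (R, ts) \<in> set Fs \<and> (R, us) \<in> set Gs}" for c
  proof (induction Fs arbitrary: c)
    case (Cons f Fs)
    obtain R ts where "f = (R, ts)" by (cases f)
    then show ?case by (simp only: fold_simps Cons.IH 1) (simp, blast)
  qed simp
  then show ?thesis by (simp add: prod_facts_def)
qed

text \<open>Holds for all \<open>p\<close> and \<open>q\<close> because padding preserves the left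
  tuples exactly.\<close>

lemma maps_to_prod_fst: "maps_to (prod_cq p q) p"
  unfolding maps_to_iff by (rule exI[of _ prod_fst]) (auto simp: prod_cq_def set_prod_facts)

text \<open>The universal property of the product: two homomorphisms are paired pointwise. A
  disjunct satisfied by both factors is therefore satisfied by the product.\<close>

lemma maps_to_prod:
  assumes "maps_to q c" "maps_to q d" shows "maps_to q (prod_cq c d)"
proof -
  obtain g h where g: "map g (head q) = head c" "\<forall>(R, zs) \<in> set (body q). (R, map g zs) \<in> set (body c)"
    and h: "map h (head q) = head d" "\<forall>(R, zs) \<in> set (body q). (R, map h zs) \<in> set (body d)"
    using assms unfolding maps_to_iff by blast
  have "(R, map (\<lambda>z. prod_name (g z) (h z)) zs) \<in> set (prod_facts (body c) (body d))"
    if "(R, zs) \<in> set (body q)" for R zs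
    unfolding prod_tuple_map[symmetric] set_prod_facts using that g(2) h(2) by blast
  then show ?thesis
    unfolding maps_to_iff prod_cq_def
    by (intro exI[of _ "\<lambda>z. prod_name (g z) (h z)"]) (auto simp: prod_tuple_map[symmetric] g(1) h(1))
qed

definition wf_cq :: "schema \<Rightarrow> cq \<Rightarrow> bool" where
  "wf_cq S c \<longleftrightarrow> (\<forall>F \<in> set (body c). over_schema S F)"

lemma wf_cq_arity: "wf_cq S c \<Longrightarrow> (R, ts) \<in> set (body c) \<Longrightarrow> S R = Some (length ts)"
  by (auto simp: wf_cq_def over_schema_def)

lemma wf_cq_subset: "wf_cq S c \<Longrightarrow> set (body d) \<subseteq> set (body c) \<Longrightarrow> wf_cq S d"
  by (auto simp: wf_cq_def)

lemma wf_cq_prod: "wf_cq S c \<Longrightarrow> wf_cq S (prod_cq c d)"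
  by (auto simp: wf_cq_def over_schema_def prod_cq_def set_prod_facts split_beta)

text \<open>The second projection recovers the right tuple only if the tuples are equally long; for
  facts this follows from the common schema.\<close>

lemma maps_to_prod_snd:
  assumes "wf_cq S p" "wf_cq S q" "length (head p) = length (head q)"
  shows "maps_to (prod_cq p q) q"
proof -
  have "length ts = length us" if "(R, ts) \<in> set (body p)" "(R, us) \<in> set (body q)" for R ts us
    using wf_cq_arity[OF assms(1) that(1)] wf_cq_arity[OF assms(2) that(2)] by simp
  then show ?thesis
    using assms(3) unfolding maps_to_iff
    by (intro exI[of _ prod_snd]) (auto simp: prod_cq_def set_prod_facts map_prod_snd)
qed

section \<open>Minimisation\<close>

lemma head_minimise [simp]: "head (minimise pos p) = head p"
  by (simp add: minimise_def)

lemma set_body_minimise: "set (body (minimise pos p)) \<subseteq> set (body p)"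
proof -
  have "set (fst (fold (\<lambda>f (kept, rem).
      if pos (CQ (head p) (fold Cons kept (tl rem))) then (kept, tl rem) else (f # kept, tl rem)) fs (kept, rem)))
    \<subseteq> set kept \<union> set fs" for fs kept rem
  proof (induction fs arbitrary: kept rem)
    case (Cons f fs)
    show ?case using Cons[of kept "tl rem"] Cons[of "f # kept" "tl rem"] by auto
  qed simp
  from this[of "body p" "[]" "body p"] show ?thesis by (simp add: minimise_def)
qed

lemma maps_to_minimise: "maps_to (minimise pos p) p"
  using set_body_minimise by (intro maps_to_subset) auto

lemma length_filter_map_le:
  assumes "\<And>x. P (f x) \<Longrightarrow> P x"
  shows "length (filter P (map f xs)) \<le> length (filter P xs)"
proof (induction xs)
  case (Cons x xs)
  then show ?case using assms[of x] by auto
qed simp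

text \<open>Pigeonhole: a list with more entries than \<open>G\<close> has an entry outside
  \<open>G\<close> or a repeated one, and such an entry can be deleted without uncovering
  \<open>G\<close>.\<close>

lemma ex_removable:
  assumes "card G < length xs" "G \<subseteq> set xs"
  shows "\<exists>A f B. xs = A @ f # B \<and> G \<subseteq> set (A @ B)"
proof (cases "distinct xs")
  case True
  then have "card G < card (set xs)"
    using assms(1) by (simp add: distinct_card)
  moreover have "finite G" using assms(2) finite_subset by blast
  ultimately have "\<not> set xs \<subseteq> G" using card_mono leD by blast
  then obtain f where f: "f \<in> set xs" "f \<notin> G" by blast
  obtain A B where "xs = A @ f # B" using split_list[OF f(1)] by blast
  then show ?thesis using f(2) assms(2) by (intro exI[of _ A] exI[of _ f] exI[of _ B]) auto
next
  case False
  then obtain A y B C where "xs = A @ [y] @ B @ [y] @ C" using not_distinct_decomp by blast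
  then show ?thesis using assms(2) by (intro exI[of _ A] exI[of _ y] exI[of _ "B @ [y] @ C"]) auto
qed

section \<open>Positivity with respect to a fixed target\<close>

locale target =
  fixes S :: schema and k :: nat and Q :: ucq
  assumes UCQ: "is_UCQ S k Q"
begin

text \<open>The answer of the membership oracle on \<open>enc_cq c\<close>, see
  \<open>MEMB_enc_cq\<close>. That the head is safe and has length \<open>k\<close> is carried over
  from a disjunct by the homomorphism.\<close>

definition pos :: "cq \<Rightarrow> bool" where
  "pos c \<longleftrightarrow> wf_cq S c \<and> (\<exists>q \<in> set Q. maps_to q c)"

lemma CQ: "q \<in> set Q \<Longrightarrow> is_CQ S k q"
  using UCQ by (auto simp: is_UCQ_def)

text \<open>A homomorphism carries each occurrence of a head variable in the body of
  \<open>q\<close> to an occurrence in \<open>c\<close>. Hence every positive instance can be output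
  as a query.\<close>

lemma pos_is_CQ:
  assumes "pos c" shows "is_CQ S k c"
proof -
  obtain q where q: "q \<in> set Q" "maps_to q c" and c: "wf_cq S c"
    using assms by (auto simp: pos_def)
  obtain g where g: "map g (head q) = head c" "\<forall>(R, zs) \<in> set (body q). (R, map g zs) \<in> set (body c)"
    using q unfolding maps_to_iff by blast
  have "\<exists>(R, zs) \<in> set (body c). x \<in> set zs" if x: "x \<in> set (head c)" for x
  proof -
    obtain z where z: "z \<in> set (head q)" "x = g z" using x unfolding g(1)[symmetric] by auto
    obtain R zs where "(R, zs) \<in> set (body q)" "z \<in> set zs"
      using CQ[OF q(1)] z(1) by (fastforce simp: is_CQ_def)
    then show ?thesis using g(2) z(2) by (intro bexI[of _ "(R, map g zs)"]) auto
  qed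
  moreover have "body c \<noteq> []"
    using g(2) CQ[OF q(1)] by (cases "body q") (auto simp: is_CQ_def)
  ultimately show ?thesis
    using CQ[OF q(1)] maps_to_length[OF q(2)] c by (auto simp: is_CQ_def wf_cq_def)
qed

lemma pos_mono:
  assumes "pos c" "wf_cq S d" "maps_to c d" shows "pos d"
  using assms maps_to_trans unfolding pos_def by blast

lemma pos_subset:
  assumes "pos (CQ xs Fs)" "wf_cq S (CQ xs Gs)" "set Fs \<subseteq> set Gs" shows "pos (CQ xs Gs)"
  using assms by (intro pos_mono[OF assms(1,2)] maps_to_subset) auto

lemma minimise_loop:
  assumes "pos (CQ xs (kept @ fs))"
    and "\<And>A f B. kept = A @ f # B \<Longrightarrow> \<not> pos (CQ xs (A @ B @ fs))"
    and "Fs = fst (fold (\<lambda>f (kept, rem). if pos (CQ xs (fold Cons kept (tl rem))) then (kept, tl rem)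
      else (f # kept, tl rem)) fs (kept, fs))"
  shows "pos (CQ xs Fs) \<and> (\<forall>A f B. Fs = A @ f # B \<longrightarrow> \<not> pos (CQ xs (A @ B)))"
  using assms
proof (induction fs arbitrary: kept)
  case (Cons f fs)
  have wf: "wf_cq S (CQ xs (kept @ f # fs))" using Cons.prems(1) by (simp add: pos_def)
  show ?case
  proof (cases "pos (CQ xs (fold Cons kept fs))")
    case True
    show ?thesis
    proof (rule Cons.IH[of kept])
      show "pos (CQ xs (kept @ fs))"
        by (rule pos_subset[OF True]) (auto simp: fold_Cons_rev intro: wf_cq_subset[OF wf])
      fix A h B assume k: "kept = A @ h # B"
      show "\<not> pos (CQ xs (A @ B @ fs))"
        using Cons.prems(2)[OF k] pos_subset[of xs "A @ B @ fs" "A @ B @ f # fs"]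
          wf_cq_subset[OF wf, of "CQ xs (A @ B @ f # fs)"] k
        by auto
    qed (use True Cons.prems(3) in simp)
  next
    case False
    show ?thesis
    proof (rule Cons.IH[of "f # kept"])
      show "pos (CQ xs ((f # kept) @ fs))"
        by (rule pos_subset[OF Cons.prems(1)]) (auto intro: wf_cq_subset[OF wf])
      fix A h B assume k: "f # kept = A @ h # B"
      show "\<not> pos (CQ xs (A @ B @ fs))"
      proof (cases A)
        case Nil
        then show ?thesis
          using False k pos_subset[of xs "kept @ fs" "fold Cons kept fs"] wf_cq_subset[OF wf, of "CQ xs (fold Cons kept fs)"]
          by (auto simp: fold_Cons_rev)
      next
        case A: (Cons _ A')
        then show ?thesis
          using Cons.prems(2)[of A' h B] k pos_subset[of xs "A @ B @ fs" "A' @ B @ f # fs"]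
            wf_cq_subset[OF wf, of "CQ xs (A' @ B @ f # fs)"]
          by auto
      qed
    qed (use False Cons.prems(3) in simp)
  qed
qed simp

lemma pos_minimise:
  assumes "pos p" shows "pos (minimise pos p)"
  using minimise_loop[of "head p" "[]" "body p"] assms by (simp add: minimise_def)

text \<open>The image of \<open>q\<close> has at most as many facts as \<open>q\<close>. In a longer
  list some entry could be deleted with \<open>q\<close> still mapping to the rest, against
  minimality.\<close>

lemma length_minimise:
  assumes "pos p" "q \<in> set Q" "maps_to q (minimise pos p)"
  shows "length (body (minimise pos p)) \<le> length (body q)"
proof (rule ccontr)
  let ?Fs = "body (minimise pos p)"
  assume long: "\<not> length ?Fs \<le> length (body q)"
  have min: "\<not> pos (CQ (head p) (A @ B))" if "?Fs = A @ f # B" for A f B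
    using minimise_loop[of "head p" "[]" "body p"] assms(1) that by (cases f) (simp add: minimise_def)
  obtain g where g: "map g (head q) = head p" "\<forall>(R, zs) \<in> set (body q). (R, map g zs) \<in> set ?Fs"
    using assms(3) unfolding maps_to_iff head_minimise by blast
  let ?G = "(\<lambda>(R, zs). (R, map g zs)) ` set (body q)"
  have "card ?G \<le> length (body q)"
    using card_image_le[of "set (body q)"] card_length[of "body q"] le_trans by blast
  then have "card ?G < length ?Fs" using long by linarith
  moreover have "?G \<subseteq> set ?Fs" using g(2) by (intro image_subsetI) (auto simp only: split: prod.splits)
  ultimately have "\<exists>A f B. ?Fs = A @ f # B \<and> ?G \<subseteq> set (A @ B)" by (rule ex_removable)
  then obtain A f B where AB: "?Fs = A @ f # B" "?G \<subseteq> set (A @ B)" by blast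
  have "wf_cq S (CQ (head p) (A @ B))"
  proof (rule wf_cq_subset)
    show "wf_cq S p" using assms(1) by (simp add: pos_def)
    show "set (body (CQ (head p) (A @ B))) \<subseteq> set (body p)"
      using set_body_minimise[of pos p] unfolding AB(1) by simp
  qed
  moreover have "(R, map g zs) \<in> set (A @ B)" if "(R, zs) \<in> set (body q)" for R zs
    by (rule subsetD[OF AB(2)], rule image_eqI[OF _ that]) simp
  then have "maps_to q (CQ (head p) (A @ B))"
    unfolding maps_to_iff using g(1) by (intro exI[of _ g]) auto
  ultimately have "pos (CQ (head p) (A @ B))" using assms(2) unfolding pos_def by blast
  then show False using min[OF AB(1)] by blast
qed

section \<open>A single update\<close>

definition refined :: "nat \<Rightarrow> cq \<Rightarrow> cq \<Rightarrow> bool" where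
  "refined L e h \<longleftrightarrow> acceptable L pos (minimise pos (prod_cq h e))"

text \<open>Writing the loop as a \<open>map\<close> retains the multiplicities of hypotheses, which
  are counted later on.\<close>

lemma update_eq:
  "update L pos e Hs = (if \<exists>h \<in> set Hs. refined L e h
     then rev (map (\<lambda>h. if refined L e h then minimise pos (prod_cq h e) else h) Hs)
     else if acceptable L pos (minimise pos e) then minimise pos e # Hs else Hs)"
proof -
  have "fold (refine L pos e) Hs (b, out) = (b \<or> (\<exists>h \<in> set Hs. refined L e h),
      rev (map (\<lambda>h. if refined L e h then minimise pos (prod_cq h e) else h) Hs) @ out)" for b out
    by (induction Hs arbitrary: b out) (auto simp: refine_def refined_def Let_def)
  then show ?thesis by (auto simp: update_def Let_def)
qed

lemma update_cases:
  assumes "h' \<in> set (update L pos e Hs)"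
  obtains "h' \<in> set Hs" | h where "h \<in> set Hs" "refined L e h" "h' = minimise pos (prod_cq h e)"
  | "h' = minimise pos e" "acceptable L pos h'" "\<And>h. h \<in> set Hs \<Longrightarrow> \<not> refined L e h"
  using assms unfolding update_eq by (auto split: if_splits)

lemma refined_maps_to:
  "refined L e h \<Longrightarrow> maps_to (minimise pos (prod_cq h e)) h"
  using maps_to_minimise maps_to_prod_fst maps_to_trans by blast

lemma length_update: "length (update L pos e Hs) \<le> Suc (length Hs)"
  by (auto simp: update_eq)

lemma update_nonempty: "Hs \<noteq> [] \<Longrightarrow> update L pos e Hs \<noteq> []"
  by (auto simp: update_eq)

lemma update_pos:
  assumes "\<And>h. h \<in> set Hs \<Longrightarrow> pos h" "h' \<in> set (update L pos e Hs)"
  shows "pos h'"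
  using assms(2) by (cases rule: update_cases) (use assms(1) in \<open>auto simp: refined_def acceptable_def\<close>)

lemma update_length_body:
  assumes "\<And>h. h \<in> set Hs \<Longrightarrow> length (body h) \<le> L + m" "h' \<in> set (update L pos e Hs)"
  shows "length (body h') \<le> L + m"
  using assms(2)
  by (cases rule: update_cases) (use assms(1) in \<open>auto simp: refined_def acceptable_def intro: trans_le_add1\<close>)

text \<open>The algorithm tests candidates only after minimising them. This is sound since the
  result maps to \<open>p\<close>, so that \<open>p\<close> was positive as well.\<close>

lemma length_body_minimise:
  assumes "pos (minimise pos p)" "wf_cq S p"
  shows "\<exists>q \<in> set Q. length (body (minimise pos p)) \<le> length (body q)"
proof -
  have "pos p" using pos_mono[OF assms maps_to_minimise] .
  then show ?thesis using assms(1) length_minimise[of p] by (auto simp: pos_def)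
qed

text \<open>In contrast to \<open>update_length_body\<close>, the bound refers to the target and not
  to the threshold; the counting of possible outputs depends on this.\<close>

lemma update_small:
  assumes "\<And>h. h \<in> set Hs \<Longrightarrow> pos h" "wf_cq S e"
    and "\<And>h. h \<in> set Hs \<Longrightarrow> h = start \<or> (\<exists>q \<in> set Q. length (body h) \<le> length (body q))"
    and "h' \<in> set (update L pos e Hs)"
  shows "h' = start \<or> (\<exists>q \<in> set Q. length (body h') \<le> length (body q))"
  using assms(4)
proof (cases rule: update_cases)
  case (2 h)
  have "wf_cq S (prod_cq h e)" using assms(1)[OF 2(1)] wf_cq_prod by (auto simp: pos_def)
  then show ?thesis using 2 length_body_minimise[of "prod_cq h e"] by (auto simp: refined_def acceptable_def)
next
  case 3
  then show ?thesis using length_body_minimise[of e] assms(2) by (auto simp: acceptable_def)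
qed (use assms(3) in blast)

section \<open>Updates whose threshold admits all disjuncts\<close>

context
  fixes L :: nat and e :: cq
  assumes L: "\<And>q. q \<in> set Q \<Longrightarrow> length (body q) \<le> L"
    and e: "wf_cq S e" "length (head e) = k"
begin

lemma acceptable_minimise:
  assumes "pos p" shows "acceptable L pos (minimise pos p)"
proof -
  have "pos (minimise pos p)" using assms by (rule pos_minimise)
  moreover from this have "\<exists>q \<in> set Q. length (body (minimise pos p)) \<le> length (body q)"
    using assms by (intro length_body_minimise) (auto simp: pos_def)
  ultimately show ?thesis using L le_trans unfolding acceptable_def by blast
qed

text \<open>A common disjunct maps to the product, which is then positive, and the threshold cannot
  reject its minimisation.\<close>

lemma refined_if_common:
  assumes "pos h" "q \<in> set Q" "maps_to q h" "maps_to q e"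
  shows "refined L e h"
  using assms wf_cq_prod[of S h e] maps_to_prod[of q h e]
  by (auto simp: refined_def pos_def intro!: acceptable_minimise)

lemma refined_maps_to_example:
  assumes "pos h" shows "maps_to (minimise pos (prod_cq h e)) e"
proof -
  have "maps_to (prod_cq h e) e"
    using assms e pos_is_CQ[OF assms] by (intro maps_to_prod_snd[of S]) (auto simp: pos_def is_CQ_def)
  then show ?thesis using maps_to_minimise maps_to_trans by blast
qed

text \<open>Hypotheses satisfying a common disjunct would have been merged.\<close>

lemma update_disjoint:
  assumes pos: "\<And>h. h \<in> set Hs \<Longrightarrow> pos h" and q: "q \<in> set Q"
    and "length (filter (maps_to q) Hs) \<le> 1"
  shows "length (filter (maps_to q) (update L pos e Hs)) \<le> 1"
proof (cases "\<exists>h \<in> set Hs. refined L e h")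
  case True
  let ?r = "\<lambda>h. if refined L e h then minimise pos (prod_cq h e) else h"
  \<comment> \<open>A refined hypothesis maps to the old one, so by composition every disjunct that
    maps to the refined one already mapped to the old one.\<close>
  have r: "maps_to q (?r h) \<Longrightarrow> maps_to q h" for h
    using refined_maps_to maps_to_trans by (cases "refined L e h") auto
  have "update L pos e Hs = rev (map ?r Hs)"
    unfolding update_eq using True by (rule if_P)
  then have "length (filter (maps_to q) (update L pos e Hs)) = length (filter (maps_to q) (map ?r Hs))"
    by (simp only: rev_filter[symmetric] length_rev)
  also have "\<dots> \<le> length (filter (maps_to q) Hs)"
    by (rule length_filter_map_le[OF r])
  finally show ?thesis using assms(3) by linarith
next
  case False
  show ?thesis
  proof (cases "maps_to q (minimise pos e)")
    case True
    then have "maps_to q e" using maps_to_minimise maps_to_trans by blast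
    \<comment> \<open>A hypothesis sharing \<open>q\<close> with \<open>e\<close> would have been
      refined, so the new entry is the only one to which \<open>q\<close> maps.\<close>
    then have "filter (maps_to q) Hs = []"
      using False refined_if_common[OF pos q] by (auto simp: filter_empty_conv)
    then show ?thesis using False by (auto simp: update_eq)
  qed (use False assms(3) in \<open>auto simp: update_eq\<close>)
qed

text \<open>Refinement only generalises: the refined hypothesis maps to the old one, and
  homomorphisms compose.\<close>

lemma update_keeps_covered:
  assumes "h \<in> set Hs" "maps_to h d"
  shows "\<exists>h' \<in> set (update L pos e Hs). maps_to h' d"
proof (cases "refined L e h")
  case True
  then have "minimise pos (prod_cq h e) \<in> set (update L pos e Hs)"
    using assms(1) by (auto simp: update_eq)
  moreover have "maps_to (minimise pos (prod_cq h e)) d"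
    using refined_maps_to[OF True] assms(2) maps_to_trans by blast
  ultimately show ?thesis by blast
next
  case False
  then have "h \<in> set (update L pos e Hs)"
    using assms(1) by (auto simp: update_eq)
  then show ?thesis using assms(2) by blast
qed

lemma update_covers:
  assumes "\<And>h. h \<in> set Hs \<Longrightarrow> pos h" "pos e"
  shows "\<exists>h' \<in> set (update L pos e Hs). maps_to h' e"
proof (cases "\<exists>h \<in> set Hs. refined L e h")
  case True
  then obtain h where h: "h \<in> set Hs" "refined L e h" by blast
  then have "minimise pos (prod_cq h e) \<in> set (update L pos e Hs)"
    by (auto simp: update_eq)
  then show ?thesis using refined_maps_to_example[OF assms(1)[OF h(1)]] by blast
next
  case False
  then have "minimise pos e \<in> set (update L pos e Hs)"
    using acceptable_minimise[OF assms(2)] by (auto simp: update_eq)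
  then show ?thesis using maps_to_minimise by blast
qed

end

end

section \<open>Invariants of the learner\<close>

lemma learn_Nil [simp]: "learn L pos start [] = [start]"
  by (simp add: learn_def)

lemma learn_snoc [simp]: "learn L pos start (es @ [e]) = update L pos e (learn L pos start es)"
  by (simp add: learn_def)

text \<open>Double counting: each entry of \<open>xs\<close> contributes at least once to the
  sum.\<close>

lemma length_le_sum_filter:
  assumes "\<forall>x \<in> set xs. \<exists>y \<in> set ys. P y x"
  shows "length xs \<le> (\<Sum>y\<leftarrow>ys. length (filter (P y) xs))"
  using assms
proof (induction xs)
  case (Cons x xs)
  obtain y where y: "y \<in> set ys" "P y x" using Cons.prems by auto
  have "(1::nat) \<le> (\<Sum>y\<leftarrow>ys. if P y x then 1 else 0)"
    using y member_le_sum_list[of "1::nat" "map (\<lambda>y. if P y x then 1 else 0) ys"] by force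
  then have "length (x # xs) \<le> (\<Sum>y\<leftarrow>ys. if P y x then 1 else 0) + (\<Sum>y\<leftarrow>ys. length (filter (P y) xs))"
    using Cons by simp
  also have "\<dots> = (\<Sum>y\<leftarrow>ys. (if P y x then 1 else 0) + length (filter (P y) xs))"
    by (rule sum_list_addf[symmetric])
  also have "\<dots> = (\<Sum>y\<leftarrow>ys. length (filter (P y) (x # xs)))"
    by (rule arg_cong[where f = sum_list]) simp
  finally show ?case .
qed simp

section \<open>Growth of names under iterated products\<close>

definition names :: "cq \<Rightarrow> name set" where
  "names c = set (head c) \<union> (\<Union>F \<in> set (body c). set (snd F))"

lemma names_minimise: "names (minimise pos p) \<subseteq> names p"
  using set_body_minimise[of pos p] by (auto simp: names_def)

lemma names_size:
  assumes "n \<in> names c" shows "size (enc_name n) \<le> size (enc_cq c)"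
proof (cases "n \<in> set (head c)")
  case True
  from size_enc_list_member[OF this, of enc_name] show ?thesis by (simp add: enc_cq_def)
next
  case False
  then obtain F where F: "F \<in> set (body c)" "n \<in> set (snd F)" using assms by (auto simp: names_def)
  from size_enc_list_member[OF F(1), of enc_atom] size_enc_list_member[OF F(2), of enc_name]
  show ?thesis by (simp add: enc_cq_def enc_atom_def split_beta)
qed

lemma size_prod_tuple_member:
  assumes "\<And>a. a \<in> set as \<Longrightarrow> size (enc_name a) \<le> A" "\<And>b. b \<in> set bs \<Longrightarrow> size (enc_name b) \<le> B"
    "n \<in> set (prod_tuple as bs)"
  shows "size (enc_name n) \<le> A + 4 * B + 1"
  using assms
proof (induction "as" arbitrary: bs)
  case (Cons a "as")
  let ?b = "case bs of [] \<Rightarrow> [] | b # _ \<Rightarrow> b"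
  have "size (enc_name ?b) \<le> B"
    using Cons.prems(2) by (cases bs) (auto simp: enc_name_def)
  moreover have "size (enc_name a) \<le> A" using Cons.prems(1) by simp
  ultimately have "size (enc_name (prod_name a ?b)) \<le> A + 4 * B + 1"
    using size_prod_name[of a ?b] by linarith
  moreover have "size (enc_name n) \<le> A + 4 * B + 1" if "n \<in> set (prod_tuple as (tl bs))"
  proof (rule Cons.IH[OF _ _ that])
    show "size (enc_name a) \<le> A" if "a \<in> set as" for a using Cons.prems(1) that by simp
    show "size (enc_name b) \<le> B" if "b \<in> set (tl bs)" for b using Cons.prems(2) that by (cases bs) auto
  qed
  ultimately show ?case using Cons.prems(3) by auto
qed simp

lemma size_names_prod:
  assumes "\<And>a. a \<in> names c \<Longrightarrow> size (enc_name a) \<le> A" "\<And>b. b \<in> names d \<Longrightarrow> size (enc_name b) \<le> B"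
    "n \<in> names (prod_cq c d)"
  shows "size (enc_name n) \<le> A + 4 * B + 1"
proof -
  obtain ts us where "n \<in> set (prod_tuple ts us)" "set ts \<subseteq> names c" "set us \<subseteq> names d"
    using assms(3) by (fastforce simp: names_def prod_cq_def set_prod_facts)
  then show ?thesis
    using assms(1,2) by (intro size_prod_tuple_member[of ts A us B]) auto
qed

text \<open>Each summand is the increase that \<open>size_names_prod\<close> allows for one product
  with example \<open>e\<close> as right factor.\<close>

definition growth :: "cq list \<Rightarrow> nat" where
  "growth es = (\<Sum>e\<leftarrow>es. 4 * size (enc_cq e) + 1)"

context target
begin

context
  fixes start :: cq
  assumes start: "pos start"
begin

lemma learn_nonempty: "learn L pos start es \<noteq> []"
  by (induction es rule: rev_induct) (auto simp: update_nonempty)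

lemma learn_pos: "h \<in> set (learn L pos start es) \<Longrightarrow> pos h"
proof (induction es arbitrary: h rule: rev_induct)
  case (snoc e es)
  show ?case by (rule update_pos[OF snoc.IH]) (use snoc.prems in simp_all)
qed (use start in simp)

lemma length_learn: "length (learn L pos start es) \<le> Suc (length es)"
proof (induction es rule: rev_induct)
  case (snoc e es)
  then show ?case using length_update[of L e "learn L pos start es"] by simp
qed simp

lemma learn_length_body:
  "h \<in> set (learn L pos start es) \<Longrightarrow> length (body h) \<le> L + length (body start)"
proof (induction es arbitrary: h rule: rev_induct)
  case (snoc e es)
  show ?case by (rule update_length_body[OF snoc.IH]) (use snoc.prems in simp_all)
qed simp

lemma learn_small:
  assumes "\<forall>e \<in> set es. wf_cq S e" "h \<in> set (learn L pos start es)"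
  shows "h = start \<or> (\<exists>q \<in> set Q. length (body h) \<le> length (body q))"
  using assms
proof (induction es arbitrary: h rule: rev_induct)
  case (snoc e es)
  show ?case
    by (rule update_small[OF learn_pos _ snoc.IH]) (use snoc.prems in simp_all)
qed simp

text \<open>As the hypothesis enters a product with coefficient 1, each update adds only a term in
  the current example. Names hence stay linear in the sample at any nesting depth; the initial
  hypothesis starts from the empty name, of size 0.\<close>

lemma learn_names:
  assumes "names start \<subseteq> {[]}" "h \<in> set (learn L pos start es)" "n \<in> names h"
  shows "size (enc_name n) \<le> growth es"
  using assms(2,3)
proof (induction es arbitrary: h n rule: rev_induct)
  case Nil
  then show ?case using assms(1) by (auto simp: enc_name_def)
next
  case (snoc e es)
  have g: "growth (es @ [e]) = growth es + (4 * size (enc_cq e) + 1)" by (simp add: growth_def)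
  have "h \<in> set (update L pos e (learn L pos start es))" using snoc.prems by simp
  then show ?case
  proof (cases rule: update_cases)
    case 1
    from snoc.IH[OF this snoc.prems(2)] show ?thesis unfolding g by linarith
  next
    case (2 h0)
    then have n: "n \<in> names (prod_cq h0 e)" using snoc.prems(2) names_minimise by blast
    have "size (enc_name n) \<le> growth es + 4 * size (enc_cq e) + 1"
    proof (rule size_names_prod)
      show "n \<in> names (prod_cq h0 e)" by (rule n)
    qed (use snoc.IH[OF 2(1)] names_size in simp_all)
    then show ?thesis unfolding g by linarith
  next
    case 3
    then have "n \<in> names e" using snoc.prems(2) names_minimise by blast
    then show ?thesis using names_size[of n e] unfolding g by linarith
  qed
qed

context
  fixes L :: nat
  assumes L: "\<And>q. q \<in> set Q \<Longrightarrow> length (body q) \<le> L"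
begin

lemma learn_disjoint:
  assumes "\<forall>e \<in> set es. wf_cq S e \<and> length (head e) = k" "q \<in> set Q"
  shows "length (filter (maps_to q) (learn L pos start es)) \<le> 1"
  using assms(1)
proof (induction es rule: rev_induct)
  case (snoc e es)
  show ?case
    unfolding learn_snoc
    by (rule update_disjoint[OF L _ _ learn_pos assms(2) snoc.IH]) (use snoc.prems in simp_all)
qed simp

text \<open>Pairs of a disjunct and a hypothesis to which it maps are counted twice: every
  hypothesis occurs in some pair, every disjunct in at most one.\<close>

lemma length_learn_le:
  assumes "\<forall>e \<in> set es. wf_cq S e \<and> length (head e) = k"
  shows "length (learn L pos start es) \<le> length Q"
proof -
  have "length (learn L pos start es) \<le> (\<Sum>q\<leftarrow>Q. length (filter (maps_to q) (learn L pos start es)))"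
    using learn_pos by (intro length_le_sum_filter) (auto simp: pos_def)
  also have "\<dots> \<le> (\<Sum>q\<leftarrow>Q. 1)"
    using learn_disjoint[OF assms] by (intro sum_list_mono) simp
  finally show ?thesis by (simp add: sum_list_triv)
qed

lemma learn_covers:
  assumes "\<forall>e \<in> set es. wf_cq S e \<and> length (head e) = k" "d \<in> set es" "pos d"
  shows "\<exists>h \<in> set (learn L pos start es). maps_to h d"
  using assms(1,2)
proof (induction es rule: rev_induct)
  case (snoc e es)
  show ?case
  proof (cases "d = e")
    case True
    show ?thesis
      unfolding learn_snoc True
      by (rule update_covers[OF L _ _ learn_pos]) (use snoc.prems assms(3) True in simp_all)
  next
    case False
    then obtain h where h: "h \<in> set (learn L pos start es)" "maps_to h d"
      using snoc by auto
    show ?thesis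
      unfolding learn_snoc
      by (rule update_keeps_covered[OF L _ _ h]) (use snoc.prems in simp_all)
  qed
qed simp

text \<open>Covered examples remain covered under later updates; conversely, everything a positive
  hypothesis maps to is positive.\<close>

lemma learn_consistent:
  assumes "\<forall>e \<in> set es. wf_cq S e \<and> length (head e) = k" "d \<in> set es"
  shows "(\<exists>h \<in> set (learn L pos start es). maps_to h d) \<longleftrightarrow> pos d"
  using learn_covers[OF assms] learn_pos pos_mono assms by blast

end

end

end


section \<open>The learner as a program\<close>

text \<open>
  The one-point instance with all facts is positive for every CQ. As a query it is contained in
  every CQ, and it takes the place of \<open>False\<close>, which is not a UCQ, as initial hypothesis.
\<close>

definition top_cq :: "schema \<Rightarrow> nat \<Rightarrow> cq" where
  "top_cq S k = CQ (replicate k [])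
     (map (\<lambda>R. (R, replicate (the (S R)) [])) (SOME Rs. set Rs = dom S \<and> distinct Rs))"

lemma body_top_cq:
  assumes "finite (dom S)"
  shows "set (body (top_cq S k)) = (\<lambda>R. (R, replicate (the (S R)) [])) ` dom S"
    and "length (body (top_cq S k)) = card (dom S)"
proof -
  have "\<exists>Rs. set Rs = dom S \<and> distinct Rs" using finite_distinct_list[OF assms] .
  from someI_ex[OF this]
  show "set (body (top_cq S k)) = (\<lambda>R. (R, replicate (the (S R)) [])) ` dom S"
    "length (body (top_cq S k)) = card (dom S)"
    by (auto simp: top_cq_def distinct_card[symmetric])
qed

lemma names_top_cq: "names (top_cq S k) \<subseteq> {[]}"
  by (auto simp: names_def top_cq_def)

lemma (in target) pos_top_cq:
  assumes "finite (dom S)" shows "pos (top_cq S k)"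
proof -
  obtain q where q: "q \<in> set Q" using UCQ by (cases Q) (auto simp: is_UCQ_def)
  have "maps_to q (top_cq S k)"
    unfolding maps_to_iff body_top_cq(1)[OF assms] using CQ[OF q]
    by (intro exI[of _ "\<lambda>_. []"])
      (fastforce simp: is_CQ_def top_cq_def map_replicate_const over_schema_def)
  moreover have "wf_cq S (top_cq S k)"
    by (auto simp: wf_cq_def body_top_cq(1)[OF assms] over_schema_def)
  ultimately show ?thesis using q unfolding pos_def by blast
qed

section \<open>Examples as encoded queries, and the membership oracle\<close>

lemma rep_pointed_instance_iff:
  "rep_pointed_instance d (I, as) \<longleftrightarrow> (\<exists>c. d = enc_cq c \<and> I = set (body c) \<and> as = head c)"
  unfolding rep_pointed_instance_def enc_cq_def
  by (auto intro: exI[of _ "CQ as _"])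

lemma query_examples_iff:
  "(set (body c), head c) \<in> query_examples S k \<longleftrightarrow>
   wf_cq S c \<and> length (head c) = k \<and> set (head c) \<subseteq> adom (set (body c))"
  by (auto simp: query_examples_def wf_cq_def is_instance_def)

lemma is_CQ_query_example: "is_CQ S k c \<Longrightarrow> (set (body c), head c) \<in> query_examples S k"
  unfolding query_examples_iff by (force simp: is_CQ_def wf_cq_def adom_def)

lemma (in target) sat_UCQ_iff:
  "wf_cq S c \<Longrightarrow> head c \<in> ucq_answers Q (set (body c)) \<longleftrightarrow> pos c"
  by (auto simp: ucq_answers_def pos_def maps_to_def)

text \<open>The program also asks about trees that represent no example. The oracle rejects these,
  and \<open>pos\<close> agrees, because a positive \<open>c\<close> is a CQ and so an
  example.\<close>

lemma (in target) MEMB_enc_cq: "MEMB (UCQ_class S k) Q (enc_cq c) \<longleftrightarrow> pos c"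
proof
  assume "MEMB (UCQ_class S k) Q (enc_cq c)"
  then obtain I as where e: "(I, as) \<in> query_examples S k" "rep_pointed_instance (enc_cq c) (I, as)"
    "as \<in> ucq_answers Q I"
    by (auto simp: MEMB_def UCQ_class_def lab_def)
  then have "I = set (body c)" "as = head c"
    by (auto simp: rep_pointed_instance_iff inj_eq[OF inj_enc_cq])
  then show "pos c" using e sat_UCQ_iff query_examples_iff by blast
next
  assume c: "pos c"
  then have "(set (body c), head c) \<in> query_examples S k"
    using pos_is_CQ is_CQ_query_example by blast
  then show "MEMB (UCQ_class S k) Q (enc_cq c)"
    using c sat_UCQ_iff[of c] unfolding MEMB_def UCQ_class_def lab_def
    by (intro bexI[of _ "(set (body c), head c)"]) (auto simp: rep_pointed_instance_iff pos_def)
qed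

lemma is_UCQ_singleton [simp]: "is_UCQ S k [q] \<longleftrightarrow> is_CQ S k q"
  by (simp add: is_UCQ_def)

text \<open>The threshold is the sample length: the program can read it off its input, and the
  sample size will make it at least the size of the target.\<close>

definition learned :: "schema \<Rightarrow> nat \<Rightarrow> ucq \<Rightarrow> cq list \<Rightarrow> ucq" where
  "learned S k Q es = learn (length es) (\<lambda>c. MEMB (UCQ_class S k) Q (enc_cq c)) (top_cq S k) es"

lemma (in target) learned_eq: "learned S k Q es = learn (length es) pos (top_cq S k) es"
  by (simp add: learned_def MEMB_enc_cq)

lemma size_enc_list_le:
  "(\<And>x. x \<in> set xs \<Longrightarrow> size (e x) \<le> m) \<Longrightarrow> size (enc_list e xs) \<le> length xs * (m + 1)"
  by (induction xs) (force simp: algebra_simps)+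

text \<open>The fixed schema contributes the constants \<open>a\<close>, for the names of symbols,
  and \<open>w\<close>, for their arities; the number of facts and the size of names remain as
  variables.\<close>

lemma size_wf_cq:
  assumes "finite (dom S)"
  obtains a w where "\<And>c B \<mu>. wf_cq S c \<Longrightarrow> length (body c) \<le> B \<Longrightarrow>
    (\<And>n. n \<in> names c \<Longrightarrow> size (enc_name n) \<le> \<mu>) \<Longrightarrow>
    size (enc_cq c) \<le> 1 + B * (a + w * (\<mu> + 1) + 2) + length (head c) * (\<mu> + 1)"
proof -
  define a where "a = Max ((\<lambda>R. size (enc_name R)) ` dom S)"
  define w where "w = Max ((\<lambda>R. the (S R)) ` dom S)"
  have aw: "size (enc_name R) \<le> a" "the (S R) \<le> w" if "R \<in> dom S" for R
    using assms that unfolding a_def w_def by (auto intro: Max_ge)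
  have "size (enc_cq c) \<le> 1 + B * (a + w * (\<mu> + 1) + 2) + length (head c) * (\<mu> + 1)"
    if c: "wf_cq S c" "length (body c) \<le> B" "\<And>n. n \<in> names c \<Longrightarrow> size (enc_name n) \<le> \<mu>" for c B \<mu>
  proof -
    have "size (enc_atom F) \<le> a + w * (\<mu> + 1) + 1" if F: "F \<in> set (body c)" for F
    proof -
      obtain R ts where [simp]: "F = (R, ts)" by (cases F)
      have "S R = Some (length ts)" using wf_cq_arity[OF c(1)] F by simp
      then have R: "R \<in> dom S" "length ts \<le> w" using aw(2)[of R] by auto
      have "size (enc_list enc_name ts) \<le> length ts * (\<mu> + 1)"
        using F c(3) by (intro size_enc_list_le) (force simp: names_def)
      also have "\<dots> \<le> w * (\<mu> + 1)" using R(2) by (rule mult_le_mono1)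
      finally show ?thesis using aw(1)[OF R(1)] by (simp add: enc_atom_Pair)
    qed
    then have "size (enc_list enc_atom (body c)) \<le> length (body c) * (a + w * (\<mu> + 1) + 1 + 1)"
      by (rule size_enc_list_le)
    also have "\<dots> \<le> B * (a + w * (\<mu> + 1) + 1 + 1)" using c(2) by (rule mult_le_mono1)
    finally have "size (enc_list enc_atom (body c)) \<le> B * (a + w * (\<mu> + 1) + 2)" by simp
    moreover have "size (enc_list enc_name (head c)) \<le> length (head c) * (\<mu> + 1)"
      using c(3) by (intro size_enc_list_le) (simp add: names_def)
    ultimately show ?thesis by (simp add: enc_cq_def)
  qed
  then show ?thesis using that by blast
qed

abbreviation enc_labelled :: "cq \<times> bool \<Rightarrow> data" where
  "enc_labelled \<equiv> \<lambda>(c, l). Node (enc_cq c) (enc_bool l)"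

lemma growth_le: "growth (map fst (take i ds)) \<le> 5 * size (enc_list enc_labelled ds)"
proof -
  have "growth (map fst ds) \<le> 5 * size (enc_list enc_labelled ds)" for ds
    by (induction ds) (auto simp: growth_def)
  from this[of "take i ds"] show ?thesis
    using size_enc_list_take[of enc_labelled i ds] by linarith
qed

text \<open>Targets and samples together form the parameters, and the budget is the sample size
  alone. One exponent therefore serves all targets, however large.\<close>

theorem learner_time:
  assumes S: "finite (dom S)"
  obtains c where "\<And>Q ds. is_UCQ S k Q \<Longrightarrow> \<forall>(c, l) \<in> set ds. wf_cq S c \<and> length (head c) = k \<Longrightarrow>
    computes (MEMB (UCQ_class S k) Q) [enc_list enc_labelled ds] (LearnP (top_cq S k))
      (enc_list enc_cq (learned S k Q (map fst ds))) ((size (enc_list enc_labelled ds) + 2) ^ c)"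
proof -
  define \<Gamma> :: "(ucq \<times> (cq \<times> bool) list) ctx" where
    "\<Gamma> = ({(Q, ds). is_UCQ S k Q \<and> (\<forall>(c, l) \<in> set ds. wf_cq S c \<and> length (head c) = k)},
      \<lambda>x. size (enc_list enc_labelled (snd x)), \<lambda>x. MEMB (UCQ_class S k) (fst x))"
  let ?env = "\<lambda>x. [enc_list enc_labelled (snd x)]"
  let ?\<mu> = "\<lambda>x. 5 * budget \<Gamma> x"
  let ?pos = "\<lambda>x c. oracle_of \<Gamma> x (enc_cq c)"
  obtain a w where aw: "\<And>c B \<mu>. wf_cq S c \<Longrightarrow> length (body c) \<le> B \<Longrightarrow>
    (\<And>n. n \<in> names c \<Longrightarrow> size (enc_name n) \<le> \<mu>) \<Longrightarrow>
    size (enc_cq c) \<le> 1 + B * (a + w * (\<mu> + 1) + 2) + length (head c) * (\<mu> + 1)"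
    using size_wf_cq[OF S] by blast
  \<comment> \<open>The bound of \<open>size_wf_cq\<close> for as many facts as
    \<open>learn_length_body\<close> permits and for names as in \<open>learn_names\<close>; the
    factor 5 is that of \<open>growth_le\<close>.\<close>
  let ?h = "\<lambda>x. 1 + (budget \<Gamma> x + card (dom S)) * (a + w * (?\<mu> x + 1) + 2) + k * (?\<mu> x + 1)"
  have "ptime \<Gamma> ?env (LearnP (top_cq S k))
    (\<lambda>x. enc_list enc_cq (learn (length (snd x)) (?pos x) (top_cq S k) (map fst (snd x))))"
  proof (rule ptime_LearnP)
    show "\<exists>K. pbounded \<Gamma> K \<and> (\<forall>x\<in>pts \<Gamma>. \<forall>i\<le>length (snd x). size (enc_list enc_cq
      (learn (length (snd x)) (?pos x) (top_cq S k) (map fst (take i (snd x))))) \<le> K x)"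
    proof (intro exI conjI ballI allI impI)
      show "pbounded \<Gamma> (\<lambda>x. (budget \<Gamma> x + 1) * (?h x + 1))"
        by (intro pbounded_intros)
      fix x i assume x: "x \<in> pts \<Gamma>" and i: "i \<le> length (snd x)"
      interpret target S k "fst x" using x by unfold_locales (auto simp: \<Gamma>_def)
      have pos: "?pos x = pos" by (simp add: fun_eq_iff \<Gamma>_def MEMB_enc_cq)
      have b: "length (snd x) \<le> budget \<Gamma> x"
        using length_le_size_enc_list[of "snd x" enc_labelled] by (simp add: \<Gamma>_def)
      let ?es = "map fst (take i (snd x))"
      let ?Hs = "learn (length (snd x)) pos (top_cq S k) ?es"
      note start = pos_top_cq[OF S]
      have "size (enc_cq h) \<le> ?h x" if h: "h \<in> set ?Hs" for h
      proof -
        have hk: "wf_cq S h" "length (head h) = k"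
          using learn_pos[OF start h] pos_is_CQ[OF learn_pos[OF start h]] by (auto simp: pos_def is_CQ_def)
        have B: "length (body h) \<le> budget \<Gamma> x + card (dom S)"
          using learn_length_body[OF start h] b body_top_cq(2)[OF S, of k] by linarith
        have m: "size (enc_name n) \<le> ?\<mu> x" if "n \<in> names h" for n
          using learn_names[OF start names_top_cq h that] growth_le[of i "snd x"] by (simp add: \<Gamma>_def)
        show ?thesis using aw[OF hk(1) B m] unfolding hk(2) by blast
      qed
      then have "size (enc_list enc_cq ?Hs) \<le> length ?Hs * (?h x + 1)"
        by (rule size_enc_list_le)
      also have "\<dots> \<le> (budget \<Gamma> x + 1) * (?h x + 1)"
        using length_learn[OF start, of "length (snd x)" ?es] b i by (intro mult_le_mono1) simp
      finally show "size (enc_list enc_cq (learn (length (snd x)) (?pos x) (top_cq S k) ?es)) \<le>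
          (budget \<Gamma> x + 1) * (?h x + 1)"
        unfolding pos .
    qed
  qed simp
  moreover have "env_bounded \<Gamma> ?env"
    unfolding env_bounded_def by (rule pbounded_mono[OF pbounded_budget]) (simp add: \<Gamma>_def)
  ultimately have "\<exists>t. pbounded \<Gamma> t \<and> (\<forall>x \<in> pts \<Gamma>. computes (oracle_of \<Gamma> x) (?env x) (LearnP (top_cq S k))
    (enc_list enc_cq (learn (length (snd x)) (?pos x) (top_cq S k) (map fst (snd x)))) (t x))"
    by (rule ptimeD)
  then obtain t where t: "pbounded \<Gamma> t" "\<forall>x \<in> pts \<Gamma>. computes (oracle_of \<Gamma> x) (?env x) (LearnP (top_cq S k))
    (enc_list enc_cq (learn (length (snd x)) (?pos x) (top_cq S k) (map fst (snd x)))) (t x)"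
    by (elim exE conjE)
  obtain c where c: "\<forall>x \<in> pts \<Gamma>. t x \<le> (budget \<Gamma> x + 2) ^ c"
    using t(1) unfolding pbounded_def by blast
  show ?thesis
  proof (rule that)
    fix Q and ds :: "(cq \<times> bool) list"
    assume "is_UCQ S k Q" "\<forall>(c, l) \<in> set ds. wf_cq S c \<and> length (head c) = k"
    then have x: "(Q, ds) \<in> pts \<Gamma>" by (simp add: \<Gamma>_def)
    from computes_mono[OF bspec[OF t(2) x] bspec[OF c x]]
    show "computes (MEMB (UCQ_class S k) Q) [enc_list enc_labelled ds] (LearnP (top_cq S k))
      (enc_list enc_cq (learned S k Q (map fst ds))) ((size (enc_list enc_labelled ds) + 2) ^ c)"
      by (simp add: \<Gamma>_def learned_def)
  qed
qed

section \<open>Counting queries up to equivalence\<close>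

lemma cq_answers_rename:
  assumes "inj_on \<rho> (names q)"
  shows "cq_answers (CQ (map \<rho> (head q)) (map (\<lambda>(R, zs). (R, map \<rho> zs)) (body q))) = cq_answers q"
proof (rule ext, rule set_eqI)
  fix I as
  let ?q = "CQ (map \<rho> (head q)) (map (\<lambda>(R, zs). (R, map \<rho> zs)) (body q))"
  show "as \<in> cq_answers ?q I \<longleftrightarrow> as \<in> cq_answers q I"
  proof
    assume "as \<in> cq_answers ?q I"
    then obtain g where g: "map g (head ?q) = as" "\<forall>(R, zs) \<in> set (body ?q). (R, map g zs) \<in> I"
      by (auto simp: cq_answers_def)
    have "map (g \<circ> \<rho>) (head q) = as" using g(1) by simp
    moreover have "(R, map (g \<circ> \<rho>) zs) \<in> I" if "(R, zs) \<in> set (body q)" for R zs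
    proof -
      have "(R, map \<rho> zs) \<in> set (body ?q)" using that by force
      then show ?thesis using g(2) by fastforce
    qed
    ultimately show "as \<in> cq_answers q I" unfolding cq_answers_def by blast
  next
    assume "as \<in> cq_answers q I"
    then obtain g where g: "map g (head q) = as" "\<forall>(R, zs) \<in> set (body q). (R, map g zs) \<in> I"
      unfolding cq_answers_def by blast
    let ?g = "g \<circ> inv_into (names q) \<rho>"
    have inv: "map ?g (map \<rho> zs) = map g zs" if "set zs \<subseteq> names q" for zs
      using that inv_into_f_f[OF assms] by auto
    have "map ?g (head ?q) = as" using g(1) inv[of "head q"] by (simp add: names_def)
    moreover have "\<forall>(R, zs) \<in> set (body ?q). (R, map ?g zs) \<in> I"
    proof (intro ballI, clarify)
      fix R zs assume "(R, zs) \<in> set (body ?q)"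
      then obtain ys where ys: "(R, ys) \<in> set (body q)" "zs = map \<rho> ys" by auto
      have "set ys \<subseteq> names q" using ys(1) by (force simp: names_def)
      moreover have "(R, map g ys) \<in> I" using g(2) ys(1) by auto
      ultimately show "(R, map ?g zs) \<in> I" by (simp only: ys(2) inv)
    qed
    ultimately show "as \<in> cq_answers ?q I" unfolding cq_answers_def by blast
  qed
qed

lemma cq_answers_cong:
  "head p = head q \<Longrightarrow> set (body p) = set (body q) \<Longrightarrow> cq_answers p = cq_answers q"
  by (simp add: cq_answers_def fun_eq_iff)

text \<open>Repeating an entry leaves the set unchanged, so bodies and disjunctions may be assumed
  to have an exact length, for which lists are easily counted.\<close>

definition pad :: "nat \<Rightarrow> 'a list \<Rightarrow> 'a list" where
  "pad n xs = xs @ replicate (n - length xs) (hd xs)"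

lemma length_pad: "length xs \<le> n \<Longrightarrow> length (pad n xs) = n"
  by (simp add: pad_def)

lemma set_pad: "xs \<noteq> [] \<Longrightarrow> set (pad n xs) = set xs"
  by (auto simp: pad_def set_replicate_conv_if)

lemma finite_names [simp]: "finite (names c)"
  by (simp add: names_def)

lemma card_names:
  assumes "is_CQ S k q" "\<And>R. R \<in> dom S \<Longrightarrow> the (S R) \<le> w"
  shows "card (names q) \<le> length (body q) * w"
proof -
  have "names q \<subseteq> (\<Union>F \<in> set (body q). set (snd F))"
  proof -
    have "x \<in> (\<Union>F \<in> set (body q). set (snd F))" if "x \<in> set (head q)" for x
    proof -
      have "\<exists>F \<in> set (body q). x \<in> set (snd F)"
        using assms(1) that unfolding is_CQ_def split_beta by blast
      then show ?thesis by blast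
    qed
    then show ?thesis unfolding names_def by blast
  qed
  then have "card (names q) \<le> card (\<Union>F \<in> set (body q). set (snd F))"
    by (intro card_mono) auto
  also have "\<dots> \<le> (\<Sum>F \<in> set (body q). card (set (snd F)))"
    by (rule card_UN_le) simp
  also have "\<dots> \<le> (\<Sum>F \<in> set (body q). w)"
  proof (rule sum_mono)
    fix F assume "F \<in> set (body q)"
    then have "S (fst F) = Some (length (snd F))"
      using assms(1) unfolding is_CQ_def over_schema_def split_beta by blast
    then have "length (snd F) \<le> w" using assms(2)[of "fst F"] by auto
    then show "card (set (snd F)) \<le> w" using card_length le_trans by blast
  qed
  also have "\<dots> = card (set (body q)) * w" by simp
  also have "\<dots> \<le> length (body q) * w"
    by (intro mult_le_mono1 card_length)
  finally show ?thesis .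
qed

definition small_UCQs :: "schema \<Rightarrow> nat \<Rightarrow> nat \<Rightarrow> nat \<Rightarrow> ucq set" where
  "small_UCQs S k n a = {Q. is_UCQ S k Q \<and> length Q \<le> n \<and> (\<forall>q \<in> set Q. length (body q) \<le> a)}"

text \<open>Answer functions are counted because variables have arbitrary names. A CQ with at most
  \<open>a\<close> atoms has at most \<open>a * w\<close> variables; these are renamed into
  \<open>V\<close>, and padding makes all lengths exact. The \<open>+ 1\<close> in \<open>m\<close>
  keeps the base positive, so that powers increase with the exponent.\<close>

lemma card_small_UCQs:
  fixes a w :: nat
  assumes S: "finite (dom S)" and w: "\<And>R. R \<in> dom S \<Longrightarrow> the (S R) \<le> w"
  defines "m \<equiv> a * w + 1"
  shows "finite (ucq_answers ` small_UCQs S k n a)"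
    and "card (ucq_answers ` small_UCQs S k n a) \<le> (m ^ k * (card (dom S) * m ^ w) ^ a) ^ n"
proof -
  define V where "V = (\<lambda>i. replicate i True) ` {..<m}"
  have "inj_on (\<lambda>i. replicate i True) {..<m}"
    by (rule inj_onI) (metis length_replicate)
  then have V: "finite V" "card V = m"
    unfolding V_def by (simp_all add: card_image)
  define At where "At = (\<Union>R \<in> dom S. (\<lambda>zs. (R, zs)) ` {zs. set zs \<subseteq> V \<and> length zs = the (S R)})"
  have At: "finite At"
    unfolding At_def using S finite_lists_length_eq[OF V(1)] by auto
  have "card At \<le> (\<Sum>R \<in> dom S. card ((\<lambda>zs. (R, zs)) ` {zs. set zs \<subseteq> V \<and> length zs = the (S R)}))"
    unfolding At_def by (rule card_UN_le[OF S])
  also have "\<dots> \<le> (\<Sum>R \<in> dom S. m ^ w)"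
  proof (rule sum_mono)
    fix R assume R: "R \<in> dom S"
    have "card ((\<lambda>zs. (R, zs)) ` {zs. set zs \<subseteq> V \<and> length zs = the (S R)}) \<le> m ^ the (S R)"
      using card_image_le[OF finite_lists_length_eq[OF V(1)], of "\<lambda>zs. (R, zs)" "the (S R)"]
      unfolding card_lists_length_eq[OF V(1)] V(2) .
    also have "\<dots> \<le> m ^ w" using w[OF R] by (intro power_increasing) (auto simp: m_def)
    finally show "card ((\<lambda>zs. (R, zs)) ` {zs. set zs \<subseteq> V \<and> length zs = the (S R)}) \<le> m ^ w" .
  qed
  finally have card_At: "card At \<le> card (dom S) * m ^ w" by simp
  define B where "B = (\<lambda>(hd, bd). CQ hd bd) `
    ({hd. set hd \<subseteq> V \<and> length hd = k} \<times> {bd. set bd \<subseteq> At \<and> length bd = a})"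
  have B: "finite B"
    unfolding B_def using finite_lists_length_eq[OF V(1)] finite_lists_length_eq[OF At] by auto
  have "card B \<le> card ({hd. set hd \<subseteq> V \<and> length hd = k} \<times> {bd. set bd \<subseteq> At \<and> length bd = a})"
    unfolding B_def by (intro card_image_le finite_cartesian_product finite_lists_length_eq V At)
  also have "\<dots> = m ^ k * card At ^ a"
    by (simp add: card_cartesian_product card_lists_length_eq V At)
  also have "\<dots> \<le> m ^ k * (card (dom S) * m ^ w) ^ a"
    by (intro mult_le_mono2 power_mono card_At) simp
  finally have card_B: "card B \<le> m ^ k * (card (dom S) * m ^ w) ^ a" .
  define U where "U = {Q. set Q \<subseteq> B \<and> length Q = n}"
  have U: "finite U" "card U \<le> (m ^ k * (card (dom S) * m ^ w) ^ a) ^ n"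
    unfolding U_def using finite_lists_length_eq[OF B] card_lists_length_eq[OF B, of n] card_B
    by (auto intro: power_mono)
  have "\<exists>q' \<in> B. cq_answers q' = cq_answers q" if q: "is_CQ S k q" "length (body q) \<le> a" for q
  proof -
    have "card (names q) \<le> card V"
      using order_trans[OF card_names[OF q(1) w] mult_le_mono1[OF q(2)]] unfolding V(2) m_def by simp
    from card_le_inj[OF finite_names V(1) this]
    obtain \<rho> where \<rho>: "\<rho> ` names q \<subseteq> V" "inj_on \<rho> (names q)" by blast
    let ?b = "map (\<lambda>(R, zs). (R, map \<rho> zs)) (body q)"
    have b: "set (pad a ?b) = set ?b" using q(1) by (intro set_pad) (auto simp: is_CQ_def)
    have "set ?b \<subseteq> At"
    proof
      fix F assume "F \<in> set ?b"
      then obtain R zs where F: "(R, zs) \<in> set (body q)" "F = (R, map \<rho> zs)" by auto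
      have "S R = Some (length zs)" using q(1) F(1) by (auto simp: is_CQ_def over_schema_def)
      moreover have "set (map \<rho> zs) \<subseteq> V" using F(1) \<rho>(1) by (force simp: names_def)
      ultimately show "F \<in> At" unfolding At_def F(2)
        by (intro UN_I[of R] imageI) auto
    qed
    moreover have "set (map \<rho> (head q)) \<subseteq> V" using \<rho>(1) by (auto simp: names_def)
    ultimately have "CQ (map \<rho> (head q)) (pad a ?b) \<in> B"
      unfolding B_def using q b
      by (intro image_eqI[of _ _ "(map \<rho> (head q), pad a ?b)"]) (auto simp: is_CQ_def length_pad)
    moreover have "cq_answers (CQ (map \<rho> (head q)) (pad a ?b)) = cq_answers q"
      using cq_answers_rename[OF \<rho>(2)] cq_answers_cong[of "CQ (map \<rho> (head q)) (pad a ?b)" "CQ (map \<rho> (head q)) ?b"] b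
      by simp
    ultimately show ?thesis by blast
  qed
  then have "\<forall>q. \<exists>q'. is_CQ S k q \<and> length (body q) \<le> a \<longrightarrow> q' \<in> B \<and> cq_answers q' = cq_answers q"
    by blast
  then obtain f where f: "\<forall>q. is_CQ S k q \<and> length (body q) \<le> a \<longrightarrow> f q \<in> B \<and> cq_answers (f q) = cq_answers q"
    using choice[of "\<lambda>q q'. is_CQ S k q \<and> length (body q) \<le> a \<longrightarrow> q' \<in> B \<and> cq_answers q' = cq_answers q"] by blast
  have sub: "ucq_answers ` small_UCQs S k n a \<subseteq> ucq_answers ` U"
  proof
    fix A assume "A \<in> ucq_answers ` small_UCQs S k n a"
    then obtain Q where A: "A = ucq_answers Q" and Q: "is_UCQ S k Q" "length Q \<le> n" "\<forall>q \<in> set Q. length (body q) \<le> a"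
      by (auto simp: small_UCQs_def)
    have Q': "\<forall>q \<in> set Q. f q \<in> B \<and> cq_answers (f q) = cq_answers q"
      using f Q by (auto simp: is_UCQ_def)
    have p: "set (pad n (map f Q)) = f ` set Q"
      using Q(1) set_pad[of "map f Q" n] by (auto simp: is_UCQ_def)
    have "pad n (map f Q) \<in> U"
      unfolding U_def using Q' Q(2) p by (auto simp: length_pad)
    moreover have "ucq_answers (pad n (map f Q)) = ucq_answers Q"
      using Q' by (simp add: fun_eq_iff ucq_answers_def p)
    ultimately show "A \<in> ucq_answers ` U" unfolding A by (intro image_eqI[of _ _ "pad n (map f Q)"]) simp_all
  qed
  then show "finite (ucq_answers ` small_UCQs S k n a)"
    using U(1) finite_subset by blast
  have "card (ucq_answers ` small_UCQs S k n a) \<le> card (ucq_answers ` U)"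
    using sub U(1) by (intro card_mono) auto
  also have "\<dots> \<le> card U" by (rule card_image_le[OF U(1)])
  also note U(2)
  finally show "card (ucq_answers ` small_UCQs S k n a) \<le> (m ^ k * (card (dom S) * m ^ w) ^ a) ^ n" .
qed

lemma power_le_exp: "real x \<le> exp (real j) \<Longrightarrow> real (x ^ i) \<le> exp (real (i * j))"
  using power_mono[of "real x" "exp (real j)" i] by (simp add: exp_of_nat_mult)

lemma real_le_exp: "real x \<le> exp (real x)"
  using exp_ge_add_one_self[of "real x"] by linarith

text \<open>The summand \<open>card (dom S)\<close> makes room for the initial hypothesis.
  Estimating x by exp x replaces logarithms and costs only powers of n: there are n disjuncts,
  linearly many facts in each, and an exponent linear in n for each fact, hence the cube.\<close>

lemma card_small_UCQs_exp:
  assumes S: "finite (dom S)"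
  obtains C where "\<And>n. 1 \<le> n \<Longrightarrow> finite (ucq_answers ` small_UCQs S k n (n + card (dom S)))"
    "\<And>n. 1 \<le> n \<Longrightarrow> real (card (ucq_answers ` small_UCQs S k n (n + card (dom S)))) \<le> exp (real (C * n ^ 3))"
proof -
  define w where "w = Max ((\<lambda>R. the (S R)) ` dom S)"
  have w: "the (S R) \<le> w" if "R \<in> dom S" for R
    using S that unfolding w_def by (auto intro: Max_ge)
  define s where "s = card (dom S)"
  define M where "M = (1 + s) * w + 1"
  define C where "C = k * M + (1 + s) * (s + w * M)"
  have "real (card (ucq_answers ` small_UCQs S k n (n + s))) \<le> exp (real (C * n ^ 3))" if n: "1 \<le> n" for n
  proof -
    define a where "a = n + s"
    define m where "m = a * w + 1"
    have a: "a \<le> (1 + s) * n" using n by (simp add: a_def)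
    then have m: "m \<le> M * n"
      using n mult_le_mono1[OF a, of w] unfolding m_def M_def by (simp add: algebra_simps)
    have nn: "n \<le> n * n" using n by simp
    have "real (m ^ k) \<le> exp (real (k * m))" "real (m ^ w) \<le> exp (real (w * m))"
      by (rule power_le_exp[OF real_le_exp])+
    then have "real (s * m ^ w) \<le> exp (real (s + w * m))"
      using real_le_exp[of s] by (simp add: exp_add mult_mono)
    from power_le_exp[OF this, of a] \<open>real (m ^ k) \<le> exp (real (k * m))\<close>
    have "real (m ^ k * (s * m ^ w) ^ a) \<le> exp (real (k * m + a * (s + w * m)))"
      unfolding of_nat_mult of_nat_add exp_add by (intro mult_mono) auto
    from power_le_exp[OF this, of n]
    have "real ((m ^ k * (s * m ^ w) ^ a) ^ n) \<le> exp (real (n * (k * m + a * (s + w * m))))" .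
    also have "n * (k * m + a * (s + w * m)) \<le> C * n ^ 3"
    proof -
      have "k * m \<le> k * M * (n * n)"
        using order_trans[OF mult_le_mono2[OF m, of k] mult_le_mono2[OF mult_le_mono2[OF nn, of M], of k]]
        by (simp only: mult.assoc)
      moreover have "s + w * m \<le> (s + w * M) * n"
        using add_mono[OF mult_le_mono2[OF n, of s] mult_le_mono2[OF m, of w]]
        by (simp only: add_mult_distrib mult.assoc mult_1_right)
      then have "a * (s + w * m) \<le> (1 + s) * n * ((s + w * M) * n)"
        using a by (rule mult_le_mono[rotated])
      ultimately have "k * m + a * (s + w * m) \<le> C * (n * n)"
        unfolding C_def add_mult_distrib[of "k * M"]
        by (intro add_mono) (simp_all only: mult.assoc mult.left_commute[of n])
      from mult_le_mono2[OF this, of n] show ?thesis by (simp add: power3_eq_cube algebra_simps)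
    qed
    finally have "real ((m ^ k * (s * m ^ w) ^ a) ^ n) \<le> exp (real (C * n ^ 3))" by simp
    moreover have "card (ucq_answers ` small_UCQs S k n a) \<le> (m ^ k * (s * m ^ w) ^ a) ^ n"
      using card_small_UCQs(2)[OF S w, of k n a] unfolding m_def s_def .
    then have "real (card (ucq_answers ` small_UCQs S k n a)) \<le> real ((m ^ k * (s * m ^ w) ^ a) ^ n)"
      by (rule of_nat_mono)
    ultimately show ?thesis unfolding a_def[symmetric] by (rule order_trans[rotated])
  qed
  moreover have "finite (ucq_answers ` small_UCQs S k n (n + card (dom S)))" for n
    using card_small_UCQs(1)[OF S w] by blast
  ultimately show ?thesis using that unfolding s_def by blast
qed


section \<open>Consistent hypotheses from a small class\<close>

lemma prob_replicate_pmf_all: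
  "measure_pmf.prob (replicate_pmf N D) {xs. \<forall>x \<in> set xs. P x} = measure_pmf.prob D {x. P x} ^ N"
proof (induction N)
  case 0
  then show ?case by (simp add: measure_pmf_single measure_return)
next
  case (Suc N)
  let ?R = "replicate_pmf N D"
  let ?A = "{x. P x} \<inter> set_pmf D" and ?B = "{xs. \<forall>x \<in> set xs. P x} \<inter> set_pmf ?R"
  have eq: "replicate_pmf (Suc N) D = map_pmf (\<lambda>(x, xs). x # xs) (pair_pmf D ?R)"
    by (simp add: pair_pmf_def map_bind_pmf bind_return_pmf bind_assoc_pmf)
  have "measure_pmf.prob (replicate_pmf (Suc N) D) {xs. \<forall>x \<in> set xs. P x} =
      measure_pmf.prob (pair_pmf D ?R) ({x. P x} \<times> {xs. \<forall>x \<in> set xs. P x})"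
    unfolding eq measure_map_pmf by (rule arg_cong[where f = "measure_pmf.prob _"]) auto
  \<comment> \<open>Restriction to the supports makes both factors countable, as the product rule
    requires.\<close>
  also have "\<dots> = measure_pmf.prob (pair_pmf D ?R) (({x. P x} \<times> {xs. \<forall>x \<in> set xs. P x}) \<inter> set_pmf (pair_pmf D ?R))"
    by (rule measure_Int_set_pmf[symmetric])
  also have "({x. P x} \<times> {xs. \<forall>x \<in> set xs. P x}) \<inter> set_pmf (pair_pmf D ?R) = ?A \<times> ?B"
    by auto
  also have "measure_pmf.prob (pair_pmf D ?R) (?A \<times> ?B) = measure_pmf.prob D ?A * measure_pmf.prob ?R ?B"
    by (rule measure_pmf_prob_product) auto
  finally show ?case by (simp add: measure_Int_set_pmf Suc)
qed

text \<open>The union bound of Occam learning: a fixed labelling with error above \<epsilon> agrees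
  with N independent examples with probability at most (1 - \<epsilon>)^N \<le> exp (- \<epsilon> *
  N).\<close>

lemma prob_consistent_bad:
  fixes D :: "'e pmf" and H :: "('e \<Rightarrow> bool) set"
  assumes H: "finite H" and \<epsilon>: "0 < \<epsilon>" "\<epsilon> < 1"
  shows "measure_pmf.prob (replicate_pmf N D)
     {es. \<exists>h \<in> H. (\<forall>e \<in> set es. h e = t e) \<and> measure_pmf.prob D {e. h e \<noteq> t e} > \<epsilon>} \<le> card H * exp (- (\<epsilon> * N))"
proof -
  let ?G = "{h \<in> H. measure_pmf.prob D {e. h e \<noteq> t e} > \<epsilon>}"
  have "measure_pmf.prob (replicate_pmf N D)
     {es. \<exists>h \<in> H. (\<forall>e \<in> set es. h e = t e) \<and> measure_pmf.prob D {e. h e \<noteq> t e} > \<epsilon>}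
    = measure_pmf.prob (replicate_pmf N D) (\<Union>h \<in> ?G. {es. \<forall>e \<in> set es. h e = t e})"
    by (rule arg_cong[where f = "measure_pmf.prob _"]) auto
  also have "\<dots> \<le> (\<Sum>h \<in> ?G. measure_pmf.prob (replicate_pmf N D) {es. \<forall>e \<in> set es. h e = t e})"
    using H by (intro measure_pmf.finite_measure_subadditive_finite) auto
  also have "\<dots> \<le> (\<Sum>h \<in> ?G. exp (- (\<epsilon> * N)))"
  proof (rule sum_mono)
    fix h assume h: "h \<in> ?G"
    have "measure_pmf.prob D {e. h e = t e} = 1 - measure_pmf.prob D {e. h e \<noteq> t e}"
      using measure_pmf.prob_compl[of "{e. h e \<noteq> t e}" D] by (simp add: Compl_eq_Diff_UNIV[symmetric] Collect_neg_eq[symmetric])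
    also have "\<dots> \<le> 1 - \<epsilon>" using h by simp
    also have "\<dots> \<le> exp (- \<epsilon>)" using exp_ge_add_one_self[of "- \<epsilon>"] by simp
    finally have "measure_pmf.prob D {e. h e = t e} ^ N \<le> exp (- \<epsilon>) ^ N"
      by (intro power_mono) auto
    then show "measure_pmf.prob (replicate_pmf N D) {es. \<forall>e \<in> set es. h e = t e} \<le> exp (- (\<epsilon> * N))"
      unfolding prob_replicate_pmf_all by (simp add: exp_of_nat_mult[symmetric] mult.commute)
  qed
  also have "\<dots> \<le> card H * exp (- (\<epsilon> * N))"
    using H by (auto intro!: mult_right_mono card_mono)
  finally show ?thesis .
qed

text \<open>The output is consistent and lies in the small class, so it can be inaccurate only if
  some inaccurate member of the class is consistent. The bound on its length is kept in the event
  because it makes the output a single CQ when the target is one.\<close>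

theorem learned_PAC:
  fixes D :: "pointed_instance pmf" and \<epsilon> \<delta> :: real and B :: nat
  assumes S: "finite (dom S)"
    and Q: "is_UCQ S k Q" "length Q \<le> n" "\<forall>q \<in> set Q. length (body q) \<le> n"
    and B: "finite (ucq_answers ` small_UCQs S k n (n + card (dom S)))"
      "real (card (ucq_answers ` small_UCQs S k n (n + card (dom S)))) \<le> exp (real B)"
    and \<epsilon>: "0 < \<epsilon>" "\<epsilon> < 1" and \<delta>: "0 < \<delta>"
    and N: "n \<le> N" "real B + 1 / \<delta> \<le> \<epsilon> * real N"
    and D: "set_pmf D \<subseteq> query_examples S k"
    and dec: "\<forall>e \<in> query_examples S k. e = (set (body (dec e)), head (dec e))"
  shows "1 - \<delta> \<le> measure_pmf.prob (replicate_pmf N D) {es. set es \<subseteq> query_examples S k \<and>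
    is_UCQ S k (learned S k Q (map dec es)) \<and> length (learned S k Q (map dec es)) \<le> length Q \<and>
    measure_pmf.prob D {(I, as). (as \<in> ucq_answers (learned S k Q (map dec es)) I) \<noteq> (as \<in> ucq_answers Q I)} \<le> \<epsilon>}"
proof -
  interpret target S k Q using Q(1) by unfold_locales
  note start = pos_top_cq[OF S]
  define t where "t = (\<lambda>(I, as). as \<in> ucq_answers Q I)"
  \<comment> \<open>Labellings of examples, so that equivalent queries are counted once.\<close>
  define HH where "HH = (\<lambda>f (I, as). as \<in> f I) ` (ucq_answers ` small_UCQs S k n (n + card (dom S)))"
  let ?R = "replicate_pmf N D"
  let ?bad = "{es. \<exists>h \<in> HH. (\<forall>e \<in> set es. h e = t e) \<and> measure_pmf.prob D {e. h e \<noteq> t e} > \<epsilon>}"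
  let ?good = "{es. set es \<subseteq> query_examples S k \<and>
     is_UCQ S k (learned S k Q (map dec es)) \<and> length (learned S k Q (map dec es)) \<le> length Q \<and>
     measure_pmf.prob D {(I, as). (as \<in> ucq_answers (learned S k Q (map dec es)) I) \<noteq> (as \<in> ucq_answers Q I)} \<le> \<epsilon>}"
  have HH: "finite HH" unfolding HH_def using B(1) by (rule finite_imageI)
  have "measure_pmf.prob ?R ?bad \<le> card HH * exp (- (\<epsilon> * N))"
    by (rule prob_consistent_bad[OF HH \<epsilon>])
  also have "\<dots> \<le> exp (real B) * exp (- (\<epsilon> * N))"
  proof (rule mult_right_mono)
    have "card HH \<le> card (ucq_answers ` small_UCQs S k n (n + card (dom S)))"
      unfolding HH_def by (rule card_image_le[OF B(1)])
    then show "real (card HH) \<le> exp (real B)"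
      using B(2) by linarith
  qed simp
  also have "\<dots> = exp (real B - \<epsilon> * N)" by (simp add: exp_diff exp_minus divide_inverse)
  also have "\<dots> \<le> exp (- (1 / \<delta>))" using N(2) by simp
  \<comment> \<open>Here 1/\<delta> stands in for the logarithm of 1/\<delta>, by 1/\<delta> \<le>
    exp (1/\<delta>).\<close>
  also have "\<dots> \<le> \<delta>"
  proof -
    have "1 / \<delta> \<le> exp (1 / \<delta>)" using exp_ge_add_one_self[of "1 / \<delta>"] by linarith
    then have "inverse (exp (1 / \<delta>)) \<le> inverse (1 / \<delta>)" using \<delta> by (intro le_imp_inverse_le) auto
    then show ?thesis by (simp add: exp_minus)
  qed
  finally have bad: "measure_pmf.prob ?R ?bad \<le> \<delta>" .
  have "es \<in> ?good" if es: "es \<in> set_pmf ?R" "es \<notin> ?bad" for es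
  proof -
    have esN: "length es = N" and ex: "set es \<subseteq> query_examples S k"
      using es(1) D by (auto simp: set_replicate_pmf)
    let ?cs = "map dec es"
    have wf: "\<forall>c \<in> set ?cs. wf_cq S c \<and> length (head c) = k"
      using ex dec query_examples_iff by fastforce
    let ?H = "learned S k Q ?cs"
    have H: "?H = learn N pos (top_cq S k) ?cs"
      by (simp add: learned_eq esN)
    \<comment> \<open>Since n \<le> N, the threshold admits every disjunct.\<close>
    have L: "length (body q) \<le> N" if "q \<in> set Q" for q
      using Q(3) N(1) that by (meson le_trans)
    have len: "length ?H \<le> length Q"
      unfolding H by (rule length_learn_le[OF start L wf])
    have UCQ: "is_UCQ S k ?H"
      unfolding H is_UCQ_def using learn_nonempty[OF start] pos_is_CQ[OF learn_pos[OF start]] by blast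
    have "length (body h) \<le> n + card (dom S)" if "h \<in> set ?H" for h
    proof -
      have "h = top_cq S k \<or> (\<exists>q \<in> set Q. length (body h) \<le> length (body q))"
        using learn_small[OF start _ that[unfolded H]] wf by blast
      then show ?thesis using Q(3) body_top_cq(2)[OF S] by (metis le_add2 trans_le_add1 le_trans)
    qed
    then have "?H \<in> small_UCQs S k n (n + card (dom S))"
      using UCQ len Q(2) unfolding small_UCQs_def by simp
    then have mem: "(\<lambda>(I, as). as \<in> ucq_answers ?H I) \<in> HH"
      unfolding HH_def by (rule imageI[OF imageI])
    have "(\<lambda>(I, as). as \<in> ucq_answers ?H I) e = t e" if e: "e \<in> set es" for e
    proof -
      let ?c = "dec e"
      have c: "?c \<in> set ?cs" using e by simp
      have "e = (set (body ?c), head ?c)" using ex dec e by blast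
      then have "(\<lambda>(I, as). as \<in> ucq_answers ?H I) e \<longleftrightarrow> head ?c \<in> ucq_answers ?H (set (body ?c))"
        "t e \<longleftrightarrow> head ?c \<in> ucq_answers Q (set (body ?c))"
        unfolding t_def by (metis (no_types, lifting) case_prod_conv)+
      moreover have "head ?c \<in> ucq_answers ?H (set (body ?c)) \<longleftrightarrow> (\<exists>h \<in> set ?H. maps_to h ?c)"
        by (simp add: ucq_answers_def maps_to_def)
      moreover have "(\<exists>h \<in> set ?H. maps_to h ?c) \<longleftrightarrow> pos ?c"
        unfolding H by (rule learn_consistent[OF start L wf c])
      moreover have "pos ?c \<longleftrightarrow> head ?c \<in> ucq_answers Q (set (body ?c))"
        using sat_UCQ_iff[of ?c] wf c by blast
      ultimately show ?thesis by blast
    qed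
    then have "\<not> measure_pmf.prob D {e. (\<lambda>(I, as). as \<in> ucq_answers ?H I) e \<noteq> t e} > \<epsilon>"
      using es(2) mem by blast
    moreover have "{e. (\<lambda>(I, as). as \<in> ucq_answers ?H I) e \<noteq> t e} =
       {(I, as). (as \<in> ucq_answers ?H I) \<noteq> (as \<in> ucq_answers Q I)}"
      unfolding t_def by auto
    ultimately have "measure_pmf.prob D {(I, as). (as \<in> ucq_answers ?H I) \<noteq> (as \<in> ucq_answers Q I)} \<le> \<epsilon>"
      by (simp only: not_less)
    then show ?thesis using ex UCQ len by blast
  qed
  \<comment> \<open>Samples outside the support may contain pairs that are not examples, so the
    inclusion is shown on the support only.\<close>
  then have sub: "(- ?bad) \<inter> set_pmf ?R \<subseteq> ?good" by blast
  have "1 - \<delta> \<le> 1 - measure_pmf.prob ?R ?bad" using bad by simp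
  also have "\<dots> = measure_pmf.prob ?R (- ?bad)"
    using measure_pmf.prob_compl[of ?bad ?R] by (simp add: Compl_eq_Diff_UNIV)
  also have "\<dots> = measure_pmf.prob ?R ((- ?bad) \<inter> set_pmf ?R)"
    by (rule measure_Int_set_pmf[symmetric])
  also have "\<dots> \<le> measure_pmf.prob ?R ?good"
    by (rule measure_pmf.finite_measure_mono[OF sub]) simp
  finally show "1 - \<delta> \<le> measure_pmf.prob ?R ?good" .
qed


section \<open>PAC learnability\<close>

text \<open>Independence of the coins makes the event a product of a set of samples with the whole
  coin space, so it is measurable and the second factor has probability 1.\<close>

lemma prob_coin_independent:
  assumes "\<And>x \<omega> \<omega>'. P x \<omega> \<Longrightarrow> P x \<omega>'"
  shows "\<P>((x, \<omega>) in measure_pmf p \<Otimes>\<^sub>M fair_coins. P x \<omega>) = measure_pmf.prob p {x. P x \<omega>0}"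
proof -
  interpret coins: prob_space fair_coins
    unfolding fair_coins_def by (rule prob_space.prob_space_stream_space) (rule measure_pmf.prob_space_axioms)
  have "{(x, \<omega>). (x, \<omega>) \<in> space (measure_pmf p \<Otimes>\<^sub>M fair_coins) \<and> P x \<omega>} = {x. P x \<omega>0} \<times> space fair_coins"
    using assms by (auto simp: space_pair_measure)
  moreover have "emeasure (measure_pmf p \<Otimes>\<^sub>M fair_coins) ({x. P x \<omega>0} \<times> space fair_coins) =
      emeasure (measure_pmf p) {x. P x \<omega>0} * emeasure fair_coins (space fair_coins)"
    by (rule coins.emeasure_pair_measure_Times) auto
  ultimately show ?thesis
    by (simp only: measure_def coins.emeasure_space_1 mult_1_right)
qed

lemma polynomial4_monomial: "polynomial4 (\<lambda>w x y z. C * w ^ a * x ^ b * y ^ c * z ^ d)"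
proof -
  let ?N = "a + b + c + d"
  let ?c = "\<lambda>i j k l. if l = d then (if k = c then (if j = b then (if i = a then C else 0) else 0) else 0) else 0"
  have "C * w ^ a * x ^ b * y ^ c * z ^ d =
    (\<Sum>i\<le>?N. \<Sum>j\<le>?N. \<Sum>k\<le>?N. \<Sum>l\<le>?N. ?c i j k l * w ^ i * x ^ j * y ^ k * z ^ l)" for w x y z
    by (simp add: if_distrib[of "\<lambda>t. t * _"] sum.delta cong: if_cong)
  then show ?thesis
    unfolding polynomial4_def by (intro exI[of _ ?N] exI[of _ ?c] allI)
qed

text \<open>A monomial replaces the sum of both requirements: n^3, 1/\<delta> and 1/\<epsilon> are
  all at least 1, so each term is bounded by the full product.\<close>

lemma sample_size_bounds:
  fixes C n N :: nat and \<epsilon> \<delta> :: real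
  assumes "real (C + 2) * (1 / \<delta>) ^ 1 * (1 / \<epsilon>) ^ 1 * real n ^ 3 * real m ^ 0 \<le> real N"
    and n: "1 \<le> n" and \<epsilon>: "0 < \<epsilon>" "\<epsilon> < 1" and \<delta>: "0 < \<delta>" "\<delta> < 1"
  shows "n \<le> N" "real (C * n ^ 3) + 1 / \<delta> \<le> \<epsilon> * real N"
proof -
  have n3: "real n \<le> real n ^ 3" "1 \<le> real n ^ 3"
    using n power_increasing[of 1 3 "real n"] by (auto intro: one_le_power)
  have d: "1 \<le> 1 / \<delta>" and e: "1 \<le> 1 / \<epsilon>" using \<epsilon> \<delta> by auto
  have N: "real (C + 2) * (1 / \<delta>) * real n ^ 3 * (1 / \<epsilon>) \<le> real N"
    using assms(1) by (simp add: mult_ac)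
  have "real C * real n ^ 3 + 1 / \<delta> \<le> real C * (1 / \<delta>) * real n ^ 3 + 2 * (1 / \<delta>) * real n ^ 3"
  proof (rule add_mono)
    show "real C * real n ^ 3 \<le> real C * (1 / \<delta>) * real n ^ 3"
      using mult_left_mono[OF d, of "real C"] by (intro mult_right_mono) auto
    have "1 / \<delta> * 1 \<le> (2 * (1 / \<delta>)) * real n ^ 3"
      by (intro mult_mono) (use n3(2) d in linarith)+
    then show "1 / \<delta> \<le> 2 * (1 / \<delta>) * real n ^ 3" by simp
  qed
  also have "\<dots> = real (C + 2) * (1 / \<delta>) * real n ^ 3" by (simp add: algebra_simps)
  finally have A: "real C * real n ^ 3 + 1 / \<delta> \<le> real (C + 2) * (1 / \<delta>) * real n ^ 3" .
  also have "\<dots> \<le> \<epsilon> * real N"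
    using mult_left_mono[OF N, of \<epsilon>] \<epsilon> by simp
  finally show "real (C * n ^ 3) + 1 / \<delta> \<le> \<epsilon> * real N" by simp
  have n': "1 * real n ^ 3 \<le> (real (C + 2) * (1 / \<delta>)) * real n ^ 3"
    using mult_mono[of 1 "real (C + 2)" 1 "1 / \<delta>"] d by (intro mult_right_mono) auto
  have "real n * 1 \<le> real (C + 2) * (1 / \<delta>) * real n ^ 3 * (1 / \<epsilon>)"
    by (intro mult_mono) (use n' n3 e in linarith)+
  then show "n \<le> N" using N by simp
qed

lemma enc_list_map: "enc_list f (map g xs) = enc_list (f \<circ> g) xs"
  by (induction xs) auto

lemma enc_list_cong: "(\<And>x. x \<in> set xs \<Longrightarrow> f x = g x) \<Longrightarrow> enc_list f xs = enc_list g xs"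
  by (induction xs) auto

lemma computes_outputs_within: "computes M [inp] A out t \<Longrightarrow> outputs_within A M inp \<omega> out t"
  unfolding computes_def outputs_within_def by blast

lemma poly_power_bound: "poly ([:2, 1:] ^ c + 1) (x :: nat) = (x + 2) ^ c + 1"
  by (simp add: poly_power add.commute)

text \<open>
  \<open>toU\<close> embeds the concepts into the UCQs; \<open>A\<close> postprocesses the UCQ found by the learner into
  the representation \<open>out\<close> of the concept \<open>fromU\<close>.
\<close>

lemma efficiently_PAC_learnable_via_UCQs:
  fixes K :: "('c, pointed_instance) concept_class" and toU :: "'c \<Rightarrow> ucq"
  assumes S: "finite (dom S)"
    and examples: "examples K = query_examples S k" "rep_example K = rep_pointed_instance"
    and sat: "\<And>I as \<phi>. sat K (I, as) \<phi> \<longleftrightarrow> as \<in> ucq_answers (toU \<phi>) I"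
    and toU: "\<And>\<phi>. \<phi> \<in> concepts K \<Longrightarrow> is_UCQ S k (toU \<phi>)"
    and size: "\<And>\<phi>. \<phi> \<in> concepts K \<Longrightarrow> 1 \<le> concept_size K \<phi> \<and> length (toU \<phi>) \<le> concept_size K \<phi> \<and>
        (\<forall>q \<in> set (toU \<phi>). length (body q) \<le> concept_size K \<phi>)"
    and A: "flip_free A" "\<And>M \<rho> H t. computes M \<rho> (LearnP (top_cq S k)) (enc_list enc_cq H) t \<Longrightarrow>
        is_UCQ S k H \<Longrightarrow> computes M \<rho> A (out H) (t + 1)"
    and fromU: "\<And>H. is_UCQ S k H \<Longrightarrow> fromU H \<in> concepts K \<and> rep_concept K (out H) (fromU H)"
    and toU_fromU: "\<And>\<phi> H. is_UCQ S k H \<Longrightarrow> length H \<le> length (toU \<phi>) \<Longrightarrow> toU (fromU H) = H"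
  shows "efficiently_PAC_learnable_MQ K"
proof -
  obtain c where c: "\<And>Q ds. is_UCQ S k Q \<Longrightarrow> \<forall>(c, l) \<in> set ds. wf_cq S c \<and> length (head c) = k \<Longrightarrow>
    computes (MEMB (UCQ_class S k) Q) [enc_list enc_labelled ds] (LearnP (top_cq S k))
      (enc_list enc_cq (learned S k Q (map fst ds))) ((size (enc_list enc_labelled ds) + 2) ^ c)"
    using learner_time[OF S] by blast
  have MEMB: "MEMB K \<phi> = MEMB (UCQ_class S k) (toU \<phi>)" for \<phi>
    unfolding MEMB_def lab_def examples by (auto simp: UCQ_class_def sat fun_eq_iff)
  have learned_UCQ: "is_UCQ S k (learned S k Q es)" if "is_UCQ S k Q" for Q es
  proof -
    interpret target S k Q using that by unfold_locales
    show ?thesis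
      unfolding learned_eq is_UCQ_def
      using learn_nonempty[OF pos_top_cq[OF S]] pos_is_CQ[OF learn_pos[OF pos_top_cq[OF S]]] by blast
  qed
  have run: "computes (MEMB K \<phi>) [enc_list enc_labelled ds] A (out (learned S k (toU \<phi>) (map fst ds)))
      ((size (enc_list enc_labelled ds) + 2) ^ c + 1)"
    if "\<phi> \<in> concepts K" "\<forall>(c, l) \<in> set ds. wf_cq S c \<and> length (head c) = k" for \<phi> ds
    unfolding MEMB by (rule A(2)[OF c[OF toU[OF that(1)] that(2)] learned_UCQ[OF toU[OF that(1)]]])
  have rep: "\<exists>c. d = enc_cq c \<and> e = (set (body c), head c)" if "rep_example K d e" for d e
    using that unfolding examples by (cases e) (auto simp: rep_pointed_instance_iff)
  have poly: "poly_time_MQ_algorithm K A"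
    unfolding poly_time_MQ_algorithm_def
  \<comment> \<open>The polynomial is (x + 2)^c + 1, where the last 1 pays for the postprocessing in
    \<open>A\<close>.\<close>
  proof (intro exI[of _ "[:2, 1:] ^ c + 1"] ballI allI impI)
    fix \<phi> and ds :: "(data \<times> bool) list" and \<omega>
    assume \<phi>: "\<phi> \<in> concepts K" and ds: "\<forall>(d, l) \<in> set ds. \<exists>e \<in> examples K. rep_example K d e"
    have "\<exists>c. d = enc_cq c \<and> wf_cq S c \<and> length (head c) = k" if dl: "(d, l) \<in> set ds" for d l
    proof -
      obtain e where e: "e \<in> examples K" "rep_example K d e" using ds dl by blast
      then obtain c where "d = enc_cq c" "e = (set (body c), head c)" using rep by blast
      then show ?thesis using e(1) query_examples_iff unfolding examples by blast
    qed
    then have "\<forall>d. \<exists>c. \<forall>l. (d, l) \<in> set ds \<longrightarrow> d = enc_cq c \<and> wf_cq S c \<and> length (head c) = k"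
      by blast
    from choice[OF this] obtain dec where
      dec: "\<forall>d l. (d, l) \<in> set ds \<longrightarrow> d = enc_cq (dec d) \<and> wf_cq S (dec d) \<and> length (head (dec d)) = k"
      by blast
    let ?ds = "map (\<lambda>(d, l). (dec d, l)) ds"
    have "enc_list (\<lambda>(d, l). Node d (enc_bool l)) ds = enc_list (enc_labelled \<circ> (\<lambda>(d, l). (dec d, l))) ds"
    proof (rule enc_list_cong)
      fix x assume x: "x \<in> set ds"
      obtain d l where [simp]: "x = (d, l)" by (cases x)
      have "(d, l) \<in> set ds" using x by simp
      then have "d = enc_cq (dec d)" using dec by blast
      from this[symmetric] show "(case x of (d, l) \<Rightarrow> Node d (enc_bool l)) = (enc_labelled \<circ> (\<lambda>(d, l). (dec d, l))) x"
        by simp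
    qed
    then have enc: "enc_sample ds = enc_list enc_labelled ?ds"
      unfolding enc_sample_def by (simp only: enc_list_map)
    have wf: "\<forall>(c, l) \<in> set ?ds. wf_cq S c \<and> length (head c) = k"
      using dec by auto
    let ?H = "learned S k (toU \<phi>) (map fst ?ds)"
    have "outputs_within A (MEMB K \<phi>) (enc_sample ds) \<omega> (out ?H) (poly ([:2, 1:] ^ c + 1) (size (enc_sample ds)))"
      unfolding enc poly_power_bound by (rule computes_outputs_within[OF run[OF \<phi> wf]])
    moreover have "fromU ?H \<in> concepts K \<and> rep_concept K (out ?H) (fromU ?H)"
      by (rule fromU[OF learned_UCQ[OF toU[OF \<phi>]]])
    ultimately show "\<exists>out. \<exists>\<phi>'\<in>concepts K. rep_concept K out \<phi>' \<and>
        outputs_within A (MEMB K \<phi>) (enc_sample ds) \<omega> out (poly ([:2, 1:] ^ c + 1) (size (enc_sample ds)))"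
      by blast
  qed
  obtain C where C: "\<And>n. 1 \<le> n \<Longrightarrow> finite (ucq_answers ` small_UCQs S k n (n + card (dom S)))"
    "\<And>n. 1 \<le> n \<Longrightarrow> real (card (ucq_answers ` small_UCQs S k n (n + card (dom S)))) \<le> exp (real (C * n ^ 3))"
    using card_small_UCQs_exp[OF S] by blast
  let ?f = "\<lambda>w x y z. real (C + 2) * w ^ 1 * x ^ 1 * y ^ 3 * z ^ 0"
  have PAC: "1 - \<delta> \<le> \<P>((es, \<omega>) in measure_pmf (replicate_pmf N D) \<Otimes>\<^sub>M fair_coins.
      \<exists>out. \<exists>\<phi>'\<in>concepts K. rep_concept K out \<phi>' \<and>
        outputs A (MEMB K \<phi>) (enc_sample (map (\<lambda>e. (enc e, lab K \<phi> e)) es)) \<omega> out \<and> error K D \<phi> \<phi>' \<le> \<epsilon>)"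
    if \<delta>: "0 < \<delta>" "\<delta> < 1" and \<epsilon>: "0 < \<epsilon>" "\<epsilon> < 1" and D: "set_pmf D \<subseteq> examples_upto K m"
      and \<phi>: "\<phi> \<in> concepts_upto K n" and N: "?f (1 / \<delta>) (1 / \<epsilon>) (real n) (real m) \<le> real N"
      and enc: "\<forall>e \<in> examples K. rep_example K (enc e) e"
    for \<delta> \<epsilon> n m D \<phi> N enc
  proof -
    have \<phi>K: "\<phi> \<in> concepts K" and sz: "concept_size K \<phi> \<le> n" using \<phi> by (auto simp: concepts_upto_def)
    let ?Q = "toU \<phi>"
    have Q: "is_UCQ S k ?Q" "length ?Q \<le> n" "\<forall>q \<in> set ?Q. length (body q) \<le> n" and n: "1 \<le> n"
      using toU[OF \<phi>K] size[OF \<phi>K] sz le_trans by blast+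
    have ex: "set_pmf D \<subseteq> query_examples S k" using D unfolding examples_upto_def examples by blast
    \<comment> \<open>\<open>enc e\<close> may list the facts in any order and with repetitions;
      \<open>dec e\<close> is the query with precisely this list as body.\<close>
    have "\<forall>e. \<exists>c. e \<in> query_examples S k \<longrightarrow> enc e = enc_cq c \<and> e = (set (body c), head c)"
      using enc rep unfolding examples by blast
    from choice[OF this] obtain dec where
      dec: "\<forall>e. e \<in> query_examples S k \<longrightarrow> enc e = enc_cq (dec e) \<and> e = (set (body (dec e)), head (dec e))"
      by blast
    let ?P = "\<lambda>es \<omega>. \<exists>out. \<exists>\<phi>'\<in>concepts K. rep_concept K out \<phi>' \<and>
        outputs A (MEMB K \<phi>) (enc_sample (map (\<lambda>e. (enc e, lab K \<phi> e)) es)) \<omega> out \<and> error K D \<phi> \<phi>' \<le> \<epsilon>"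
    let ?good = "{es. set es \<subseteq> query_examples S k \<and>
       is_UCQ S k (learned S k ?Q (map dec es)) \<and> length (learned S k ?Q (map dec es)) \<le> length ?Q \<and>
       measure_pmf.prob D {(I, as). (as \<in> ucq_answers (learned S k ?Q (map dec es)) I) \<noteq> (as \<in> ucq_answers ?Q I)} \<le> \<epsilon>}"
    have "1 - \<delta> \<le> measure_pmf.prob (replicate_pmf N D) ?good"
      by (rule learned_PAC[OF S Q C[OF n] \<epsilon> \<delta>(1) sample_size_bounds[OF N n \<epsilon> \<delta>] ex])
        (use dec in blast)
    \<comment> \<open>\<open>undefined\<close> is merely some coin stream; any other would serve, as
      no coin is tossed.\<close>
    also have "\<dots> \<le> measure_pmf.prob (replicate_pmf N D) {es. ?P es undefined}"
    proof (rule measure_pmf.finite_measure_mono)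
      show "?good \<subseteq> {es. ?P es undefined}"
      proof (rule subsetI, rule CollectI)
        fix es assume es: "es \<in> ?good"
        let ?H = "learned S k ?Q (map dec es)"
        let ?ds = "map (\<lambda>e. (dec e, lab K \<phi> e)) es"
        have H: "is_UCQ S k ?H" "length ?H \<le> length ?Q"
          and err: "measure_pmf.prob D {(I, as). (as \<in> ucq_answers ?H I) \<noteq> (as \<in> ucq_answers ?Q I)} \<le> \<epsilon>"
          and es': "set es \<subseteq> query_examples S k"
          using es by blast+
        have "enc_list ((\<lambda>(d, l). Node d (enc_bool l)) \<circ> (\<lambda>e. (enc e, lab K \<phi> e))) es =
          enc_list (enc_labelled \<circ> (\<lambda>e. (dec e, lab K \<phi> e))) es"
          using dec es' by (intro enc_list_cong) auto
        then have s: "enc_sample (map (\<lambda>e. (enc e, lab K \<phi> e)) es) = enc_list enc_labelled ?ds"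
          unfolding enc_sample_def by (simp only: enc_list_map)
        have wf: "\<forall>(c, l) \<in> set ?ds. wf_cq S c \<and> length (head c) = k"
        proof (clarsimp)
          fix e assume "e \<in> set es"
          then have e: "e \<in> query_examples S k" using es' by blast
          then have "(set (body (dec e)), head (dec e)) \<in> query_examples S k" using dec by metis
          then show "wf_cq S (dec e) \<and> length (head (dec e)) = k" unfolding query_examples_iff by blast
        qed
        have "map fst ?ds = map dec es" by simp
        from run[OF \<phi>K wf, unfolded this] have "outputs A (MEMB K \<phi>)
            (enc_sample (map (\<lambda>e. (enc e, lab K \<phi> e)) es)) undefined (out ?H)"
          unfolding s outputs_def using computes_outputs_within by blast
        moreover have "{e. lab K (fromU ?H) e \<noteq> lab K \<phi> e} =
            {(I, as). (as \<in> ucq_answers ?H I) \<noteq> (as \<in> ucq_answers ?Q I)}"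
          \<comment> \<open>For CQs, passing to the single query \<open>hd H\<close> is faithful
            because \<open>H\<close> is no longer than the target; this is where that bound is
            used.\<close>
          using toU_fromU[OF H] by (auto simp: lab_def sat)
        then have "error K D \<phi> (fromU ?H) \<le> \<epsilon>" unfolding error_def using err by simp
        ultimately show "?P es undefined" using fromU[OF H(1)] by blast
      qed
    qed simp
    also have "\<dots> = \<P>((es, \<omega>) in measure_pmf (replicate_pmf N D) \<Otimes>\<^sub>M fair_coins. ?P es \<omega>)"
      by (rule prob_coin_independent[symmetric]) (use outputs_flip_free[OF A(1)] in blast)
    finally show ?thesis .
  qed
  show ?thesis
    unfolding efficiently_PAC_learnable_MQ_def
    by (rule exI[of _ A], rule exI[of _ ?f], intro conjI allI impI poly polynomial4_monomial)
      (elim conjE, rule PAC; assumption)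
qed

lemma concept_size_eq:
  assumes "\<And>d. rep_concept K d \<phi> \<longleftrightarrow> d = e"
  shows "concept_size K \<phi> = size e"
  unfolding concept_size_def assms by (rule Least_equality) auto

lemma length_body_le_size: "length (body q) < size (enc_cq q)"
  using length_le_size_enc_list[of "body q" enc_atom] by (simp add: enc_cq_def)

theorem theorem1p2:
  fixes S :: schema and k :: nat
  assumes "finite (dom S)"
  shows "efficiently_PAC_learnable_MQ (CQ_class S k) \<and> efficiently_PAC_learnable_MQ (UCQ_class S k)"
proof
  show "efficiently_PAC_learnable_MQ (CQ_class S k)"
  proof (rule efficiently_PAC_learnable_via_UCQs[OF assms, where toU = "\<lambda>q. [q]" and fromU = hd
        and out = "\<lambda>H. enc_cq (hd H)" and A = "Lft (LearnP (top_cq S k))"])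
    show "1 \<le> concept_size (CQ_class S k) q \<and> length [q] \<le> concept_size (CQ_class S k) q \<and>
        (\<forall>q' \<in> set [q]. length (body q') \<le> concept_size (CQ_class S k) q)" for q
      using length_body_le_size[of q] by (simp add: concept_size_eq[of _ _ "enc_cq q"] CQ_class_def)
    show "computes M \<rho> (Lft (LearnP (top_cq S k))) (enc_cq (hd H)) (t + 1)"
      if "computes M \<rho> (LearnP (top_cq S k)) (enc_list enc_cq H) t" "is_UCQ S k H" for M \<rho> H t
      using computes_Lft[OF that(1)] that(2) by (cases H) (auto simp: is_UCQ_def)
    show "hd H \<in> concepts (CQ_class S k) \<and> rep_concept (CQ_class S k) (enc_cq (hd H)) (hd H)"
      if "is_UCQ S k H" for H
      using that by (cases H) (auto simp: is_UCQ_def CQ_class_def)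
    \<comment> \<open>A UCQ is non-empty, so length at most 1 makes it a singleton.\<close>
    show "[hd H] = H" if "is_UCQ S k H" "length H \<le> length [q]" for q H
      using that by (cases H) (auto simp: is_UCQ_def)
  qed (auto simp: CQ_class_def ucq_answers_def flip_free_LearnP)
  show "efficiently_PAC_learnable_MQ (UCQ_class S k)"
  proof (rule efficiently_PAC_learnable_via_UCQs[OF assms, where toU = "\<lambda>Q. Q" and fromU = "\<lambda>H. H"
        and out = "enc_list enc_cq" and A = "LearnP (top_cq S k)"])
    show "1 \<le> concept_size (UCQ_class S k) Q \<and> length Q \<le> concept_size (UCQ_class S k) Q \<and>
        (\<forall>q \<in> set Q. length (body q) \<le> concept_size (UCQ_class S k) Q)" if "Q \<in> concepts (UCQ_class S k)" for Q
    proof -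
      have sz: "concept_size (UCQ_class S k) Q = size (enc_list enc_cq Q)"
        by (rule concept_size_eq) (simp add: UCQ_class_def)
      have "length (body q) \<le> size (enc_list enc_cq Q)" if "q \<in> set Q" for q
        using length_body_le_size[of q] size_enc_list_member[OF that, of enc_cq] by linarith
      moreover have "1 \<le> length Q" using that by (cases Q) (auto simp: UCQ_class_def is_UCQ_def)
      ultimately show ?thesis
        unfolding sz using length_le_size_enc_list[of Q enc_cq] by auto
    qed
    show "computes M \<rho> (LearnP (top_cq S k)) (enc_list enc_cq H) (t + 1)"
      if "computes M \<rho> (LearnP (top_cq S k)) (enc_list enc_cq H) t" for M \<rho> H t
      by (rule computes_mono[OF that]) simp
  qed (auto simp: UCQ_class_def flip_free_LearnP)
qed

end
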